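(* Let $n\ge 1$ and $(k,q)\in\{(1,4),(2,3)\}$. Let $(C_1,\ldots,C_{n+2})$ be the random sequence in $\{1,\ldots,q\}^{n+2}$ produced by the Eden-model cycle coloring construction with $q$ colors (defined in the context), and let $(X_i)_{i\in\mathbb Z}$ be the Holroyd–Liggett stationary $k$-dependent $q$-coloring of $\mathbb Z$ (defined in the context). Then $(C_1,\ldots,C_{n+2})$ is a $k$-dependent proper $q$-coloring of the $(n+2)$-cycle. The coloring is symmetric in law under rotations and reflections of the cycle and under permutations of the colors. Moreover, $(C_1,\ldots,C_{n+2-k})$ is equal in law to $(X_1,\ldots,X_{n+2-k})$.
   Context: **Dependence.** A random process indexed by the vertex set of a graph is $k$-dependent if its restrictions to any two sets of vertices at graph distance greater than $k$ from each other are independent. The $m$-cycle has vertex set $\{1,\ldots,m\}$ with $i$ adjacent to $i+1$ modulo $m$. A proper $q$-coloring assigns colors in $\{1,\ldots,q\}$ to the vertices so that (almost surely, when random) adjacent vertices have different colors. **Eden-model cycle coloring.** Let $\mathbb T$ be the infinite 3-regular tree with a distinguished root vertex, embedded in the plane, and let $\mathbb D$ be its planar dual, an infinite-degree triangulation. For a vertex $v$ of $\mathbb T$, let $\Delta(v)$ be the set of the three vertices of $\mathbb D$ incident to the (triangular) face of $\mathbb D$ dual to $v$. Define random clusters $T_1,T_2,\ldots$ of vertices of $\mathbb T$: $T_1$ consists of the root; given $T_n$, choose a vertex uniformly at random from those adjacent to but not lying in $T_n$, and add it to $T_n$ to form $T_{n+1}$. Let $D_n$ be the subgraph of $\mathbb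 D$ induced by the vertex set $\bigcup_{v\in T_n}\Delta(v)$; it inherits a planar embedding with one outer face containing all of its $n+2$ vertices, all other faces being triangles. Conditional on $D_n$, choose a uniformly random proper $q$-coloring of $D_n$ and, independently, a uniformly random vertex $u$ of $D_n$. Let $C_1,\ldots,C_{n+2}$ be the sequence of colors of the vertices of the outer face in clockwise order starting from $u$. Equivalently (in law), this is the following necklace insertion procedure: start with a cyclic necklace of 3 beads with uniformly random distinct colors from $\{1,\ldots,q\}$; at each of $n-1$ steps, choose a uniformly random gap between consecutive beads and insert there a bead whose color is uniformly random among the colors different from those of its two neighbors; finally read the $n+2$ colors in clockwise order starting from an independent uniformly random bead. **Holroyd–Liggett coloring of $\mathbb Z$.** A word $x=x_1\cdots x_n\in\{1,\ldots,q\}^n$ is proper if $x_i\ne x_{i+1}$ for all $1\le i\le n-1$. Write $\hat x_i$ for the word of length $n-1$ obtained from $x$ by deleting its $i$-th letter. Define $\vec B(\emptyset)=1$ for the empty word and recursively $$\vec B(x)=\mathbf 1[x\text{ is proper}]\sum_{i=1}^n\vec B(\hat x_i),\qquad n\ge 1,\ x\in\{1,\ldots,q\}^n,$$ and let $\vec Z(n,q)=\sum_{y\in\{1,\ldots,q\}^n}\vec B(y)$. For $(k,q)\in\{(1,4),(2,3)\}$, the stationary $k$-dependent $q$-coloring $(X_i)_{i\in\mathbb Z}$ of Holroyd and Liggett is the stationary process whose law is characterized by $\mathbb P\bigl((X_1,\ldots,X_n)=x\bigr)=\vec B(x)/\vec Z(n,q)$ for all $n\ge 0$ and $x\in\{1,\ldots,q\}^n$.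 *)

theory Defs
  imports "HOL-Probability.Probability" "HOL-Combinatorics.Permutations"
begin

section \<open>Random processes indexed by a graph\<close>

text \<open>A graph is given by its symmetric set \<open>E\<close> of ordered edges; the distance is \<open>\<infinity>\<close>
  between different components.\<close>

definition graph_dist :: "('v \<times> 'v) set \<Rightarrow> 'v \<Rightarrow> 'v \<Rightarrow> enat" where
  "graph_dist E u v = (INF d\<in>{d. (u, v) \<in> E ^^ d}. enat d)"

definition k_dependent ::
  "'o measure \<Rightarrow> 'v set \<Rightarrow> ('v \<times> 'v) set \<Rightarrow> nat \<Rightarrow> ('v \<Rightarrow> 'o \<Rightarrow> 'c) \<Rightarrow> bool" where
  "k_dependent M V E k X \<longleftrightarrow>
     (\<forall>A B. A \<subseteq> V \<longrightarrow> B \<subseteq> V \<longrightarrow> (\<forall>a\<in>A. \<forall>b\<in>B. graph_dist E a b > enat k) \<longrightarrow>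
        prob_space.indep_var M
          (Pi\<^sub>M A (\<lambda>_. count_space UNIV)) (\<lambda>\<omega>. \<lambda>v\<in>A. X v \<omega>)
          (Pi\<^sub>M B (\<lambda>_. count_space UNIV)) (\<lambda>\<omega>. \<lambda>v\<in>B. X v \<omega>))"

definition proper_coloring :: "'v set \<Rightarrow> ('v \<times> 'v) set \<Rightarrow> nat \<Rightarrow> ('v \<Rightarrow> nat) \<Rightarrow> bool" where
  "proper_coloring V E q c \<longleftrightarrow>
     (\<forall>v\<in>V. c v \<in> {1..q}) \<and> (\<forall>u\<in>V. \<forall>v\<in>V. (u, v) \<in> E \<longrightarrow> c u \<noteq> c v)"

definition cycle_edges :: "nat \<Rightarrow> (nat \<times> nat) set" where
  "cycle_edges m = {(i, j). i \<in> {1..m} \<and> j \<in> {1..m} \<and>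
     (j mod m = (i + 1) mod m \<or> i mod m = (j + 1) mod m)}"


section \<open>The plane 3-regular tree and its dual\<close>

text \<open>The tree is modelled as the Cayley graph of the free product of three groups of order two:
  vertices are the words over three letters (the type \<open>3\<close> of integers modulo 3) without two equal
  consecutive letters, and the neighbour of \<open>v\<close> in direction \<open>a\<close> is obtained by putting
  \<open>a\<close> in front of \<open>v\<close> and cancelling. In particular both ends of an edge give it
  the same label. The plane embedding is the one in which the directions
  \<open>a\<close>, \<open>a + 1\<close>, \<open>a + 2\<close> follow each other clockwise around every vertex.\<close>

type_synonym tvertex = "3 list"
type_synonym dart = "tvertex \<times> 3"

definition tree_vertices :: "tvertex set" where
  "tree_vertices = {v. distinct_adj v}"

fun neighbour :: "tvertex \<Rightarrow> 3 \<Rightarrow> tvertex" where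
  "neighbour [] a = [a]"
| "neighbour (b # v) a = (if a = b then v else a # b # v)"

definition root :: tvertex where
  "root = []"

text \<open>A dart \<open>(v, a)\<close> is the edge at \<open>v\<close> with label \<open>a\<close>, directed away from \<open>v\<close>.\<close>

definition darts :: "dart set" where
  "darts = tree_vertices \<times> UNIV"

definition rev_dart :: "dart \<Rightarrow> dart" where
  "rev_dart = (\<lambda>(v, a). (neighbour v a, a))"

text \<open>The face to the right of \<open>(v, a)\<close> has at \<open>v\<close> the corner between the directions
  \<open>a\<close> and \<open>a + 1\<close>, and at the other end \<open>w\<close> of the edge the corner between
  \<open>a - 1\<close> and \<open>a\<close>. Its boundary therefore continues along \<open>(w, a - 1)\<close>. A face of the plane
  tree, i.e. a vertex of the dual, is represented by the set of all darts that have it on their right.\<close>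

definition face_step :: "dart \<Rightarrow> dart" where
  "face_step = (\<lambda>(v, a). (neighbour v a, a - 1))"

type_synonym dvertex = "dart set"

definition right_face :: "dart \<Rightarrow> dvertex" where
  "right_face d = {e \<in> darts. \<exists>i. (face_step ^^ i) d = e \<or> (face_step ^^ i) e = d}"

definition left_face :: "dart \<Rightarrow> dvertex" where
  "left_face d = right_face (rev_dart d)"

definition dual_edges :: "(dvertex \<times> dvertex) set" where
  "dual_edges = {(left_face d, right_face d) | d. d \<in> darts}"

definition Delta :: "tvertex \<Rightarrow> dvertex set" where
  "Delta v = {right_face (v, a) | a. True}"


section \<open>The Eden-model cycle coloring\<close>

definition tree_boundary :: "tvertex set \<Rightarrow> tvertex set" where
  "tree_boundary S = {neighbour v a | v a. v \<in> S} - S"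

definition eden_grow :: "tvertex set \<Rightarrow> tvertex set pmf" where
  "eden_grow S = map_pmf (\<lambda>w. insert w S) (pmf_of_set (tree_boundary S))"

text \<open>The law of \<open>T\<^sub>n\<close>, for \<open>n \<ge> 1\<close>.\<close>

definition eden_cluster :: "nat \<Rightarrow> tvertex set pmf" where
  "eden_cluster n = ((\<lambda>p. bind_pmf p eden_grow) ^^ (n - 1)) (return_pmf {root})"

definition cluster_dual_vertices :: "tvertex set \<Rightarrow> dvertex set" where
  "cluster_dual_vertices S = (\<Union>v\<in>S. Delta v)"

definition dual_colorings :: "nat \<Rightarrow> tvertex set \<Rightarrow> (dvertex \<Rightarrow> nat) set" where
  "dual_colorings q S =
     {c \<in> extensional (cluster_dual_vertices S).
        proper_coloring (cluster_dual_vertices S) dual_edges q c}"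

text \<open>The edges on the outer face of the triangulation dual to the cluster \<open>S\<close> are those
  crossed by the darts leaving \<open>S\<close>. Looking along such a dart, i.e. away from \<open>S\<close>, moving
  clockwise around the triangulation means moving from left to right.\<close>

definition clockwise_next :: "tvertex set \<Rightarrow> dvertex \<Rightarrow> dvertex" where
  "clockwise_next S f =
     (THE g. \<exists>v\<in>S. \<exists>a. neighbour v a \<notin> S \<and> f = left_face (v, a) \<and> g = right_face (v, a))"

text \<open>The law of \<open>[C\<^sub>1, \<dots>, C\<^sub>n\<^sub>+\<^sub>2]\<close>.\<close>

definition eden_cycle_coloring :: "nat \<Rightarrow> nat \<Rightarrow> nat list pmf" where
  "eden_cycle_coloring q n =
     bind_pmf (eden_cluster n) (\<lambda>S.
     bind_pmf (pmf_of_set (dual_colorings q S)) (\<lambda>c.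
     map_pmf (\<lambda>u. map (\<lambda>i. c ((clockwise_next S ^^ i) u)) [0..<n + 2])
       (pmf_of_set (cluster_dual_vertices S))))"

definition C :: "nat \<Rightarrow> nat list \<Rightarrow> nat" where
  "C i xs = xs ! (i - 1)"


section \<open>The Holroyd--Liggett colorings of the integers\<close>

definition words :: "nat \<Rightarrow> nat \<Rightarrow> nat list set" where
  "words q n = {x. length x = n \<and> set x \<subseteq> {1..q}}"

definition delete_nth :: "nat \<Rightarrow> 'a list \<Rightarrow> 'a list" where
  "delete_nth i x = take i x @ drop (Suc i) x"

function B_lin :: "nat list \<Rightarrow> nat" where
  "B_lin x =
     (if x = [] then 1
      else if distinct_adj x then (\<Sum>i<length x. B_lin (delete_nth i x))
      else 0)"
  by auto
termination
  by (relation "Wellfounded.measure length") (auto simp: delete_nth_def)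

declare B_lin.simps [simp del]

definition Z_lin :: "nat \<Rightarrow> nat \<Rightarrow> nat" where
  "Z_lin n q = (\<Sum>y\<in>words q n. B_lin y)"

definition stationary :: "'o measure \<Rightarrow> (int \<Rightarrow> 'o \<Rightarrow> nat) \<Rightarrow> bool" where
  "stationary M X \<longleftrightarrow>
     distr M (Pi\<^sub>M UNIV (\<lambda>_. count_space UNIV)) (\<lambda>\<omega> i. X (i + 1) \<omega>) =
     distr M (Pi\<^sub>M UNIV (\<lambda>_. count_space UNIV)) (\<lambda>\<omega> i. X i \<omega>)"

text \<open>\<open>initial_word X m\<close> is \<open>[X\<^sub>1, \<dots>, X\<^sub>m]\<close>.\<close>

definition initial_word :: "(int \<Rightarrow> 'o \<Rightarrow> nat) \<Rightarrow> nat \<Rightarrow> 'o \<Rightarrow> nat list" where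
  "initial_word X m \<omega> = map (\<lambda>i. X (int i) \<omega>) [1..<Suc m]"

definition holroyd_liggett_coloring :: "nat \<Rightarrow> 'o measure \<Rightarrow> (int \<Rightarrow> 'o \<Rightarrow> nat) \<Rightarrow> bool" where
  "holroyd_liggett_coloring q M X \<longleftrightarrow>
     prob_space M \<and> (\<forall>i. X i \<in> measurable M (count_space UNIV)) \<and> stationary M X \<and>
     (\<forall>m. \<forall>x\<in>words q m.
        measure M {\<omega> \<in> space M. initial_word X m \<omega> = x} = real (B_lin x) / real (Z_lin m q))"

end

theory Submission
  imports Defs "HOL-Library.Sublist"
begin

text \<open>The whole theorem rests on one recursion. If the beads of a necklace are inserted one at a time
  into uniformly random gaps and the necklace is read from a uniformly random bead, then the bead
  inserted last is equally likely to sit at each position, and its color is uniform among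
  \<open>q - 2\<close> colors, because the neighbours of a gap always have different colors. Hence the
  probability of a cyclically proper word is, up to a factor depending only on its length, the sum
  of the probabilities of the words obtained by deleting one letter (\<open>pmf_eden_Suc\<close>). The
  solution of this recursion is the function \<open>necklace_weight\<close> (\<open>pmf_eden\<close>), and its
  invariance under rotations, reflections and permutations of the colors is visible from the
  recursion.

  The function \<open>B_lin\<close> satisfies the same recursion on linear words. To treat both at once,
  necklaces may contain beads of the extra color \<open>0\<close> that are never deleted: a linear word
  \<open>x\<close> is the necklace \<open>0 # x\<close>. Now sum the weight over the color of one bead, or of two
  adjacent beads, called the gap. The deletions of the other beads reproduce the same sum for
  shorter necklaces. What is left over is the deletion of the gap beads themselves minus the terms
  in which deleting a neighbour of the gap makes a forbidden color available; it is a
  multiple of the weight, or of the sum over a smaller gap, and the multiple is \<open>q - 4\<close> for a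
  gap of one bead and \<open>2 * q - 6\<close> for two (\<open>gap1_rec\<close>, \<open>gap2_rec\<close>), if neither
  neighbour has color \<open>0\<close>. So for \<open>(k, q) = (1, 4)\<close> and \<open>(2, 3)\<close> it vanishes.
  For necklaces without \<open>0\<close>, the sum over a gap of length \<open>k\<close> therefore obeys the recursion
  of \<open>B_lin\<close> (\<open>cyclic_gap\<close>): forgetting \<open>k\<close> consecutive beads of the cycle leaves the law
  of the Holroyd--Liggett coloring. For a necklace with one \<open>0\<close>, the sum obeys the recursion of
  a product \<open>B_lin x * B_lin y\<close> up to Pascal's rule (\<open>linear_gap\<close>): in that law, the words on
  the two sides of \<open>k\<close> consecutive positions are independent. Two nonempty sets of vertices at distance
  greater than \<open>k\<close> on the cycle leave a window of \<open>k\<close> free vertices somewhere; rotating it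
  to the end and cutting the remaining interval repeatedly gives the independence of the two sets
  (\<open>independent_blocks\<close>, \<open>cycle_independence\<close>).

  It remains to see that the Eden model is the necklace procedure. The darts that leave a cluster,
  listed clockwise, form a list that determines the outer face (\<open>boundary_walk\<close>). Adding a vertex
  replaces one dart by two and adds one face; that face lies entirely in the new branch of the tree,
  so among the earlier faces only the two along the replaced dart are adjacent to it
  (\<open>new_face_neighbour\<close>). A uniform coloring of the new triangulation is thus a uniform coloring
  of the old one with a uniformly chosen admissible color for the new vertex
  (\<open>dual_colorings_step\<close>, \<open>boundary_word_Suc\<close>).\<close>

section \<open>Cyclic words and deletion of letters\<close>

lemma delete_nth_Cons_0 [simp]: "delete_nth 0 (a # z) = z"
  by (simp add: delete_nth_def)

lemma delete_nth_Cons_Suc [simp]: "delete_nth (Suc i) (a # z) = a # delete_nth i z"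
  by (simp add: delete_nth_def)

lemma length_delete_nth: "i < length z \<Longrightarrow> length (delete_nth i z) = length z - 1"
  by (simp add: delete_nth_def)

lemma set_delete_nth: "set (delete_nth i z) \<subseteq> set z"
  by (auto simp: delete_nth_def dest: in_set_takeD in_set_dropD)

text \<open>The letter \<open>0\<close> marks places that are not deleted. Functions rather than
  words are summed, so that the rules for \<open>Cons\<close> and \<open>append\<close> can push a
  fixed context into the function.\<close>

definition deletions :: "(nat list \<Rightarrow> real) \<Rightarrow> nat list \<Rightarrow> real" where
  "deletions f z = (\<Sum>i<length z. if z ! i = 0 then 0 else f (delete_nth i z))"

lemma deletions_Nil [simp]: "deletions f [] = 0"
  by (simp add: deletions_def)

lemma deletions_Cons:
  "deletions f (a # z) = (if a = 0 then 0 else f z) + deletions (\<lambda>z'. f (a # z')) z"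
  unfolding deletions_def by (simp add: sum.lessThan_Suc_shift del: sum.lessThan_Suc cong: if_cong)

lemma deletions_append:
  "deletions f (x @ y) = deletions (\<lambda>x'. f (x' @ y)) x + deletions (\<lambda>y'. f (x @ y')) y"
  by (induction x arbitrary: f) (simp_all add: deletions_Cons)

lemma deletions_cong:
  assumes "\<And>i. i < length z \<Longrightarrow> z ! i \<noteq> 0 \<Longrightarrow> f (delete_nth i z) = g (delete_nth i z)"
  shows "deletions f z = deletions g z"
  unfolding deletions_def using assms by (intro sum.cong) auto

lemma deletions_scale: "deletions (\<lambda>z'. c * f z') z = c * deletions f z"
  unfolding deletions_def by (simp add: sum_distrib_left if_distrib cong: if_cong)

lemma deletions_sum: "deletions (\<lambda>z'. \<Sum>a\<in>A. f a z') z = (\<Sum>a\<in>A. deletions (f a) z)"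
  unfolding deletions_def by (subst sum.swap) (auto intro!: sum.cong)

lemma deletions_eq_0: "(\<And>z'. f z' = 0) \<Longrightarrow> deletions f z = 0"
  by (simp add: deletions_def cong: if_cong)

lemma deletions_rev: "deletions f (rev z) = deletions (\<lambda>z'. f (rev z')) z"
  by (induction z arbitrary: f) (simp_all add: deletions_Cons deletions_append)

lemma deletions_map:
  assumes "\<And>a. a \<in> set z \<Longrightarrow> \<pi> a = 0 \<longleftrightarrow> a = 0"
  shows "deletions f (map \<pi> z) = deletions (\<lambda>z'. f (map \<pi> z')) z"
  using assms by (induction z arbitrary: f) (simp_all add: deletions_Cons)

definition cyc_proper :: "nat list \<Rightarrow> bool" where
  "cyc_proper z \<longleftrightarrow> distinct_adj z \<and> (z \<noteq> [] \<longrightarrow> last z \<noteq> hd z)"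

lemma cyc_proper_rotate1: "cyc_proper (rotate1 z) \<longleftrightarrow> cyc_proper z"
  by (cases z) (auto simp: cyc_proper_def distinct_adj_append_iff distinct_adj_Cons)

lemma cyc_proper_rev: "cyc_proper (rev z) \<longleftrightarrow> cyc_proper z"
  by (auto simp: cyc_proper_def hd_rev last_rev)

lemma cyc_proper_map: 
  assumes "inj_on \<pi> (set z)" shows "cyc_proper (map \<pi> z) \<longleftrightarrow> cyc_proper z"
  using assms by (auto simp: cyc_proper_def hd_map last_map distinct_adj_map_iff inj_on_eq_iff)

text \<open>Up to constants, the number of orders in which the letters of a cyclic word can be
  deleted so that every intermediate word is cyclically proper; letters \<open>0\<close> stay.
  Words of length at most two are the base, since a cyclic word of length one is never proper. The
  value at \<open>[0]\<close> belongs to the empty linear word.\<close>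

function necklace_weight :: "nat list \<Rightarrow> real" where
  "necklace_weight z =
     (if length z \<le> 2 then (if z = [0] \<or> length z = 2 \<and> cyc_proper z then 1 else 0)
      else if cyc_proper z then (\<Sum>i<length z. if z ! i = 0 then 0 else necklace_weight (delete_nth i z))
      else 0)"
  by auto
termination
  by (relation "Wellfounded.measure length") (auto simp: delete_nth_def)

declare necklace_weight.simps [simp del]

lemma necklace_weight_short: "length z \<le> 2 \<Longrightarrow> necklace_weight z = (if z = [0] \<or> length z = 2 \<and> cyc_proper z then 1 else 0)"
  by (subst necklace_weight.simps) simp

lemma necklace_weight_rec: "length z \<ge> 3 \<Longrightarrow> necklace_weight z = (if cyc_proper z then deletions necklace_weight z else 0)"
  by (subst necklace_weight.simps) (simp add: deletions_def)

lemma necklace_weight_improper: "\<not> cyc_proper z \<Longrightarrow> z \<noteq> [0] \<Longrightarrow> necklace_weight z = 0"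
  by (subst necklace_weight.simps) simp

text \<open>Deleting the letter at \<open>i + 1\<close> and rotating is deleting the letter at
  \<open>i\<close> of the rotated word, so the two deletion sums agree term by term.\<close>

lemma necklace_weight_rotate1: "necklace_weight (rotate1 z) = necklace_weight z"
proof (induction z rule: length_induct)
  case (1 z)
  show ?case
  proof (cases "length z \<le> 2")
    case True
    have "rotate1 z = [0] \<longleftrightarrow> z = [0]"
      by (cases z) (auto simp: append_eq_Cons_conv)
    then show ?thesis
      using True by (simp add: necklace_weight_short cyc_proper_rotate1)
  next
    case False
    then obtain a y where z: "z = a # y" by (cases z) auto
    have *: "necklace_weight (delete_nth i y @ [a]) = necklace_weight (a # delete_nth i y)" if "i < length y" for i
      using 1 [rule_format, of "a # delete_nth i y"] that by (simp add: z length_delete_nth)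
    have "deletions necklace_weight (y @ [a]) = deletions necklace_weight (a # y)"
      unfolding deletions_append deletions_Cons using *
      by (auto intro!: deletions_cong)
    then show ?thesis
      using False cyc_proper_rotate1[of z] by (simp add: necklace_weight_rec z)
  qed
qed

lemma necklace_weight_rotate: "necklace_weight (rotate r z) = necklace_weight z"
  by (induction r) (simp_all add: necklace_weight_rotate1)

lemma necklace_weight_append_commute: "necklace_weight (x @ y) = necklace_weight (y @ x)"
  by (metis necklace_weight_rotate rotate_append)

lemma necklace_weight_rev: "necklace_weight (rev z) = necklace_weight z"
proof (induction z rule: length_induct)
  case (1 z)
  show ?case
  proof (cases "length z \<le> 2")
    case True
    have "rev z = [0] \<longleftrightarrow> z = [0]" by (metis rev_singleton_conv)
    then show ?thesis
      using True by (simp add: necklace_weight_short cyc_proper_rev)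
  next
    case False
    have "deletions (\<lambda>z'. necklace_weight (rev z')) z = deletions necklace_weight z"
      using 1 by (intro deletions_cong) (simp add: length_delete_nth)
    then show ?thesis
      using False by (simp add: necklace_weight_rec cyc_proper_rev deletions_rev)
  qed
qed

lemma necklace_weight_map:
  assumes "inj_on \<pi> (set z)" "\<And>a. a \<in> set z \<Longrightarrow> \<pi> a = 0 \<longleftrightarrow> a = 0"
  shows "necklace_weight (map \<pi> z) = necklace_weight z"
  using assms
proof (induction z rule: length_induct)
  case (1 z)
  show ?case
  proof (cases "length z \<le> 2")
    case True
    have "map \<pi> z = [0] \<longleftrightarrow> z = [0]" using 1(3) by (auto simp: map_eq_Cons_conv)
    then show ?thesis
      using True 1 by (simp add: necklace_weight_short cyc_proper_map)
  next
    case False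
    have "deletions (\<lambda>z'. necklace_weight (map \<pi> z')) z = deletions necklace_weight z"
    proof (rule deletions_cong)
      fix i assume i: "i < length z"
      show "necklace_weight (map \<pi> (delete_nth i z)) = necklace_weight (delete_nth i z)"
        using set_delete_nth[of i z] i 1(2,3)
        by (intro 1(1)[rule_format]) (auto simp: length_delete_nth intro: inj_on_subset)
    qed
    then show ?thesis
      using False 1 by (simp add: necklace_weight_rec cyc_proper_map deletions_map)
  qed
qed

lemma B_lin_improper: "\<not> distinct_adj x \<Longrightarrow> B_lin x = 0"
  by (subst B_lin.simps) auto

lemma B_lin_rec:
  assumes "0 \<notin> set x" "x \<noteq> []" "distinct_adj x"
  shows "real (B_lin x) = deletions (\<lambda>x'. real (B_lin x')) x"
proof -
  have "\<forall>i<length x. x ! i \<noteq> 0" using assms by (metis nth_mem)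
  then have "deletions (\<lambda>x'. real (B_lin x')) x = (\<Sum>i<length x. real (B_lin (delete_nth i x)))"
    unfolding deletions_def by (intro sum.cong) auto
  then show ?thesis
    using assms by (subst B_lin.simps) simp
qed

text \<open>The undeletable bead acts as a cut: no letter of \<open>x\<close> equals
  \<open>0\<close>, hence cyclic properness of \<open>0 # x\<close> is properness of
  \<open>x\<close>, and the deletions are those of the linear recursion.\<close>

lemma necklace_weight_0_Cons: "0 \<notin> set x \<Longrightarrow> necklace_weight (0 # x) = real (B_lin x)"
proof (induction x rule: length_induct)
  case (1 x)
  consider "x = []" | a where "x = [a]" | "length x \<ge> 2"
    by (metis One_nat_def Suc_1 length_0_conv length_Suc_conv less_2_cases not_less)
  then show ?case
  proof cases
    case 1
    then show ?thesis by (simp add: necklace_weight_short B_lin.simps)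
  next
    case 2
    have "B_lin [a] = 1"
      by (subst B_lin.simps) (simp add: B_lin.simps[of "[]"])
    then show ?thesis using 2 1(2) by (simp add: necklace_weight_short cyc_proper_def)
  next
    case 3
    have cp: "cyc_proper (0 # x) \<longleftrightarrow> distinct_adj x"
      using 1(2) 3 unfolding cyc_proper_def distinct_adj_Cons
      by (metis hd_in_set last.simps last_in_set list.sel(1) list.size(3) not_numeral_le_zero)
    have "deletions (\<lambda>x'. necklace_weight (0 # x')) x = deletions (\<lambda>x'. real (B_lin x')) x"
    proof (rule deletions_cong)
      fix i assume "i < length x"
      then show "necklace_weight (0 # delete_nth i x) = real (B_lin (delete_nth i x))"
        using 1 set_delete_nth[of i x] by (intro 1(1)[rule_format]) (auto simp: length_delete_nth)
    qed
    moreover have "x \<noteq> []" using 3 by auto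
    ultimately show ?thesis
      using 3 cp 1(2) B_lin_rec[of x] by (simp add: necklace_weight_rec deletions_Cons B_lin_improper)
  qed
qed

section \<open>Summing over the colors of a gap\<close>

text \<open>By rotation invariance the gap may be taken at the end of the word, between the last
  and the first letter of \<open>z\<close>.\<close>

definition gap1 :: "nat \<Rightarrow> nat list \<Rightarrow> real" where
  "gap1 q z = (\<Sum>a\<in>{1..q}. necklace_weight (z @ [a]))"

definition gap2 :: "nat \<Rightarrow> nat list \<Rightarrow> real" where
  "gap2 q z = (\<Sum>a\<in>{1..q}. gap1 q (z @ [a]))"

lemma gap1_improper: "\<not> distinct_adj z \<Longrightarrow> gap1 q z = 0"
  by (auto simp: gap1_def cyc_proper_def distinct_adj_append_iff append_eq_Cons_conv intro!: sum.neutral necklace_weight_improper)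

lemma gap2_improper: "\<not> distinct_adj z \<Longrightarrow> gap2 q z = 0"
  by (auto simp: gap2_def distinct_adj_append_iff intro!: sum.neutral gap1_improper)

text \<open>For an admissible color \<open>a\<close> of the gap bead, the recursion gives the
  deletions inside \<open>z\<close> and, for deleting the gap bead, the weight of
  \<open>z\<close>. The sum over all \<open>a\<close> of the deletions inside \<open>z\<close>
  would be the gap sum of the shorter words, but the two inadmissible colors are missing. For
  \<open>a = hd z\<close> only the deletion of the first letter survives, and it turns \<open>z @
  [a]\<close> into a rotation of \<open>z\<close>; the last letter is similar. Each deletable end
  therefore costs two copies of the weight of \<open>z\<close>: one for the missing color, one for
  the correction.\<close>

lemma gap1_rec:
  assumes "distinct_adj z" "set z \<subseteq> {0..q}" "z = [0] \<or> length z \<ge> 2"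
  shows "gap1 q z = deletions (gap1 q) z
           + (real q - 2 * of_bool (hd z \<noteq> 0) - 2 * of_bool (last z \<noteq> 0)) * necklace_weight z"
proof (cases "length z \<ge> 2")
  case True
  then have [simp]: "z \<noteq> []" by auto
  define T where "T a = deletions (\<lambda>z'. necklace_weight (z' @ [a])) z" for a
  \<comment> \<open>the deletion terms for the two forbidden colors, which are not part of the gap sum\<close>
  have T_hd: "T a = necklace_weight z" if "a = hd z" "a \<noteq> 0" for a
  proof -
    have "z = a # tl z" using \<open>a = hd z\<close> by simp
    then obtain y where z: "z = a # y" ..
    have "necklace_weight (y @ [a]) = necklace_weight z" using necklace_weight_rotate1[of z] by (simp add: z)
    moreover have "deletions (\<lambda>y'. necklace_weight (a # y' @ [a])) y = 0"
      using that(2) by (intro deletions_eq_0 necklace_weight_improper) (auto simp: cyc_proper_def)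
    ultimately show ?thesis using that(2) by (simp add: T_def z deletions_Cons)
  qed
  have T_last: "T a = necklace_weight z" if "a = last z" "a \<noteq> 0" for a
  proof -
    have "z = butlast z @ [a]" using \<open>a = last z\<close> by simp
    then obtain y where z: "z = y @ [a]" ..
    have "deletions (\<lambda>y'. necklace_weight (y' @ [a, a])) y = 0"
      by (intro deletions_eq_0 necklace_weight_improper)
         (auto simp: cyc_proper_def distinct_adj_append_iff append_eq_Cons_conv)
    then show ?thesis using that(2) by (simp add: T_def z deletions_append deletions_Cons)
  qed
  have letter: "necklace_weight (z @ [a]) = T a + necklace_weight z
      - 2 * (of_bool (a = hd z) * necklace_weight z) - 2 * (of_bool (a = last z) * necklace_weight z)"
    if a: "a \<in> {1..q}" for a
  proof -
    have cp: "cyc_proper (z @ [a]) \<longleftrightarrow> a \<noteq> hd z \<and> a \<noteq> last z"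
      using assms(1) by (auto simp: cyc_proper_def distinct_adj_append_iff)
    show ?thesis
    proof (cases "a = hd z \<or> a = last z")
      case False
      then show ?thesis
        using a True cp by (simp add: necklace_weight_rec deletions_append deletions_Cons T_def)
    next
      case eq: True
      \<comment> \<open>if the ends agree, a single color is excluded, but then all the terms counted twice are zero\<close>
      have "necklace_weight z = 0" if "hd z = last z"
        using that True by (intro necklace_weight_improper) (auto simp: cyc_proper_def)
      moreover have "necklace_weight (z @ [a]) = 0" using eq cp by (intro necklace_weight_improper) auto
      moreover have "T a = necklace_weight z" using eq T_hd T_last a by force
      ultimately show ?thesis using eq by auto
    qed
  qed
  have delta: "(\<Sum>a\<in>{1..q}. of_bool (a = b) * necklace_weight z) = of_bool (b \<noteq> 0) * necklace_weight z"
    if "b \<in> set z" for b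
    using that assms(2) by (auto simp: of_bool_def if_distrib[of "\<lambda>c. c * _"] cong: if_cong)
  have "gap1 q z = (\<Sum>a\<in>{1..q}. T a) + real q * necklace_weight z
      - 2 * (\<Sum>a\<in>{1..q}. of_bool (a = hd z) * necklace_weight z)
      - 2 * (\<Sum>a\<in>{1..q}. of_bool (a = last z) * necklace_weight z)"
    unfolding gap1_def using letter
    by (simp add: sum.distrib sum_subtractf sum_distrib_left del: sum_of_bool_mult_eq sum_mult_of_bool_eq)
  also have "(\<Sum>a\<in>{1..q}. T a) = deletions (gap1 q) z"
    unfolding T_def gap1_def[abs_def] deletions_sum ..
  finally show ?thesis by (simp only: delta[OF hd_in_set[OF \<open>z \<noteq> []\<close>]] delta[OF last_in_set[OF \<open>z \<noteq> []\<close>]]) (simp add: algebra_simps)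
next
  case False
  then show ?thesis using assms(3)
    by (auto simp: gap1_def necklace_weight_short cyc_proper_def deletions_Cons)
qed

text \<open>The second gap bead is adjacent to the last letter of \<open>z\<close> through the
  first one only, so the argument of \<open>gap1_rec\<close> is repeated at one end, and the
  correction at the other end comes from \<open>gap1_rec\<close> for \<open>z @ [a]\<close>, whose
  last letter \<open>a\<close> is deletable.\<close>

lemma gap2_rec:
  assumes "distinct_adj z" "set z \<subseteq> {0..q}" "z \<noteq> []"
  shows "gap2 q z = deletions (gap2 q) z
           + (2 * real q - 2 - 2 * of_bool (hd z \<noteq> 0) - 2 * of_bool (last z \<noteq> 0)) * gap1 q z"
proof -
  define T where "T a = deletions (\<lambda>z'. gap1 q (z' @ [a])) z" for a
  define e where "e = real q - 2 * of_bool (hd z \<noteq> 0) - 2"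
  have letter: "gap1 q (z @ [a]) = T a + gap1 q z - 2 * (of_bool (a = last z) * gap1 q z)
      + e * necklace_weight (z @ [a])" if a: "a \<in> {1..q}" for a
  proof (cases "a = last z")
    case False
    then have "distinct_adj (z @ [a])" using assms by (auto simp: distinct_adj_append_iff)
    moreover have "length (z @ [a]) \<ge> 2" using assms(3) by (cases z) auto
    ultimately have "gap1 q (z @ [a]) = deletions (gap1 q) (z @ [a]) + e * necklace_weight (z @ [a])"
      using gap1_rec[of "z @ [a]" q] assms a by (simp add: e_def)
    then show ?thesis using a False by (simp add: T_def deletions_append deletions_Cons)
  next
    case True
    obtain y where z: "z = y @ [a]" using True by (metis assms(3) append_butlast_last_id)
    have "deletions (\<lambda>y'. gap1 q (y' @ [a, a])) y = 0"
      by (intro deletions_eq_0 gap1_improper) (auto simp: distinct_adj_append_iff)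
    then have "T a = gap1 q z" using a by (simp add: T_def z deletions_append deletions_Cons)
    moreover have "gap1 q (z @ [a]) = 0" 
      using True assms(3) by (intro gap1_improper) (auto simp: distinct_adj_append_iff)
    moreover have "necklace_weight (z @ [a]) = 0" 
      using True assms(3) by (intro necklace_weight_improper) (auto simp: cyc_proper_def distinct_adj_append_iff)
    ultimately show ?thesis using True by simp
  qed
  have delta: "(\<Sum>a\<in>{1..q}. of_bool (a = last z) * gap1 q z) = of_bool (last z \<noteq> 0) * gap1 q z"
    using assms(2) last_in_set[OF assms(3)]
    by (auto simp: of_bool_def if_distrib[of "\<lambda>c. c * _"] cong: if_cong)
  have "gap2 q z = (\<Sum>a\<in>{1..q}. T a) + real q * gap1 q z
      - 2 * (\<Sum>a\<in>{1..q}. of_bool (a = last z) * gap1 q z) + e * gap1 q z"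
    unfolding gap2_def using letter
    by (simp add: sum.distrib sum_subtractf sum_distrib_left gap1_def[of q z])
  also have "(\<Sum>a\<in>{1..q}. T a) = deletions (gap2 q) z"
    unfolding T_def gap2_def[abs_def] deletions_sum ..
  finally show ?thesis unfolding delta e_def by (simp add: algebra_simps)
qed

section \<open>Gaps in cyclic and in linear words\<close>

lemma words_not_0: "x \<in> words q n \<Longrightarrow> 0 \<notin> set x"
  by (auto simp: words_def)

lemma delete_nth_words: "x \<in> words q n \<Longrightarrow> i < n \<Longrightarrow> delete_nth i x \<in> words q (n - 1)"
  using set_delete_nth[of i x] by (auto simp: words_def length_delete_nth)

lemma finite_words [simp]: "finite (words q n)"
  unfolding words_def using finite_lists_length_eq[of "{1..q}" n] by (simp add: conj_commute)

lemma words_0 [simp]: "words q 0 = {[]}"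
  by (auto simp: words_def)

lemma sum_words_append:
  "(\<Sum>z\<in>words q (m + n). f z) = (\<Sum>x\<in>words q m. \<Sum>y\<in>words q n. f (x @ y))"
proof -
  have "(\<Sum>z\<in>words q (m + n). f z) = (\<Sum>(x, y)\<in>words q m \<times> words q n. f (x @ y))"
    by (rule sum.reindex_bij_witness[of _ "\<lambda>(x, y). x @ y" "\<lambda>z. (take m z, drop m z)"])
       (auto simp: words_def dest: in_set_takeD in_set_dropD)
  then show ?thesis by (simp add: sum.cartesian_product)
qed

lemma sum_words_1: "(\<Sum>w\<in>words q (Suc 0). f w) = (\<Sum>a\<in>{1..q}. f [a])"
  by (rule sum.reindex_bij_witness[of _ "\<lambda>a. [a]" hd])
     (auto simp: words_def length_Suc_conv)

definition gap :: "nat \<Rightarrow> nat \<Rightarrow> nat list \<Rightarrow> real" where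
  "gap k q z = (\<Sum>w\<in>words q k. necklace_weight (z @ w))"

lemma gap_1: "gap 1 q z = gap1 q z"
  by (simp add: gap_def gap1_def sum_words_1)

lemma gap_2: "gap 2 q z = gap2 q z"
  using sum_words_append[of "\<lambda>w. necklace_weight (z @ w)" q 1 1]
  by (simp add: gap_def gap2_def gap1_def sum_words_1 numeral_2_eq_2)

text \<open>The coefficient in \<open>gap1_rec\<close> is \<open>4 - 2 - 2 = 0\<close>, so both
  sides satisfy the recursion of \<open>B_lin\<close>; the constant is the number of colors
  different from a single letter.\<close>

lemma cyclic_gap1:
  assumes "z \<in> words 4 n" "n \<ge> 1"
  shows "gap1 4 z = 3 * real (B_lin z)"
  using assms
proof (induction n arbitrary: z)
  case (Suc n)
  have z0: "0 \<notin> set z" and z4: "set z \<subseteq> {0..4}" and len: "length z = Suc n"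
    using Suc.prems by (auto simp: words_def)
  show ?case
  proof (cases "distinct_adj z")
    case adj: True
    show ?thesis
    proof (cases "n = 0")
      case True
      then obtain a where z: "z = [a]" "a \<in> {1..4}"
        using Suc.prems by (auto simp: words_def length_Suc_conv)
      have "gap1 4 z = (\<Sum>b\<in>{1..4}. if b = a then 0 else 1)"
        unfolding gap1_def by (intro sum.cong) (auto simp: z necklace_weight_short cyc_proper_def)
      also have "\<dots> = 3" using z(2) by (simp add: sum.If_cases Diff_eq[symmetric] card_Diff_singleton) 
      finally show ?thesis
        using z B_lin_rec[of z] z0 by (simp add: deletions_Cons B_lin.simps[of "[]"])
    next
      case False
      then have [simp]: "z \<noteq> []" using len by auto
      have "deletions (gap1 4) z = deletions (\<lambda>z'. 3 * real (B_lin z')) z"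
        using False len Suc.prems by (intro deletions_cong Suc.IH) (auto dest: delete_nth_words)
      moreover have "hd z \<noteq> 0" "last z \<noteq> 0"
        using z0 by (metis \<open>z \<noteq> []\<close> hd_in_set, metis \<open>z \<noteq> []\<close> last_in_set)
      ultimately show ?thesis
        using gap1_rec[OF adj z4] False len z0 adj by (simp add: deletions_scale B_lin_rec)
    qed
  qed (simp add: gap1_improper B_lin_improper)
qed simp

text \<open>Here the coefficient in \<open>gap2_rec\<close> is \<open>6 - 2 - 2 - 2 = 0\<close>,
  and the constant \<open>6\<close> is the gap sum of the empty word.\<close>

lemma cyclic_gap2:
  assumes "z \<in> words 3 n" "n \<ge> 1"
  shows "gap2 3 z = 6 * real (B_lin z)"
  using assms
proof (induction n arbitrary: z)
  case (Suc n)
  have z0: "0 \<notin> set z" and z4: "set z \<subseteq> {0..3}" and len: "length z = Suc n"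
    using Suc.prems by (auto simp: words_def)
  then have [simp]: "z \<noteq> []" by auto
  have ends: "hd z \<noteq> 0" "last z \<noteq> 0"
    using z0 by (metis \<open>z \<noteq> []\<close> hd_in_set, metis \<open>z \<noteq> []\<close> last_in_set)
  show ?case
  proof (cases "distinct_adj z")
    case adj: True
    have rec: "gap2 3 z = deletions (gap2 3) z"
      using gap2_rec[OF adj z4] ends by simp
    show ?thesis
    proof (cases "n = 0")
      case True
      then obtain a where z: "z = [a]" using len by (auto simp: length_Suc_conv)
      have [simp]: "{1..3::nat} = {1,2,3}" by auto
      have "gap2 3 [] = 6"
        by (simp add: gap2_def gap1_def necklace_weight_short cyc_proper_def del: One_nat_def)
      then show ?thesis
        using rec ends z B_lin_rec[of z] z0 by (simp add: deletions_Cons B_lin.simps[of "[]"])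
    next
      case False
      have "deletions (gap2 3) z = deletions (\<lambda>z'. 6 * real (B_lin z')) z"
        using False len Suc.prems by (intro deletions_cong Suc.IH) (auto dest: delete_nth_words)
      then show ?thesis
        using rec z0 adj by (simp add: deletions_scale B_lin_rec)
    qed
  qed (simp add: gap2_improper B_lin_improper)
qed simp

text \<open>The deletions of \<open>y @ 0 # x\<close> fall into those of \<open>x\<close> and
  those of \<open>y\<close>, and summing a product over the deletions of one factor restores that
  factor. Only the constants are added, which is where Pascal's rule enters below.\<close>

lemma deletions_gap_product:
  assumes x: "x \<in> words q m" and y: "y \<in> words q n" and adj: "distinct_adj x" "distinct_adj y"
    and x': "\<And>x'. m \<ge> 1 \<Longrightarrow> x' \<in> words q (m - 1) \<Longrightarrow> g (y @ 0 # x') = c1 * real (B_lin x') * real (B_lin y)"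
    and y': "\<And>y'. n \<ge> 1 \<Longrightarrow> y' \<in> words q (n - 1) \<Longrightarrow> g (y' @ 0 # x) = c2 * real (B_lin x) * real (B_lin y')"
  shows "deletions g (y @ 0 # x) = 
    (of_bool (m \<ge> 1) * c1 + of_bool (n \<ge> 1) * c2) * real (B_lin x) * real (B_lin y)"
proof -
  have len: "length x = m" "length y = n" using x y by (auto simp: words_def)
  have "deletions (\<lambda>x'. g (y @ 0 # x')) x = deletions (\<lambda>x'. (c1 * real (B_lin y)) * real (B_lin x')) x"
    using x x' len by (intro deletions_cong) (auto dest: delete_nth_words)
  also have "\<dots> = of_bool (m \<ge> 1) * c1 * real (B_lin x) * real (B_lin y)"
    using adj len B_lin_rec[OF words_not_0[OF x]]
    by (cases x) (auto simp: deletions_scale)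
  finally have 1: "deletions (\<lambda>x'. g (y @ 0 # x')) x = of_bool (m \<ge> 1) * c1 * real (B_lin x) * real (B_lin y)" .
  have "deletions (\<lambda>y'. g (y' @ 0 # x)) y = deletions (\<lambda>y'. (c2 * real (B_lin x)) * real (B_lin y')) y"
    using y y' len by (intro deletions_cong) (auto dest: delete_nth_words)
  also have "\<dots> = of_bool (n \<ge> 1) * c2 * real (B_lin x) * real (B_lin y)"
    using adj len B_lin_rec[OF words_not_0[OF y]]
    by (cases y) (auto simp: deletions_scale)
  finally show ?thesis using 1 by (simp add: deletions_append deletions_Cons algebra_simps)
qed

lemma ends_nonzero:
  fixes x :: "nat list"
  assumes "0 \<notin> set x" "x \<noteq> []"
  shows "0 < hd x \<and> 0 < last x"
proof -
  have "hd x \<in> set x" "last x \<in> set x" using assms by auto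
  then have "hd x \<noteq> 0" "last x \<noteq> 0" using assms(1) by metis+
  then show ?thesis by simp
qed

lemma distinct_adj_separated:
  fixes x y :: "nat list"
  assumes "0 \<notin> set x" "0 \<notin> set y"
  shows "distinct_adj (y @ 0 # x) \<longleftrightarrow> distinct_adj x \<and> distinct_adj y"
  using ends_nonzero[OF assms(1)] ends_nonzero[OF assms(2)]
  by (cases "x = []"; cases "y = []") (auto simp: distinct_adj_append_iff distinct_adj_Cons)

lemma necklace_weight_separated_Nil: "0 \<notin> set x \<Longrightarrow> necklace_weight ([] @ 0 # x) = real (B_lin x)"
  "0 \<notin> set x \<Longrightarrow> necklace_weight (x @ [0]) = real (B_lin x)"
  using necklace_weight_append_commute[of x "[0]"] by (simp_all add: necklace_weight_0_Cons)

text \<open>The necklace \<open>y @ 0 # x\<close> is the pair of linear words \<open>x\<close>,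
  \<open>y\<close> separated by the gap, since \<open>0\<close> marks the outer ends of both. If
  both words are nonempty, the recursion has no remainder and the constants add by Pascal's rule.
  If one of them is empty, the remainder is a multiple of the weight of the other one, with the
  coefficient that continues the binomial pattern to the boundary.\<close>

lemma linear_gap1:
  assumes "x \<in> words 4 m" "y \<in> words 4 n"
  shows "gap1 4 (y @ 0 # x) = 2 * real ((m + n + 2) choose (m + 1)) * real (B_lin x) * real (B_lin y)"
  using assms
proof (induction "m + n" arbitrary: m n x y rule: less_induct)
  case less
  note x = words_not_0[OF less.prems(1)] and y = words_not_0[OF less.prems(2)]
  have sub: "set (y @ 0 # x) \<subseteq> {0..4}" and len: "length x = m" "length y = n"
    using less.prems by (auto simp: words_def)
  show ?case
  proof (cases "distinct_adj x \<and> distinct_adj y")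
    case adj: True
    have "deletions (gap1 4) (y @ 0 # x) = 
        (of_bool (m \<ge> 1) * (2 * real ((m - 1 + n + 2) choose (m - 1 + 1))) + 
         of_bool (n \<ge> 1) * (2 * real ((m + (n - 1) + 2) choose (m + 1)))) * real (B_lin x) * real (B_lin y)"
    proof (rule deletions_gap_product[OF less.prems])
      show "distinct_adj x" "distinct_adj y" using adj by auto
      show "gap1 4 (y @ 0 # x') = 2 * real ((m - 1 + n + 2) choose (m - 1 + 1)) * real (B_lin x') * real (B_lin y)"
        if "m \<ge> 1" "x' \<in> words 4 (m - 1)" for x'
        by (rule less.hyps) (use that less.prems in auto)
      show "gap1 4 (y' @ 0 # x) = 2 * real ((m + (n - 1) + 2) choose (m + 1)) * real (B_lin x) * real (B_lin y')"
        if "n \<ge> 1" "y' \<in> words 4 (n - 1)" for y'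
        by (rule less.hyps) (use that less.prems in auto)
    qed
    moreover have "y @ 0 # x = [0] \<or> length (y @ 0 # x) \<ge> 2"
      by (cases x; cases y) auto
    moreover have "hd (y @ 0 # x) \<noteq> 0 \<longleftrightarrow> y \<noteq> []" "last (y @ 0 # x) \<noteq> 0 \<longleftrightarrow> x \<noteq> []"
      using ends_nonzero[OF x] ends_nonzero[OF y] by (auto simp: hd_append)
    ultimately have rec: "gap1 4 (y @ 0 # x) = 
        (of_bool (m \<ge> 1) * (2 * real ((m - 1 + n + 2) choose (m - 1 + 1))) + 
         of_bool (n \<ge> 1) * (2 * real ((m + (n - 1) + 2) choose (m + 1)))) * real (B_lin x) * real (B_lin y)
        + (4 - 2 * of_bool (y \<noteq> []) - 2 * of_bool (x \<noteq> [])) * necklace_weight (y @ 0 # x)"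
      using gap1_rec[of "y @ 0 # x" 4] adj x y sub by (simp add: distinct_adj_separated)
    consider "x = []" "y = []" | "x = []" "y \<noteq> []" | "x \<noteq> []" "y = []" | "x \<noteq> []" "y \<noteq> []" by blast
    then show ?thesis
    proof cases
      case 4
      then obtain m' n' where "m = Suc m'" "n = Suc n'" using len by (cases m; cases n) auto
      then show ?thesis using rec 4 by (simp add: algebra_simps)
    next
      case 3
      then obtain m' where "m = Suc m'" using len by (cases m) auto
      then show ?thesis using rec 3 len x necklace_weight_separated_Nil(1)[of x] by (simp add: algebra_simps B_lin.simps[of "[]"])
    next
      case 2
      then obtain m' where "n = Suc m'" using len by (cases n) auto
      then show ?thesis using rec 2 len y necklace_weight_separated_Nil(2)[of y] by (simp add: algebra_simps B_lin.simps[of "[]"])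
    next
      case 1
      then show ?thesis using rec len necklace_weight_separated_Nil(1)[of "[]"] by (simp add: algebra_simps B_lin.simps[of "[]"])
    qed
  next
    case False
    then have "\<not> distinct_adj (y @ 0 # x)" by (simp add: distinct_adj_separated[OF x y])
    then show ?thesis using False by (auto simp: gap1_improper B_lin_improper)
  qed
qed

text \<open>The remainder in the recursion for two gap beads next to \<open>0\<close> involves a
  single gap bead next to \<open>0\<close>. Because one of its ends is undeletable, its own
  recursion has the remainder \<open>B_lin x\<close>, so the constant grows by one with each
  letter.\<close>

lemma linear_end_gap1_3:
  assumes "x \<in> words 3 m"
  shows "gap1 3 (0 # x) = (real m + 3) * real (B_lin x)
    \<and> gap1 3 (x @ [0]) = (real m + 3) * real (B_lin x)"
  using assms
proof (induction m arbitrary: x)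
  case 0
  have "gap1 3 [0] = 3"
    using gap1_rec[of "[0]" 3] by (simp add: necklace_weight_short deletions_Cons)
  moreover have "x = []" using 0 by simp
  ultimately show ?case
    by (simp_all add: B_lin.simps[of "[]"])
next
  case (Suc m)
  note x = words_not_0[OF Suc.prems]
  have sub: "set x \<subseteq> {0..3}" and len: "length x = Suc m"
    using Suc.prems by (auto simp: words_def)
  then have [simp]: "x \<noteq> []" by auto
  have ends: "hd x \<noteq> 0" "last x \<noteq> 0" using ends_nonzero[OF x] by auto
  show ?case
  proof (cases "distinct_adj x")
    case adj: True
    have "deletions (\<lambda>x'. gap1 3 (0 # x')) x = (real m + 3) * real (B_lin x)"
      unfolding B_lin_rec[OF x \<open>x \<noteq> []\<close> adj] deletions_scale[symmetric]
      using Suc len by (intro deletions_cong) (auto dest: delete_nth_words)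
    moreover have "deletions (\<lambda>x'. gap1 3 (x' @ [0])) x = (real m + 3) * real (B_lin x)"
      unfolding B_lin_rec[OF x \<open>x \<noteq> []\<close> adj] deletions_scale[symmetric]
      using Suc len by (intro deletions_cong) (auto dest: delete_nth_words)
    moreover have "distinct_adj (0 # x)" "distinct_adj (x @ [0])"
      using adj ends by (auto simp: distinct_adj_Cons distinct_adj_append_iff)
    moreover have "length x \<ge> 1" using len by simp
    ultimately show ?thesis
      using gap1_rec[of "0 # x" 3] gap1_rec[of "x @ [0]" 3] sub ends x adj necklace_weight_separated_Nil[OF x]
      by (simp add: deletions_Cons deletions_append deletions_scale B_lin_rec[OF x] algebra_simps)
  next
    case False
    then have "\<not> distinct_adj (0 # x)" "\<not> distinct_adj (x @ [0])" 
      by (auto simp: distinct_adj_Cons distinct_adj_append_iff)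
    then show ?thesis using False by (simp add: gap1_improper B_lin_improper)
  qed
qed

text \<open>As for \<open>linear_gap1\<close>; the boundary terms now come from
  \<open>linear_end_gap1_3\<close>.\<close>

lemma linear_gap2:
  assumes "x \<in> words 3 m" "y \<in> words 3 n"
  shows "gap2 3 (y @ 0 # x) = 2 * real ((m + n + 4) choose (m + 2)) * real (B_lin x) * real (B_lin y)"
  using assms
proof (induction "m + n" arbitrary: m n x y rule: less_induct)
  case less
  note x = words_not_0[OF less.prems(1)] and y = words_not_0[OF less.prems(2)]
  have sub: "set (y @ 0 # x) \<subseteq> {0..3}" and len: "length x = m" "length y = n"
    using less.prems by (auto simp: words_def)
  have [simp]: "B_lin [] = 1" by (simp add: B_lin.simps)
  show ?case
  proof (cases "distinct_adj x \<and> distinct_adj y")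
    case adj: True
    have "deletions (gap2 3) (y @ 0 # x) = 
        (of_bool (m \<ge> 1) * (2 * real ((m - 1 + n + 4) choose (m - 1 + 2))) + 
         of_bool (n \<ge> 1) * (2 * real ((m + (n - 1) + 4) choose (m + 2)))) * real (B_lin x) * real (B_lin y)"
    proof (rule deletions_gap_product[OF less.prems])
      show "distinct_adj x" "distinct_adj y" using adj by auto
      show "gap2 3 (y @ 0 # x') = 2 * real ((m - 1 + n + 4) choose (m - 1 + 2)) * real (B_lin x') * real (B_lin y)"
        if "m \<ge> 1" "x' \<in> words 3 (m - 1)" for x'
        by (rule less.hyps) (use that less.prems in auto)
      show "gap2 3 (y' @ 0 # x) = 2 * real ((m + (n - 1) + 4) choose (m + 2)) * real (B_lin x) * real (B_lin y')"
        if "n \<ge> 1" "y' \<in> words 3 (n - 1)" for y'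
        by (rule less.hyps) (use that less.prems in auto)
    qed
    moreover have "hd (y @ 0 # x) \<noteq> 0 \<longleftrightarrow> y \<noteq> []" "last (y @ 0 # x) \<noteq> 0 \<longleftrightarrow> x \<noteq> []"
      using ends_nonzero[OF x] ends_nonzero[OF y] by (auto simp: hd_append)
    ultimately have rec: "gap2 3 (y @ 0 # x) = 
        (of_bool (m \<ge> 1) * (2 * real ((m - 1 + n + 4) choose (m - 1 + 2))) + 
         of_bool (n \<ge> 1) * (2 * real ((m + (n - 1) + 4) choose (m + 2)))) * real (B_lin x) * real (B_lin y)
        + (4 - 2 * of_bool (y \<noteq> []) - 2 * of_bool (x \<noteq> [])) * gap1 3 (y @ 0 # x)"
      using gap2_rec[of "y @ 0 # x" 3] adj x y sub by (simp add: distinct_adj_separated)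
    consider "x = []" "y = []" | "x = []" "y \<noteq> []" | "x \<noteq> []" "y = []" | "x \<noteq> []" "y \<noteq> []" by blast
    then show ?thesis
    proof cases
      case 4
      then obtain m' n' where "m = Suc m'" "n = Suc n'" using len by (cases m; cases n) auto
      moreover have "m' + (n' + 6) = Suc (m' + (n' + 5))" by simp
      then have "(m' + (n' + 6)) choose Suc (Suc (Suc m')) =
          ((m' + (n' + 5)) choose Suc (Suc m')) + ((m' + (n' + 5)) choose Suc (Suc (Suc m')))"
        by (simp only: binomial_Suc_Suc)
      ultimately show ?thesis using rec 4 by (simp add: algebra_simps)
    next
      case 3
      then obtain m' where m: "m = Suc m'" using len by (cases m) auto
      have "gap1 3 (0 # x) = (real m + 3) * real (B_lin x)" using linear_end_gap1_3[OF less.prems(1)] by simp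
      moreover have "(m' + 5) choose (m' + 3) = ((m' + 5) choose 2)" "(m' + 4) choose (m' + 2) = ((m' + 4) choose 2)"
        using binomial_symmetric[of "m' + 3" "m' + 5"] binomial_symmetric[of "m' + 2" "m' + 4"] by simp_all
      then have "real ((m' + 5) choose (m' + 3)) = real ((m' + 4) choose (m' + 2)) + real m' + 4"
        by (simp add: numeral_eq_Suc)
      moreover have "m' + 3 = Suc (Suc (Suc m'))" by simp
      ultimately show ?thesis using rec 3 len m by (simp add: algebra_simps)
    next
      case 2
      then obtain n' where n: "n = Suc n'" using len by (cases n) auto
      have "gap1 3 (y @ [0]) = (real n + 3) * real (B_lin y)" using linear_end_gap1_3[OF less.prems(2)] by simp
      moreover have "real ((n' + 5) choose Suc (Suc 0)) = real ((n' + 4) choose Suc (Suc 0)) + real n' + 4"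
        by (simp add: numeral_eq_Suc)
      ultimately show ?thesis using rec 2 len n by (simp add: algebra_simps)
    next
      case 1
      have "(4::nat) choose Suc (Suc 0) = 6" by (simp add: numeral_eq_Suc)
      then show ?thesis using rec 1 len linear_end_gap1_3[OF less.prems(1)] by (simp add: algebra_simps)
    qed
  next
    case False
    then have "\<not> distinct_adj (y @ 0 # x)" by (simp add: distinct_adj_separated[OF x y])
    then show ?thesis using False by (auto simp: gap2_improper B_lin_improper)
  qed
qed

lemma cyclic_gap:
  assumes "(k, q) \<in> {(1, 4), (2, 3)}"
  obtains c where "\<And>n z. n \<ge> 1 \<Longrightarrow> z \<in> words q n \<Longrightarrow> gap k q z = c * real (B_lin z)"
proof -
  consider "k = 1" "q = 4" | "k = 2" "q = 3" using assms by blast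
  then show ?thesis
  proof cases
    case 1
    show ?thesis by (rule that[of 3]) (simp only: 1 gap_1 cyclic_gap1)
  next
    case 2
    show ?thesis by (rule that[of 6]) (simp only: 2 gap_2 cyclic_gap2)
  qed
qed

lemma linear_gap:
  assumes "(k, q) \<in> {(1, 4), (2, 3)}"
  obtains c where "\<And>x y. x \<in> words q m \<Longrightarrow> y \<in> words q n \<Longrightarrow>
    (\<Sum>w\<in>words q k. real (B_lin (x @ w @ y))) = c * real (B_lin x) * real (B_lin y)"
proof -
  obtain c where c: "\<And>x y. x \<in> words q m \<Longrightarrow> y \<in> words q n \<Longrightarrow>
      gap k q (y @ 0 # x) = c * real (B_lin x) * real (B_lin y)"
  proof -
    consider "k = 1" "q = 4" | "k = 2" "q = 3" using assms by blast
    then show ?thesis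
    proof cases
      case 1
      show ?thesis
        by (rule that[of "2 * real ((m + n + 2) choose (m + 1))"]) (simp only: 1 gap_1 linear_gap1)
    next
      case 2
      show ?thesis
        by (rule that[of "2 * real ((m + n + 4) choose (m + 2))"]) (simp only: 2 gap_2 linear_gap2)
    qed
  qed
  show ?thesis
  proof (rule that)
    fix x y assume xy: "x \<in> words q m" "y \<in> words q n"
    have "(\<Sum>w\<in>words q k. real (B_lin (x @ w @ y))) = gap k q (y @ 0 # x)"
      unfolding gap_def
    proof (rule sum.cong)
      fix w assume "w \<in> words q k"
      then have "0 \<notin> set (x @ w @ y)" using xy words_not_0 by auto
      then show "real (B_lin (x @ w @ y)) = necklace_weight ((y @ 0 # x) @ w)"
        using necklace_weight_append_commute[of y "0 # x @ w"] by (simp add: necklace_weight_0_Cons)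
    qed simp
    then show "(\<Sum>w\<in>words q k. real (B_lin (x @ w @ y))) = c * real (B_lin x) * real (B_lin y)"
      using c[OF xy] by simp
  qed
qed

section \<open>Faces of the plane tree\<close>

lemma label_neq:
  fixes a :: 3
  shows "a + 1 \<noteq> a" "a \<noteq> a + 1" "a - 1 \<noteq> a" "a \<noteq> a - 1" "a + 1 \<noteq> a - 1" "a - 1 \<noteq> a + 1"
  using exhaust_3[of a] by auto

lemma label_eq:
  fixes a :: 3
  shows "a - 1 - 1 = a + 1" "a + 1 + 1 = a - 1"
  using exhaust_3[of a] by auto

lemma label_cases: "b = a \<or> b = a + 1 \<or> b = a - 1" for a b :: 3
  using exhaust_3[of a] exhaust_3[of b] by auto

lemma neighbour_push: "v = [] \<or> hd v \<noteq> a \<Longrightarrow> neighbour v a = a # v"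
  by (cases v) auto

lemma neighbour_in_tree [intro]: "v \<in> tree_vertices \<Longrightarrow> neighbour v a \<in> tree_vertices"
  by (cases v) (auto simp: tree_vertices_def dest: distinct_adj_ConsD)

lemma neighbour_neighbour: "v \<in> tree_vertices \<Longrightarrow> neighbour (neighbour v a) a = v"
  by (cases "(v, a)" rule: neighbour.cases) (auto simp: tree_vertices_def distinct_adj_Cons neighbour_push)

lemma face_step_in_darts: "d \<in> darts \<Longrightarrow> face_step d \<in> darts"
  by (auto simp: darts_def face_step_def)

definition face_back :: "dart \<Rightarrow> dart" where
  "face_back = (\<lambda>(v, a). (neighbour v (a + 1), a + 1))"

lemma face_back_step: "d \<in> darts \<Longrightarrow> face_back (face_step d) = d"
  by (auto simp: darts_def face_back_def face_step_def neighbour_neighbour)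

lemma funpow_face_step_in_darts: "d \<in> darts \<Longrightarrow> (face_step ^^ i) d \<in> darts"
  by (induction i) (auto simp: face_step_in_darts)

lemma funpow_face_back_step: "d \<in> darts \<Longrightarrow> (face_back ^^ i) ((face_step ^^ i) d) = d"
proof (induction i)
  case (Suc i)
  have "(face_back ^^ Suc i) ((face_step ^^ Suc i) d) = (face_back ^^ i) (face_back (face_step ((face_step ^^ i) d)))"
    by (simp add: funpow_Suc_right del: funpow.simps) (simp add: funpow_swap1)
  then show ?case using Suc by (simp add: face_back_step funpow_face_step_in_darts)
qed simp

lemma right_face_self: "d \<in> darts \<Longrightarrow> d \<in> right_face d"
  unfolding right_face_def by (auto intro: exI[of _ 0])

text \<open>A face is an orbit of \<open>face_step\<close>, which is injective on darts; hence a
  step does not leave the equivalence class.\<close>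

lemma right_face_step: 
  assumes "d \<in> darts" 
  shows "right_face (face_step d) = right_face d"
proof -
  have "(\<exists>i. (face_step ^^ i) (face_step d) = e \<or> (face_step ^^ i) e = face_step d) \<longleftrightarrow>
        (\<exists>i. (face_step ^^ i) d = e \<or> (face_step ^^ i) e = d)" (is "?L = ?R") if e: "e \<in> darts" for e
  proof
    assume ?L
    then obtain i where "(face_step ^^ i) (face_step d) = e \<or> (face_step ^^ i) e = face_step d" ..
    then show ?R
    proof
      assume "(face_step ^^ i) (face_step d) = e"
      then show ?R by (intro exI[of _ "Suc i"]) (simp add: funpow_swap1)
    next
      assume *: "(face_step ^^ i) e = face_step d"
      show ?R
      proof (cases i)
        case 0
        then show ?R using * by (intro exI[of _ 1]) simp
      next
        case (Suc j)
        then have "face_back (face_step ((face_step ^^ j) e)) = face_back (face_step d)" using * by simp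
        then have "(face_step ^^ j) e = d"
          using e assms by (simp add: face_back_step funpow_face_step_in_darts)
        then show ?R by blast
      qed
    qed
  next
    assume ?R
    then obtain i where "(face_step ^^ i) d = e \<or> (face_step ^^ i) e = d" ..
    then show ?L
    proof
      assume *: "(face_step ^^ i) d = e"
      show ?L
      proof (cases i)
        case 0
        then show ?L using * by (intro exI[of _ 1]) simp
      next
        case (Suc j)
        then show ?L using * by (intro exI[of _ j]) (simp add: funpow_swap1)
      qed
    next
      assume "(face_step ^^ i) e = d"
      then show ?L by (intro exI[of _ "Suc i"]) simp
    qed
  qed
  then show ?thesis unfolding right_face_def by blast
qed

lemma right_face_funpow: "d \<in> darts \<Longrightarrow> right_face ((face_step ^^ i) d) = right_face d"
  by (induction i) (simp_all add: right_face_step funpow_face_step_in_darts)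

lemma right_face_eqI:
  assumes "e \<in> right_face d" "d \<in> darts"
  shows "right_face e = right_face d"
proof -
  obtain i where "e \<in> darts" "(face_step ^^ i) d = e \<or> (face_step ^^ i) e = d"
    using assms(1) by (auto simp: right_face_def)
  then show ?thesis
    using right_face_funpow[OF assms(2), of i] right_face_funpow[of e i] by auto
qed

text \<open>The faces around a vertex are its corners: the face to the left of a dart is the one
  to the right of the preceding dart at the same vertex.\<close>

lemma left_face_eq: "v \<in> tree_vertices \<Longrightarrow> left_face (v, a) = right_face (v, a - 1)"
  using right_face_step[of "(neighbour v a, a)"]
  by (auto simp: left_face_def rev_dart_def face_step_def darts_def neighbour_neighbour)

lemma right_face_across: "v \<in> tree_vertices \<Longrightarrow> right_face (v, a) = right_face (neighbour v a, a - 1)"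
  using right_face_step[of "(v, a)"] by (auto simp: face_step_def darts_def)

text \<open>Along a face the labels change at every step, so once the path moves away from the
  root it prepends a letter each time and never turns back.\<close>

lemma forward_steps:
  assumes "v = [] \<or> hd v \<noteq> a"
  shows "\<exists>u b. (face_step ^^ i) (v, a) = (u @ v, b) \<and> length u = i \<and> (u @ v = [] \<or> hd (u @ v) \<noteq> b)
            \<and> (i > 0 \<longrightarrow> last u = a)"
proof (induction i)
  case (Suc i)
  then obtain u b where u: "(face_step ^^ i) (v, a) = (u @ v, b)" "length u = i"
    "u @ v = [] \<or> hd (u @ v) \<noteq> b" "i > 0 \<longrightarrow> last u = a" by blast
  have "i = 0 \<Longrightarrow> b = a" using u by simp
  then show ?case using u label_neq(4)[of b]
    by (intro exI[of _ "b # u"] exI[of _ "b - 1"]) (auto simp: face_step_def neighbour_push)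
qed (use assms in auto)

lemma backward_steps:
  assumes "v = [] \<or> hd v \<noteq> a + 1"
  shows "\<exists>u b. (face_back ^^ i) (v, a) = (u @ v, b) \<and> length u = i \<and> (u @ v = [] \<or> hd (u @ v) \<noteq> b + 1)
            \<and> (i > 0 \<longrightarrow> last u = a + 1)"
proof (induction i)
  case (Suc i)
  then obtain u b where u: "(face_back ^^ i) (v, a) = (u @ v, b)" "length u = i"
    "u @ v = [] \<or> hd (u @ v) \<noteq> b + 1" "i > 0 \<longrightarrow> last u = a + 1" by blast
  have "i = 0 \<Longrightarrow> b = a" using u by simp
  then show ?case using u label_neq(2)[of "b + 1"]
    by (intro exI[of _ "(b + 1) # u"] exI[of _ "b + 1"]) (auto simp: face_back_def neighbour_push)
qed (use assms in auto)

lemma right_face_cases: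
  assumes "e \<in> right_face d"
  obtains i where "e = (face_step ^^ i) d" | i where "e = (face_back ^^ i) d"
proof -
  obtain i where e: "e \<in> darts" "(face_step ^^ i) d = e \<or> (face_step ^^ i) e = d"
    using assms by (auto simp: right_face_def)
  show ?thesis using e(2)
  proof
    assume "(face_step ^^ i) d = e"
    then show ?thesis by (intro that(1)[of i]) simp
  next
    assume "(face_step ^^ i) e = d"
    then show ?thesis by (intro that(2)[of i]) (use funpow_face_back_step[OF e(1), of i] in simp)
  qed
qed

text \<open>A face whose corner at \<open>v\<close> lies between two edges leading away from the
  root has \<open>v\<close> as its vertex closest to the root. Going forward the path enters the
  branch of the label \<open>a\<close>, going backward that of \<open>a + 1\<close>; so the letter
  in front of \<open>v\<close> shows the direction and the length shows the number of
  steps.\<close>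

lemma corner_face_source:
  assumes v: "v = [] \<or> hd v \<noteq> a \<and> hd v \<noteq> a + 1"
    and x: "(x, b) \<in> right_face (v, a)"
  shows "\<exists>u. x = u @ v \<and> (x, b) =
    ((if u \<noteq> [] \<and> last u = a + 1 then face_back else face_step) ^^ length u) (v, a)"
  using x
proof (cases rule: right_face_cases)
  case (1 i)
  have fwd: "v = [] \<or> hd v \<noteq> a" using v by auto
  obtain u b' where u: "(face_step ^^ i) (v, a) = (u @ v, b')" "length u = i" "i > 0 \<longrightarrow> last u = a"
    using forward_steps[OF fwd, of i] by blast
  then have "\<not> (u \<noteq> [] \<and> last u = a + 1)" using label_neq(1)[of a] by auto
  then show ?thesis using 1 u by (intro exI[of _ u]) auto
next
  case (2 i)
  have bwd: "v = [] \<or> hd v \<noteq> a + 1" using v by auto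
  obtain u b' where u: "(face_back ^^ i) (v, a) = (u @ v, b')" "length u = i" "i > 0 \<longrightarrow> last u = a + 1"
    using backward_steps[OF bwd, of i] by blast
  show ?thesis
  proof (cases "i = 0")
    case True
    then show ?thesis using 2 u by (intro exI[of _ "[]"]) auto
  next
    case False
    then have "u \<noteq> [] \<and> last u = a + 1" using u by auto
    then show ?thesis using 2 u by (intro exI[of _ u]) auto
  qed
qed

lemma corner_face_suffix:
  assumes "v = [] \<or> hd v \<noteq> a \<and> hd v \<noteq> a + 1" "(x, b) \<in> right_face (v, a)"
  shows "suffix v x"
  using corner_face_source[OF assms] by (auto simp: suffix_def)

lemma corner_face_unique:
  assumes v: "v = [] \<or> hd v \<noteq> a \<and> hd v \<noteq> a + 1" 
    and b: "(x, b) \<in> right_face (v, a)" and c: "(x, c) \<in> right_face (v, a)"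
  shows "b = c"
  using corner_face_source[OF v b] corner_face_source[OF v c] by (metis Pair_inject append_same_eq)

lemma edge_crossing:
  assumes "suffix (a # v) y \<noteq> suffix (a # v) (neighbour y c)"
  shows "c = a \<and> (y = a # v \<or> y = v)"
  using assms by (cases "(y, c)" rule: neighbour.cases) (auto simp: suffix_Cons split: if_splits)

lemma orbit_crossing:
  assumes e: "e \<in> darts" and "suffix (a # v) (fst e) \<noteq> suffix (a # v) (fst ((face_step ^^ i) e))"
  shows "(a # v, a) \<in> right_face e \<or> (v, a) \<in> right_face e"
  using assms(2)
proof (induction i)
  case (Suc i)
  show ?case
  proof (cases "suffix (a # v) (fst e) = suffix (a # v) (fst ((face_step ^^ i) e))")
    case True
    obtain y c where yc: "(face_step ^^ i) e = (y, c)" by fastforce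
    have "suffix (a # v) y \<noteq> suffix (a # v) (neighbour y c)"
      using Suc.prems True yc by (simp add: face_step_def)
    then have "c = a \<and> (y = a # v \<or> y = v)" by (rule edge_crossing)
    moreover have "(y, c) \<in> right_face e"
      using yc e funpow_face_step_in_darts[OF e, of i] by (auto simp: right_face_def)
    ultimately show ?thesis by auto
  qed (use Suc.IH in auto)
qed simp

text \<open>A face is a path in the tree. If it has vertices inside and outside the branch that
  starts with the edge from \<open>v\<close> to \<open>a # v\<close>, it must use this edge, in
  one direction or the other.\<close>

lemma face_crossing:
  assumes d: "d \<in> darts" and "(x, b) \<in> right_face d" "(y, c) \<in> right_face d"
    and "suffix (a # v) x" "\<not> suffix (a # v) y"
  shows "(a # v, a) \<in> right_face d \<or> (v, a) \<in> right_face d"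
proof -
  have darts: "(x, b) \<in> darts" "(y, c) \<in> darts" using assms by (auto simp: right_face_def)
  have eq: "right_face (x, b) = right_face d" "right_face (y, c) = right_face d"
    using assms right_face_eqI by auto
  have "(y, c) \<in> right_face (x, b)" using assms eq by simp
  then obtain i where "(face_step ^^ i) (x, b) = (y, c) \<or> (face_step ^^ i) (y, c) = (x, b)"
    by (auto simp: right_face_def)
  then show ?thesis
  proof
    assume "(face_step ^^ i) (x, b) = (y, c)"
    then show ?thesis using orbit_crossing[OF darts(1), of a v i] assms eq by auto
  next
    assume "(face_step ^^ i) (y, c) = (x, b)"
    then show ?thesis using orbit_crossing[OF darts(2), of a v i] assms eq by auto
  qed
qed

lemma dual_edges_eq: "dual_edges = {(right_face (x, b - 1), right_face (x, b)) | x b. x \<in> tree_vertices}"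
proof -
  have "(left_face d, right_face d) = (right_face (fst d, snd d - 1), right_face (fst d, snd d))" 
    if "d \<in> darts" for d
    using that by (cases d) (simp add: darts_def left_face_eq)
  then show ?thesis unfolding dual_edges_def by (fastforce simp: darts_def)
qed

section \<open>The boundary of a cluster\<close>

text \<open>The darts leaving a cluster in clockwise order, up to the choice of the first one. The
  last equation says that each of them has on its right the face that the next one has on its
  left, so the left faces are the vertices of the outer cycle in order. Listing the left faces
  rather than the right ones lets the first of them stay fixed while the cluster grows.\<close>

definition boundary_walk :: "tvertex set \<Rightarrow> dart list \<Rightarrow> bool" where
  "boundary_walk S ds \<longleftrightarrow>
     S \<subseteq> tree_vertices \<and> root \<in> S \<and> (\<forall>a v. a # v \<in> S \<longrightarrow> v \<in> S) \<and>
     distinct ds \<and> set ds = {(v, a). v \<in> S \<and> neighbour v a \<notin> S} \<and>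
     distinct (map left_face ds) \<and> set (map left_face ds) = cluster_dual_vertices S \<and>
     map right_face ds = rotate1 (map left_face ds)"

definition expand_dart :: "dart \<Rightarrow> dart list" where
  "expand_dart = (\<lambda>(v, a). [(neighbour v a, a + 1), (neighbour v a, a - 1)])"

definition new_face :: "dart \<Rightarrow> dvertex" where
  "new_face = (\<lambda>(v, a). right_face (neighbour v a, a + 1))"

text \<open>A loop at a face would be an edge of the tree with that face on both sides, so the
  face would have two corners at one vertex.\<close>

lemma corner_face_no_loop:
  assumes "v = [] \<or> hd v \<noteq> a \<and> hd v \<noteq> a + 1"
  shows "(right_face (v, a), right_face (v, a)) \<notin> dual_edges"
proof
  assume "(right_face (v, a), right_face (v, a)) \<in> dual_edges"
  then obtain x b where x: "x \<in> tree_vertices" "right_face (v, a) = right_face (x, b - 1)"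
      "right_face (v, a) = right_face (x, b)"
    by (auto simp: dual_edges_eq)
  then have "(x, b - 1) \<in> right_face (v, a)" "(x, b) \<in> right_face (v, a)"
    using right_face_self[of "(x, b - 1)"] right_face_self[of "(x, b)"] by (auto simp: darts_def)
  then show False using corner_face_unique[OF assms] label_neq(3)[of b] by metis
qed

lemma suffix_closed_cluster:
  assumes "\<forall>a v. a # v \<in> S \<longrightarrow> v \<in> S" "suffix y x" "x \<in> S"
  shows "y \<in> S"
  using assms(2,3) by (induction x) (use assms(1) in \<open>auto simp: suffix_Cons\<close>)

lemma right_face_root_inj: "right_face (root, a) = right_face (root, b) \<longleftrightarrow> a = b"
proof
  assume eq: "right_face (root, a) = right_face (root, b)"
  have "(root, a) \<in> darts" "(root, b) \<in> darts" by (auto simp: darts_def tree_vertices_def root_def)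
  then show "a = b" using eq right_face_self corner_face_unique[of root a root a b] by (metis root_def)
qed simp

lemma left_face_root: "left_face (root, a) = right_face (root, a - 1)"
  by (rule left_face_eq) (simp add: tree_vertices_def root_def)

lemma boundary_walk_root: "boundary_walk {root} [(root, 0), (root, 1), (root, 2)]"
proof -
  have "x = 0 \<or> x = 1 \<or> x = 2" for x :: 3 using exhaust_3[of x] by auto
  then have univ: "UNIV = {0, 1, 2 :: 3}" by blast
  have "Delta root = right_face ` Pair root ` UNIV" by (auto simp: Delta_def)
  then have "Delta root = {right_face (root, 0), right_face (root, 1), right_face (root, 2)}"
    unfolding univ by simp
  moreover have "left_face (root, 0) = right_face (root, 2)" "left_face (root, 1) = right_face (root, 0)"
    "left_face (root, 2) = right_face (root, 1)"
  proof -
    have "(0::3) - 1 = 2" "(1::3) - 1 = 0" "(2::3) - 1 = 1" by simp_all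
    then show "left_face (root, 0) = right_face (root, 2)" "left_face (root, 1) = right_face (root, 0)"
      "left_face (root, 2) = right_face (root, 1)" by (metis left_face_root)+
  qed
  moreover have "set [(root, 0), (root, 1), (root, 2 :: 3)] = {root} \<times> UNIV" unfolding univ by auto
  moreover have "neighbour root a = [a]" for a by (simp add: root_def)
  moreover have "root \<in> tree_vertices" "\<And>a v. a # v \<noteq> root" "\<And>a. [a] \<noteq> root"
    by (simp_all add: tree_vertices_def root_def)
  ultimately show ?thesis
    by (auto simp: boundary_walk_def right_face_root_inj cluster_dual_vertices_def)
qed

text \<open>A dart that leaves a cluster containing the root leads away from the root, since a
  cluster contains with each vertex the whole path to the root.\<close>

lemma boundary_walk_leaving:
  assumes "boundary_walk S ds" "(v, a) \<in> set ds"
  shows "v \<in> S" "neighbour v a = a # v" "a # v \<notin> S" "a # v \<in> tree_vertices" "v \<in> tree_vertices"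
    "v = [] \<or> hd v \<noteq> a"
proof -
  have va: "v \<in> S" "neighbour v a \<notin> S" "v \<in> tree_vertices" 
    and closed: "\<forall>a v. a # v \<in> S \<longrightarrow> v \<in> S"
    using assms by (auto simp: boundary_walk_def)
  show hd: "v = [] \<or> hd v \<noteq> a"
    using va closed by (cases v) auto
  show n: "neighbour v a = a # v" by (rule neighbour_push[OF hd])
  show "v \<in> S" "a # v \<notin> S" "v \<in> tree_vertices" using va n by auto
  show "a # v \<in> tree_vertices" using neighbour_in_tree[OF va(3), of a] n by simp
qed

lemma boundary_darts_inj:
  assumes "boundary_walk S ds" "d \<in> set ds" "d' \<in> set ds"
    "neighbour (fst d) (snd d) = neighbour (fst d') (snd d')"
  shows "d = d'"
proof -
  have "neighbour (fst e) (snd e) = snd e # fst e" if "e \<in> set ds" for e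
    using boundary_walk_leaving(2)[OF assms(1), of "fst e" "snd e"] that by simp
  then show ?thesis using assms(2-4) by (simp add: prod_eq_iff)
qed

context
  fixes S ds1 v a ds2
  assumes walk: "boundary_walk S (ds1 @ (v, a) # ds2)"
begin

lemma cluster_closed: "\<forall>a v. a # v \<in> S \<longrightarrow> v \<in> S"
  using walk by (auto simp: boundary_walk_def)

lemma leaving_dart: "v \<in> S" "neighbour v a = a # v" "a # v \<notin> S" "a # v \<in> tree_vertices" "v \<in> tree_vertices"
    "v = [] \<or> hd v \<noteq> a"
  using boundary_walk_leaving[OF walk, of v a] by auto

lemma new_face_eq: "new_face (v, a) = right_face (a # v, a + 1)"
  by (simp add: new_face_def leaving_dart)

lemma new_corner: "a # v = [] \<or> hd (a # v) \<noteq> a + 1 \<and> hd (a # v) \<noteq> a + 1 + 1"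
  using label_neq[of a] label_eq(2)[of a] by auto

text \<open>The two darts that replace \<open>(v, a)\<close> run around the new vertex \<open>a #
  v\<close>: the first has the old left face on its left, the second has the old right face on its
  right, and the new face lies between them.\<close>

lemma expanded_faces:
  "left_face (a # v, a + 1) = left_face (v, a)"
  "right_face (a # v, a + 1) = new_face (v, a)"
  "left_face (a # v, a - 1) = new_face (v, a)"
  "right_face (a # v, a - 1) = right_face (v, a)"
  using left_face_eq[OF leaving_dart(4), of "a + 1"] left_face_eq[OF leaving_dart(4), of "a - 1"] 
    right_face_across[OF leaving_dart(5), of a]
  by (simp_all add: leaving_dart(2) left_face_def[of "(v, a)"] rev_dart_def new_face_eq label_eq)

lemma new_face_suffix: "(x, b) \<in> new_face (v, a) \<Longrightarrow> suffix (a # v) x"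
  using corner_face_suffix[OF new_corner] by (simp add: new_face_eq)

lemma cluster_face_vertex:
  assumes "g \<in> cluster_dual_vertices S"
  obtains y c where "y \<in> S" "(y, c) \<in> g" "g = right_face (y, c)" "(y, c) \<in> darts"
proof -
  obtain y c where y: "y \<in> S" "g = right_face (y, c)"
    using assms by (auto simp: cluster_dual_vertices_def Delta_def)
  moreover have "(y, c) \<in> darts" using y walk by (auto simp: boundary_walk_def darts_def)
  ultimately show thesis using that right_face_self by blast
qed

lemma cluster_not_suffix: "y \<in> S \<Longrightarrow> \<not> suffix (a # v) y"
  using suffix_closed_cluster[OF cluster_closed] leaving_dart(3) by blast

text \<open>All vertices of the new face lie in the branch of \<open>a # v\<close>, which contains
  no vertex of the cluster.\<close>

lemma new_face_fresh: "new_face (v, a) \<notin> cluster_dual_vertices S"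
proof
  assume "new_face (v, a) \<in> cluster_dual_vertices S"
  then obtain y c where "y \<in> S" "(y, c) \<in> new_face (v, a)" by (rule cluster_face_vertex)
  then show False using cluster_not_suffix new_face_suffix by blast
qed

lemma old_faces:
  "left_face (v, a) \<in> cluster_dual_vertices S" "right_face (v, a) \<in> cluster_dual_vertices S"
  using leaving_dart by (auto simp: cluster_dual_vertices_def Delta_def left_face_eq)

lemma cluster_dual_vertices_insert:
  "cluster_dual_vertices (insert (a # v) S) = insert (new_face (v, a)) (cluster_dual_vertices S)"
proof -
  have "UNIV = {a, a + 1, a - 1}" using label_cases[of _ a] by auto
  moreover have "Delta (a # v) = right_face ` Pair (a # v) ` UNIV" by (auto simp: Delta_def)
  ultimately have "Delta (a # v) = {right_face (a # v, a), right_face (a # v, a + 1), right_face (a # v, a - 1)}"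
    by auto
  moreover have "right_face (a # v, a) = left_face (v, a)"
    by (simp add: left_face_def rev_dart_def leaving_dart)
  ultimately have "Delta (a # v) = {left_face (v, a), new_face (v, a), right_face (v, a)}"
    by (simp add: expanded_faces)
  then show ?thesis using old_faces by (auto simp: cluster_dual_vertices_def)
qed

lemma boundary_walk_expand: 
  "boundary_walk (insert (a # v) S) (ds1 @ expand_dart (v, a) @ ds2)"
proof -
  note [simp] = leaving_dart expanded_faces
  let ?w = "a # v"
  have ds: "distinct (ds1 @ (v, a) # ds2)" "set (ds1 @ (v, a) # ds2) = {(v, a). v \<in> S \<and> neighbour v a \<notin> S}"
    and L: "distinct (map left_face (ds1 @ (v, a) # ds2))" 
       "set (map left_face (ds1 @ (v, a) # ds2)) = cluster_dual_vertices S"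
    and R: "map right_face (ds1 @ (v, a) # ds2) = rotate1 (map left_face (ds1 @ (v, a) # ds2))"
    and S: "S \<subseteq> tree_vertices" "root \<in> S"
    using walk unfolding boundary_walk_def by blast+
  have exp: "expand_dart (v, a) = [(?w, a + 1), (?w, a - 1)]" by (simp add: expand_dart_def)
  have not_w: "d \<noteq> (?w, b)" if "d \<in> set (ds1 @ (v, a) # ds2)" for d b
  proof -
    have "fst d \<in> S" using that unfolding ds(2) by auto
    then show ?thesis using leaving_dart(3) by auto
  qed
  have 1: "distinct (ds1 @ expand_dart (v, a) @ ds2)"
    using ds(1) not_w label_neq(5)[of a] by (auto simp: exp)
  have 2: "set (ds1 @ expand_dart (v, a) @ ds2) = {(x, b). x \<in> insert ?w S \<and> neighbour x b \<notin> insert ?w S}"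
  proof -
    have "set ds1 \<union> set ds2 = set (ds1 @ (v, a) # ds2) - {(v, a)}"
      using ds(1) by auto
    also have "\<dots> = {(x, b). x \<in> S \<and> neighbour x b \<notin> S} - {(v, a)}"
      unfolding ds(2) ..
    also have "\<dots> = {(x, b). x \<in> S \<and> neighbour x b \<notin> insert ?w S}"
    proof -
      have "(x, b) = (v, a)" if "x \<in> S" "neighbour x b = ?w" for x b
      proof -
        have "(x, b) \<in> set (ds1 @ (v, a) # ds2)" unfolding ds(2) using that leaving_dart(3) by simp
        then show ?thesis using boundary_darts_inj[OF walk, of "(x, b)" "(v, a)"] that leaving_dart(2) by simp
      qed
      then show ?thesis using leaving_dart(2) by blast
    qed
    finally have old: "set ds1 \<union> set ds2 = {(x, b). x \<in> S \<and> neighbour x b \<notin> insert ?w S}" .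
    have W: "neighbour ?w b \<notin> insert ?w S \<longleftrightarrow> b = a + 1 \<or> b = a - 1" for b
    proof (cases "b = a")
      case True
      then show ?thesis using label_neq[of a] by auto
    next
      case False
      then have "neighbour ?w b = b # ?w" by simp
      moreover have "b # ?w \<notin> S" using cluster_closed leaving_dart(3) by blast
      ultimately show ?thesis using label_cases[of b a] False by auto
    qed
    have "set (ds1 @ expand_dart (v, a) @ ds2) = (set ds1 \<union> set ds2) \<union> {(?w, a + 1), (?w, a - 1)}"
      by (auto simp: exp)
    also have "\<dots> = {(x, b). x \<in> insert ?w S \<and> neighbour x b \<notin> insert ?w S}"
      unfolding old using W leaving_dart(3) by (auto simp del: neighbour.simps)
    finally show ?thesis .
  qed
  have 3: "distinct (map left_face (ds1 @ expand_dart (v, a) @ ds2))"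
  proof -
    have "new_face (v, a) \<notin> set (map left_face (ds1 @ (v, a) # ds2))" using new_face_fresh L by simp
    then show ?thesis using L(1) by (auto simp: exp)
  qed
  have 4: "set (map left_face (ds1 @ expand_dart (v, a) @ ds2)) = cluster_dual_vertices (insert ?w S)"
    unfolding cluster_dual_vertices_insert using L(2) by (auto simp: exp)
  have 5: "map right_face (ds1 @ expand_dart (v, a) @ ds2) = rotate1 (map left_face (ds1 @ expand_dart (v, a) @ ds2))"
  proof (cases ds1)
    case Nil
    then show ?thesis using R by (auto simp: exp)
  next
    case (Cons e ds1')
    have "map right_face ds1 @ (right_face (v, a) # map right_face ds2) = 
        (map left_face ds1' @ [left_face (v, a)]) @ (map left_face ds2 @ [left_face e])"
      using R Cons by simp
    then have "map right_face ds1 = map left_face ds1' @ [left_face (v, a)]"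
        "right_face (v, a) # map right_face ds2 = map left_face ds2 @ [left_face e]"
      by (subst (asm) append_eq_append_conv; simp add: Cons)+
    then show ?thesis using Cons by (simp add: exp)
  qed
  have "\<forall>b x. b # x \<in> insert ?w S \<longrightarrow> x \<in> insert ?w S" using cluster_closed leaving_dart(1) by auto
  then show ?thesis
    unfolding boundary_walk_def using 1 2 3 4 5 S by auto
qed

text \<open>An edge of the dual crosses an edge of the tree whose ends are vertices of both faces.
  For the new face these ends lie in the branch of \<open>a # v\<close>; a face that also meets
  the cluster must then contain the edge leading into this branch, and there are only two such
  faces.\<close>

lemma new_face_neighbour:
  assumes g: "g \<in> cluster_dual_vertices S" 
    and "(new_face (v, a), g) \<in> dual_edges \<or> (g, new_face (v, a)) \<in> dual_edges"
  shows "g = left_face (v, a) \<or> g = right_face (v, a)"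
proof -
  obtain x b c where x: "x \<in> tree_vertices" "new_face (v, a) = right_face (x, b)" "g = right_face (x, c)"
    using assms(2) by (auto simp: dual_edges_eq)
  then have darts: "(x, b) \<in> darts" "(x, c) \<in> darts" by (auto simp: darts_def)
  have "suffix (a # v) x"
    using new_face_suffix[of x b] right_face_self[OF darts(1)] x by simp
  moreover obtain y e where y: "y \<in> S" "(y, e) \<in> g" using cluster_face_vertex[OF g] by metis
  moreover have "(x, c) \<in> g" using x right_face_self[OF darts(2)] by simp
  ultimately have "(a # v, a) \<in> right_face (x, c) \<or> (v, a) \<in> right_face (x, c)"
    using face_crossing[OF darts(2), of x c y e a v] x(3) cluster_not_suffix[of y] by auto
  then have "right_face (a # v, a) = g \<or> right_face (v, a) = g"
    using right_face_eqI[OF _ darts(2)] x(3) by auto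
  moreover have "right_face (a # v, a) = left_face (v, a)"
    by (simp add: left_face_def rev_dart_def leaving_dart)
  ultimately show ?thesis by auto
qed

lemma new_face_no_loop: "(new_face (v, a), new_face (v, a)) \<notin> dual_edges"
  using corner_face_no_loop[OF new_corner] by (simp add: new_face_eq)

lemma new_face_edges: 
  "(left_face (v, a), new_face (v, a)) \<in> dual_edges" "(new_face (v, a), right_face (v, a)) \<in> dual_edges"
proof -
  have "(a # v, b) \<in> darts" for b using leaving_dart by (simp add: darts_def)
  then have edge: "(left_face (a # v, b), right_face (a # v, b)) \<in> dual_edges" for b
    unfolding dual_edges_def by blast
  show "(left_face (v, a), new_face (v, a)) \<in> dual_edges"
    using edge[of "a + 1"] by (simp only: expanded_faces)
  show "(new_face (v, a), right_face (v, a)) \<in> dual_edges"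
    using edge[of "a - 1"] by (simp only: expanded_faces)
qed

text \<open>The new face has degree two in the enlarged triangulation, and its two neighbours are
  adjacent to it; so a coloring extends by any color that differs from their colors.\<close>

lemma dual_colorings_insert:
  "dual_colorings q (insert (a # v) S) =
     (\<lambda>(c, col). c(new_face (v, a) := col)) `
       (SIGMA c : dual_colorings q S. {1..q} - {c (left_face (v, a)), c (right_face (v, a))})"
  (is "?A = ?F ` ?B")
proof
  let ?f = "new_face (v, a)" and ?V = "cluster_dual_vertices S"
  have ne: "g \<noteq> ?f" if "g \<in> ?V" for g using that new_face_fresh by blast
  show "?A \<subseteq> ?F ` ?B"
  proof
    fix c assume "c \<in> ?A"
    then have ext: "c \<in> extensional (insert ?f ?V)" and proper: "proper_coloring (insert ?f ?V) dual_edges q c"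
      by (auto simp: dual_colorings_def cluster_dual_vertices_insert)
    let ?c = "c(?f := undefined)"
    have "?c \<in> extensional ?V" using ext by (simp add: extensional_def)
    moreover have "proper_coloring ?V dual_edges q ?c"
      using proper ne by (simp add: proper_coloring_def)
    ultimately have "?c \<in> dual_colorings q S" by (simp add: dual_colorings_def)
    moreover have "c ?f \<in> {1..q} - {?c (left_face (v, a)), ?c (right_face (v, a))}"
    proof -
      have "c (left_face (v, a)) \<noteq> c ?f" "c ?f \<noteq> c (right_face (v, a))" "c ?f \<in> {1..q}"
        using proper old_faces new_face_edges unfolding proper_coloring_def by blast+
      then show ?thesis using ne old_faces by simp
    qed
    moreover have "c = ?F (?c, c ?f)" by simp
    ultimately show "c \<in> ?F ` ?B" by blast
  qed
  show "?F ` ?B \<subseteq> ?A"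
  proof
    fix c' assume "c' \<in> ?F ` ?B"
    then obtain p where p: "c' = ?F p" "p \<in> ?B" by (rule imageE)
    moreover obtain c col where "p = (c, col)" by fastforce
    ultimately have c: "c \<in> dual_colorings q S" "c' = c(?f := col)"
      and col: "col \<in> {1..q} - {c (left_face (v, a)), c (right_face (v, a))}"
      by simp_all
    then have c3: "col \<in> {1..q}" "col \<noteq> c (left_face (v, a))" "col \<noteq> c (right_face (v, a))"
      by simp_all
    have ext: "c \<in> extensional ?V" and proper: "proper_coloring ?V dual_edges q c"
      using c(1) by (simp_all add: dual_colorings_def)
    have old: "c' g = c g" if "g \<in> ?V" for g using ne[OF that] c(2) by simp
    have new: "c' ?f = col" using c(2) by simp
    have "c' g \<noteq> c' h" if gV: "g \<in> insert ?f ?V" "h \<in> insert ?f ?V" and gh: "(g, h) \<in> dual_edges" for g h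
    proof -
      consider "g = ?f" "h = ?f" | "g = ?f" "h \<in> ?V" | "g \<in> ?V" "h = ?f" | "g \<in> ?V" "h \<in> ?V"
        using gV by blast
      then show ?thesis
      proof cases
        case 1
        then show ?thesis using gh new_face_no_loop by simp
      next
        case 2
        then have "h = left_face (v, a) \<or> h = right_face (v, a)" using gh new_face_neighbour by blast
        then show ?thesis using 2 old[of h] new c3 by auto
      next
        case 3
        then have "g = left_face (v, a) \<or> g = right_face (v, a)" using gh new_face_neighbour by blast
        then show ?thesis using 3 old[of g] new c3 by auto
      next
        case 4
        then show ?thesis using old proper gh by (simp add: proper_coloring_def)
      qed
    qed
    moreover have "c' g \<in> {1..q}" if "g \<in> insert ?f ?V" for g
      using that old new c3(1) proper by (auto simp: proper_coloring_def)
    moreover have "c' \<in> extensional (insert ?f ?V)"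
      using ext c(2) by (simp add: extensional_def)
    ultimately show "c' \<in> ?A"
      unfolding dual_colorings_def cluster_dual_vertices_insert proper_coloring_def by blast
  qed
qed

end

lemma boundary_walk_proper:
  assumes walk: "boundary_walk S ds" and c: "c \<in> dual_colorings q S"
  shows "list_all2 (\<noteq>) (map (c \<circ> left_face) ds) (rotate1 (map (c \<circ> left_face) ds))"
    and "set (map (c \<circ> left_face) ds) \<subseteq> {1..q}"
proof -
  have R: "map right_face ds = rotate1 (map left_face ds)"
    and L: "set (map left_face ds) = cluster_dual_vertices S"
    and darts: "set ds \<subseteq> darts"
    using walk by (auto simp: boundary_walk_def darts_def)
  have "c (left_face d) \<noteq> c (right_face d)" if "d \<in> set ds" for d
  proof -
    have "right_face d \<in> set (map right_face ds)" using that by simp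
    then have "right_face d \<in> cluster_dual_vertices S" unfolding R using L by simp
    moreover have "left_face d \<in> cluster_dual_vertices S" using that L by auto
    moreover have "(left_face d, right_face d) \<in> dual_edges"
      using that darts unfolding dual_edges_def by blast
    ultimately show ?thesis using c by (auto simp: dual_colorings_def proper_coloring_def)
  qed
  then have "list_all2 (\<noteq>) (map (c \<circ> left_face) ds) (map (c \<circ> right_face) ds)"
    by (simp add: list_all2_conv_all_nth)
  also have "map (c \<circ> right_face) ds = rotate1 (map (c \<circ> left_face) ds)"
    using arg_cong[OF R, of "map c"] by (simp add: rotate1_map)
  finally show "list_all2 (\<noteq>) (map (c \<circ> left_face) ds) (rotate1 (map (c \<circ> left_face) ds))" .
  show "set (map (c \<circ> left_face) ds) \<subseteq> {1..q}"
  proof -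
    have "set (map (c \<circ> left_face) ds) = c ` set (map left_face ds)" by (simp add: image_comp)
    then show ?thesis using c unfolding L dual_colorings_def proper_coloring_def by auto
  qed
qed

lemma clockwise_next_walk:
  assumes walk: "boundary_walk S ds" and i: "i < length ds"
  shows "clockwise_next S (left_face (ds ! i)) = left_face (ds ! (Suc i mod length ds))"
proof -
  have R: "map right_face ds = rotate1 (map left_face ds)"
    and L: "distinct (map left_face ds)"
    and ds: "set ds = {(v, a). v \<in> S \<and> neighbour v a \<notin> S}"
    using walk by (auto simp: boundary_walk_def)
  have right: "right_face (ds ! i) = left_face (ds ! (Suc i mod length ds))"
  proof -
    have lt: "Suc i mod length ds < length ds" using i by (intro mod_less_divisor) auto
    have "map right_face ds ! i = rotate1 (map left_face ds) ! i" by (simp only: R)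
    also have "\<dots> = map left_face ds ! (Suc i mod length ds)" using i by (simp add: nth_rotate1)
    finally show ?thesis using i lt by simp
  qed
  show ?thesis
    unfolding clockwise_next_def
  proof (rule the_equality)
    have "ds ! i \<in> set ds" using i by simp
    then obtain v a where va: "ds ! i = (v, a)" "v \<in> S" "neighbour v a \<notin> S" using ds by auto
    then show "\<exists>v\<in>S. \<exists>a. neighbour v a \<notin> S \<and> left_face (ds ! i) = left_face (v, a) \<and>
        left_face (ds ! (Suc i mod length ds)) = right_face (v, a)"
      using right by metis
  next
    fix g assume "\<exists>v\<in>S. \<exists>a. neighbour v a \<notin> S \<and> left_face (ds ! i) = left_face (v, a) \<and> g = right_face (v, a)"
    then obtain v a where va: "(v, a) \<in> set ds" "left_face (ds ! i) = left_face (v, a)" "g = right_face (v, a)"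
      using ds by auto
    have inj: "inj_on left_face (set ds)" using L by (simp add: distinct_map)
    have "ds ! i = (v, a)" using inj_onD[OF inj va(2)] i va(1) by simp
    then show "g = left_face (ds ! (Suc i mod length ds))" using right va by simp
  qed
qed

lemma clockwise_next_walk_iterate:
  assumes walk: "boundary_walk S ds" and i: "i < length ds"
  shows "(clockwise_next S ^^ j) (left_face (ds ! i)) = left_face (ds ! ((i + j) mod length ds))"
proof (induction j)
  case (Suc j)
  have "(i + j) mod length ds < length ds" using i by (intro mod_less_divisor) auto
  then show ?case using Suc clockwise_next_walk[OF walk] by (simp add: mod_Suc_eq)
qed (use i in simp)

section \<open>The colored boundary as a growing necklace\<close>

lemma list_all2_rotate1_iff: "list_all2 (\<noteq>) z (rotate1 z) \<longleftrightarrow> cyc_proper z"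
proof (cases z)
  case (Cons a y)
  have "list_all2 (\<noteq>) (a # y) (y @ [b]) \<longleftrightarrow> distinct_adj (a # y @ [b])" for b
    by (induction y arbitrary: a) auto
  moreover have "distinct_adj (a # y @ [a]) \<longleftrightarrow> cyc_proper (a # y)"
    using distinct_adj_append_iff[of "a # y" "[a]"] by (auto simp: cyc_proper_def)
  ultimately show ?thesis by (simp add: Cons)
qed (simp add: cyc_proper_def)

text \<open>A uniform pair can be chosen in two uniform stages because all fibres have the same
  size.\<close>

lemma pmf_of_set_Sigma:
  assumes A: "finite A" "A \<noteq> {}" and k: "k > 0" "\<And>a. a \<in> A \<Longrightarrow> card (B a) = k"
  shows "pmf_of_set (Sigma A B) = bind_pmf (pmf_of_set A) (\<lambda>a. map_pmf (Pair a) (pmf_of_set (B a)))"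
proof (rule pmf_eqI)
  fix p :: "'a \<times> 'b"
  obtain x y where p: "p = (x, y)" by fastforce
  have B: "finite (B a)" "B a \<noteq> {}" if "a \<in> A" for a
    using k that card_gt_0_iff[of "B a"] by auto
  have fin: "finite (Sigma A B)" using A B by auto
  have ne: "Sigma A B \<noteq> {}" using A B by auto
  have card: "card (Sigma A B) = card A * k" using A B k by (simp add: card_SigmaI)
  have summand: "pmf (map_pmf (Pair a) (pmf_of_set (B a))) (x, y) = (if a = x then indicator (B x) y / k else 0)"
    if a: "a \<in> A" for a
  proof (cases "a = x")
    case True
    then show ?thesis using pmf_map_inj'[of "Pair x" "pmf_of_set (B x)" y] B[OF a] k(2)[OF a]
      by (simp add: inj_on_def)
  next
    case False
    then have "(x, y) \<notin> set_pmf (map_pmf (Pair a) (pmf_of_set (B a)))" by auto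
    then show ?thesis using False by (simp add: pmf_eq_0_set_pmf)
  qed
  have "pmf (bind_pmf (pmf_of_set A) (\<lambda>a. map_pmf (Pair a) (pmf_of_set (B a)))) p =
      (\<Sum>a\<in>A. if a = x then indicator (B x) y / k else 0) / card A"
    unfolding p pmf_bind_pmf_of_set[OF A(2,1)] using summand by (intro arg_cong2[of _ _ _ _ "(/)"] sum.cong) auto
  also have "\<dots> = indicator (Sigma A B) p / (card A * k)"
    using A by (auto simp: p indicator_def)
  finally show "pmf (pmf_of_set (Sigma A B)) p =
      pmf (bind_pmf (pmf_of_set A) (\<lambda>a. map_pmf (Pair a) (pmf_of_set (B a)))) p"
    using fin ne by (simp add: card)
qed

lemma pmf_of_set_image_Sigma:
  assumes A: "finite A" "A \<noteq> {}" and k: "k > 0" "\<And>a. a \<in> A \<Longrightarrow> card (B a) = k"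
    and inj: "inj_on (\<lambda>(a, b). f a b) (Sigma A B)"
  shows "pmf_of_set ((\<lambda>(a, b). f a b) ` Sigma A B) =
    bind_pmf (pmf_of_set A) (\<lambda>a. map_pmf (f a) (pmf_of_set (B a)))"
proof -
  have B: "finite (B a)" "B a \<noteq> {}" if "a \<in> A" for a
    using k that card_gt_0_iff[of "B a"] by auto
  have "pmf_of_set ((\<lambda>(a, b). f a b) ` Sigma A B) = map_pmf (\<lambda>(a, b). f a b) (pmf_of_set (Sigma A B))"
    using A B by (intro map_pmf_of_set_inj[OF inj, symmetric]) auto
  also have "pmf_of_set (Sigma A B) = bind_pmf (pmf_of_set A) (\<lambda>a. map_pmf (Pair a) (pmf_of_set (B a)))"
    by (rule pmf_of_set_Sigma[OF A k])
  finally show ?thesis by (simp add: map_bind_pmf pmf.map_comp comp_def)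
qed

text \<open>Choosing a leaving dart uniformly instead of a boundary vertex gives the same law for
  the cluster, because in a tree each boundary vertex is reached by exactly one leaving dart. The
  list of darts is carried along so that the cyclic order, and a starting point on it, need not be
  recovered from the cluster.\<close>

definition walk_step :: "tvertex set \<times> dart list \<Rightarrow> (tvertex set \<times> dart list) pmf" where
  "walk_step = (\<lambda>(S, ds). map_pmf (\<lambda>i. (insert (neighbour (fst (ds ! i)) (snd (ds ! i))) S,
       take i ds @ expand_dart (ds ! i) @ drop (Suc i) ds)) (pmf_of_set {..<length ds}))"

definition walk_chain :: "nat \<Rightarrow> (tvertex set \<times> dart list) pmf" where
  "walk_chain n = ((\<lambda>p. bind_pmf p walk_step) ^^ n) 
     (return_pmf ({root}, [(root, 0), (root, 1), (root, 2)]))"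

lemma walk_chain_0: "walk_chain 0 = return_pmf ({root}, [(root, 0), (root, 1), (root, 2)])"
  by (simp add: walk_chain_def)

lemma walk_chain_Suc: "walk_chain (Suc n) = bind_pmf (walk_chain n) walk_step"
  by (simp add: walk_chain_def)

lemma boundary_walk_step:
  assumes walk: "boundary_walk S ds" and i: "i < length ds" and va: "ds ! i = (v, a)"
  shows "boundary_walk (insert (neighbour v a) S) (take i ds @ expand_dart (v, a) @ drop (Suc i) ds)"
    and "length (take i ds @ expand_dart (v, a) @ drop (Suc i) ds) = Suc (length ds)"
proof -
  have ds: "ds = take i ds @ (v, a) # drop (Suc i) ds"
    using id_take_nth_drop[OF i] va by simp
  have "(v, a) \<in> set ds" using i va by (metis nth_mem)
  then show "boundary_walk (insert (neighbour v a) S) (take i ds @ expand_dart (v, a) @ drop (Suc i) ds)"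
    using boundary_walk_expand[of S "take i ds" v a "drop (Suc i) ds"] walk ds boundary_walk_leaving(2)[OF walk]
    by simp
  show "length (take i ds @ expand_dart (v, a) @ drop (Suc i) ds) = Suc (length ds)"
    using i by (simp add: expand_dart_def)
qed

lemma walk_chain_support:
  "(S, ds) \<in> set_pmf (walk_chain n) \<Longrightarrow> boundary_walk S ds \<and> length ds = n + 3"
proof (induction n arbitrary: S ds)
  case 0
  then show ?case using boundary_walk_root by (simp add: walk_chain_0)
next
  case (Suc n)
  then obtain S' ds' where prev: "(S', ds') \<in> set_pmf (walk_chain n)" "(S, ds) \<in> set_pmf (walk_step (S', ds'))"
    by (auto simp: walk_chain_Suc)
  then have walk: "boundary_walk S' ds'" "length ds' = n + 3" using Suc.IH by auto
  have "set_pmf (pmf_of_set {..<length ds'}) = {..<length ds'}"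
    using walk by (intro set_pmf_of_set) (simp_all add: lessThan_empty_iff)
  then obtain i where i: "i < length ds'" "S = insert (neighbour (fst (ds' ! i)) (snd (ds' ! i))) S'"
      "ds = take i ds' @ expand_dart (ds' ! i) @ drop (Suc i) ds'"
    using prev(2) by (auto simp: walk_step_def)
  then show ?case
    using boundary_walk_step[OF walk(1) i(1), of "fst (ds' ! i)" "snd (ds' ! i)"] walk(2) by simp
qed

lemma walk_step_eden_grow:
  assumes walk: "boundary_walk S ds" and ne: "ds \<noteq> []"
  shows "map_pmf fst (walk_step (S, ds)) = eden_grow S"
proof -
  let ?w = "\<lambda>i. neighbour (fst (ds ! i)) (snd (ds ! i))"
  have ds: "distinct ds" "set ds = {(v, a). v \<in> S \<and> neighbour v a \<notin> S}"
    using walk by (auto simp: boundary_walk_def)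
  have "inj_on ?w {..<length ds}"
  proof (rule inj_onI)
    fix i j assume ij: "i \<in> {..<length ds}" "j \<in> {..<length ds}" "?w i = ?w j"
    then have "ds ! i = ds ! j" by (intro boundary_darts_inj[OF walk]) auto
    then show "i = j" using ds(1) ij by (simp add: nth_eq_iff_index_eq)
  qed
  moreover have "?w ` {..<length ds} = tree_boundary S"
  proof -
    have "?w ` {..<length ds} = (\<lambda>d. neighbour (fst d) (snd d)) ` set ds"
      by (force simp: set_conv_nth)
    also have "\<dots> = tree_boundary S" unfolding ds(2) tree_boundary_def by force
    finally show ?thesis .
  qed
  ultimately have "pmf_of_set (tree_boundary S) = map_pmf ?w (pmf_of_set {..<length ds})"
    using map_pmf_of_set_inj[of ?w "{..<length ds}"] ne by (simp add: lessThan_empty_iff)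
  then show ?thesis
    by (simp add: eden_grow_def walk_step_def pmf.map_comp comp_def)
qed

lemma eden_cluster_walk: "eden_cluster (Suc n) = map_pmf fst (walk_chain n)"
proof (induction n)
  case 0
  then show ?case by (simp add: eden_cluster_def walk_chain_0)
next
  case (Suc n)
  have "map_pmf fst (walk_chain (Suc n)) = bind_pmf (walk_chain n) (\<lambda>s. map_pmf fst (walk_step s))"
    by (simp add: walk_chain_Suc map_bind_pmf)
  also have "\<dots> = bind_pmf (walk_chain n) (\<lambda>s. eden_grow (fst s))"
  proof (rule bind_pmf_cong)
    fix s assume s: "s \<in> set_pmf (walk_chain n)"
    obtain S ds where "s = (S, ds)" by fastforce
    then show "map_pmf fst (walk_step s) = eden_grow (fst s)"
      using walk_chain_support[of S ds n] s by (auto intro!: walk_step_eden_grow)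
  qed simp
  also have "\<dots> = eden_cluster (Suc (Suc n))"
    using Suc by (simp add: eden_cluster_def bind_map_pmf)
  finally show ?case by simp
qed

lemma boundary_walk_faces: "boundary_walk S ds \<Longrightarrow> set (map left_face ds) = cluster_dual_vertices S"
  unfolding boundary_walk_def by blast

lemma cyc_proper_boundary_word:
  assumes "boundary_walk S ds" "c \<in> dual_colorings q S"
  shows "cyc_proper (map (c \<circ> left_face) ds)"
  using boundary_walk_proper(1)[OF assms] by (simp only: list_all2_rotate1_iff)

lemma finite_dual_colorings:
  assumes "boundary_walk S ds"
  shows "finite (dual_colorings q S)"
proof -
  have "finite (cluster_dual_vertices S)"
    unfolding boundary_walk_faces[OF assms, symmetric] by (rule List.finite_set)
  then have "finite (cluster_dual_vertices S \<rightarrow>\<^sub>E {1..q})" by (intro finite_PiE) auto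
  moreover have "dual_colorings q S \<subseteq> cluster_dual_vertices S \<rightarrow>\<^sub>E {1..q}"
    unfolding dual_colorings_def proper_coloring_def by (auto simp: PiE_def)
  ultimately show ?thesis by (rule finite_subset[rotated])
qed

definition insert_bead :: "nat \<Rightarrow> nat \<Rightarrow> nat list \<Rightarrow> nat list" where
  "insert_bead i col xs = take (Suc i) xs @ col # drop (Suc i) xs"

definition free_colors :: "nat \<Rightarrow> nat \<Rightarrow> nat list \<Rightarrow> nat set" where
  "free_colors q i xs = {1..q} - {xs ! i, xs ! (Suc i mod length xs)}"

lemma cyc_proper_neighbours:
  assumes "cyc_proper xs" "i < length xs"
  shows "xs ! i \<noteq> xs ! (Suc i mod length xs)"
proof -
  have "list_all2 (\<noteq>) xs (rotate1 xs)" using assms by (simp only: list_all2_rotate1_iff)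
  then show ?thesis using assms(2) by (auto simp: list_all2_conv_all_nth nth_rotate1)
qed

text \<open>The two neighbours of a gap have different colors; this is what makes the number of
  colorings of \<open>D\<^sub>n\<close> independent of the cluster.\<close>

lemma card_free_colors:
  assumes "cyc_proper xs" "i < length xs" "set xs \<subseteq> {1..q}"
  shows "card (free_colors q i xs) = q - 2"
proof -
  have "Suc i mod length xs < length xs" using assms(2) by (intro mod_less_divisor) auto
  then have "xs ! i \<in> {1..q}" "xs ! (Suc i mod length xs) \<in> {1..q}"
    using assms(2,3) nth_mem by blast+
  then have "card (free_colors q i xs) = card {1..q} - card {xs ! i, xs ! (Suc i mod length xs)}"
    unfolding free_colors_def by (intro card_Diff_subset) auto
  then show ?thesis using cyc_proper_neighbours[OF assms(1,2)] by simp
qed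

text \<open>The equality of the fibre sizes, \<open>q - 2\<close> for each coloring of the old
  cluster, turns the description of the colorings in \<open>dual_colorings_insert\<close> into a
  two-stage random choice.\<close>

lemma dual_colorings_step:
  assumes walk: "boundary_walk S ds" and i: "i < length ds" and va: "ds ! i = (v, a)"
    and q: "q \<ge> 3" and ne: "dual_colorings q S \<noteq> {}"
  shows "pmf_of_set (dual_colorings q (insert (neighbour v a) S)) =
      bind_pmf (pmf_of_set (dual_colorings q S)) (\<lambda>c.
        map_pmf (\<lambda>col. c(new_face (v, a) := col))
          (pmf_of_set (free_colors q i (map (c \<circ> left_face) ds))))" (is ?eq)
    and "dual_colorings q (insert (neighbour v a) S) \<noteq> {}" (is ?ne)
    and "c \<in> dual_colorings q S \<Longrightarrow>
      map (c(new_face (v, a) := col) \<circ> left_face) (take i ds @ expand_dart (v, a) @ drop (Suc i) ds)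
        = insert_bead i col (map (c \<circ> left_face) ds)" (is "_ \<Longrightarrow> ?word")
proof -
  have ds: "ds = take i ds @ (v, a) # drop (Suc i) ds"
    using id_take_nth_drop[OF i] va by simp
  have walk': "boundary_walk S (take i ds @ (v, a) # drop (Suc i) ds)" using walk ds by simp
  note facts = leaving_dart[OF walk'] expanded_faces[OF walk'] new_face_fresh[OF walk']
  have w: "neighbour v a = a # v" by (rule facts)
  let ?B = "\<lambda>c. free_colors q i (map (c \<circ> left_face) ds)"
  have B: "?B c = {1..q} - {c (left_face (v, a)), c (right_face (v, a))}" for c
  proof -
    have lt: "Suc i mod length ds < length ds" using i by (intro mod_less_divisor) auto
    have "map right_face ds = rotate1 (map left_face ds)" using walk by (simp add: boundary_walk_def)
    then have "map right_face ds ! i = rotate1 (map left_face ds) ! i" by (simp only:)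
    then have "right_face (v, a) = left_face (ds ! (Suc i mod length ds))" 
      using i va lt by (simp add: nth_rotate1)
    then show ?thesis using i va lt by (simp add: free_colors_def)
  qed
  have cardB: "card (?B c) = q - 2" if "c \<in> dual_colorings q S" for c
    using that i cyc_proper_boundary_word[OF walk that] boundary_walk_proper(2)[OF walk that]
    by (intro card_free_colors) auto
  have img: "dual_colorings q (insert (neighbour v a) S) =
     (\<lambda>(c, col). c(new_face (v, a) := col)) ` (SIGMA c : dual_colorings q S. ?B c)"
    unfolding w B by (rule dual_colorings_insert[OF walk'])
  have inj: "inj_on (\<lambda>(c, col). c(new_face (v, a) := col)) (SIGMA c : dual_colorings q S. ?B c)"
  proof (rule inj_onI, clarify)
    fix c col c' col' 
    assume c: "c \<in> dual_colorings q S" "c' \<in> dual_colorings q S" 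
      and eq: "c(new_face (v, a) := col) = c'(new_face (v, a) := col')"
    have "c (new_face (v, a)) = undefined" "c' (new_face (v, a)) = undefined"
      using c facts by (auto simp: dual_colorings_def extensional_def)
    then have "c = (c(new_face (v, a) := col))(new_face (v, a) := undefined)"
      "c' = (c'(new_face (v, a) := col'))(new_face (v, a) := undefined)" by auto
    then show "c = c' \<and> col = col'" using eq by (metis fun_upd_same)
  qed
  show ?eq unfolding img
    using finite_dual_colorings[OF walk] ne cardB q inj by (intro pmf_of_set_image_Sigma[where k = "q - 2"]) auto
  have "?B c \<noteq> {}" if "c \<in> dual_colorings q S" for c
    using cardB[OF that] q by (intro notI) simp
  then show ?ne unfolding img using ne by blast
  show ?word if c: "c \<in> dual_colorings q S"
  proof -
    let ?c = "c(new_face (v, a) := col)"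
    have "left_face d \<noteq> new_face (v, a)" if "d \<in> set ds" for d
    proof -
      have "left_face d \<in> set (map left_face ds)" using that by simp
      also have "\<dots> = cluster_dual_vertices S" by (rule boundary_walk_faces[OF walk])
      finally show ?thesis using new_face_fresh[OF walk'] by auto
    qed
    then have same: "map (?c \<circ> left_face) ds' = map (c \<circ> left_face) ds'" if "set ds' \<subseteq> set ds" for ds'
      using that by auto
    have "left_face (v, a) \<noteq> new_face (v, a)" using old_faces[OF walk'] facts by auto
    then have "map (?c \<circ> left_face) (expand_dart (v, a)) = [c (left_face (v, a)), col]"
      using facts by (simp add: expand_dart_def)
    moreover have "take (Suc i) (map (c \<circ> left_face) ds) = map (c \<circ> left_face) (take i ds) @ [c (left_face (v, a))]"
      using i va by (simp add: take_Suc_conv_app_nth take_map)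
    ultimately show ?thesis 
      using same[OF set_take_subset] same[OF set_drop_subset] by (simp add: insert_bead_def drop_map)
  qed
qed

text \<open>The colors around the outer face, read from the face on the left of the initial dart,
  which remains on the outer face forever.\<close>

definition boundary_word :: "nat \<Rightarrow> nat \<Rightarrow> nat list pmf" where
  "boundary_word q n = bind_pmf (walk_chain n) (\<lambda>(S, ds).
     map_pmf (\<lambda>c. map (c \<circ> left_face) ds) (pmf_of_set (dual_colorings q S)))"

text \<open>Starting at a uniformly chosen face of the outer cycle is rotating the boundary word
  by a uniform amount.\<close>

lemma eden_cycle_coloring_rotation:
  "eden_cycle_coloring q (Suc n) =
     bind_pmf (boundary_word q n) (\<lambda>xs. map_pmf (\<lambda>r. rotate r xs) (pmf_of_set {..<n + 3}))"
proof -
  have "eden_cycle_coloring q (Suc n) = bind_pmf (walk_chain n) (\<lambda>s.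
     bind_pmf (pmf_of_set (dual_colorings q (fst s))) (\<lambda>c.
     map_pmf (\<lambda>u. map (\<lambda>i. c ((clockwise_next (fst s) ^^ i) u)) [0..<n + 3])
       (pmf_of_set (cluster_dual_vertices (fst s)))))"
    by (simp add: eden_cycle_coloring_def eden_cluster_walk bind_map_pmf numeral_3_eq_3)
  also have "\<dots> = bind_pmf (walk_chain n) (\<lambda>s.
     bind_pmf (pmf_of_set (dual_colorings q (fst s))) (\<lambda>c.
       map_pmf (\<lambda>r. rotate r (map (c \<circ> left_face) (snd s))) (pmf_of_set {..<n + 3})))"
  proof (intro bind_pmf_cong refl)
    fix s c assume s: "s \<in> set_pmf (walk_chain n)"
    obtain S ds where sd: "s = (S, ds)" by fastforce
    have walk: "boundary_walk S ds" and len: "length ds = n + 3"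
      using walk_chain_support s sd by auto
    have L: "distinct (map left_face ds)" "set (map left_face ds) = cluster_dual_vertices S"
      using walk by (auto simp: boundary_walk_def)
    let ?u = "\<lambda>r. left_face (ds ! r)"
    have "inj_on ?u {..<n + 3}"
      using L(1) len by (auto simp: inj_on_def distinct_conv_nth)
    moreover have "?u ` {..<n + 3} = cluster_dual_vertices S"
      unfolding L(2)[symmetric] using len by (force simp: set_conv_nth)
    moreover have nonempty: "{..<n + 3} \<noteq> {}" by (simp add: lessThan_empty_iff)
    ultimately have "pmf_of_set (cluster_dual_vertices S) = map_pmf ?u (pmf_of_set {..<n + 3})"
      using map_pmf_of_set_inj[of ?u "{..<n + 3}"] by simp
    moreover have support: "set_pmf (pmf_of_set {..<n + 3}) = {..<n + 3}"
      using nonempty by (intro set_pmf_of_set) auto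
    moreover have "map (\<lambda>i. c ((clockwise_next S ^^ i) (?u r))) [0..<n + 3] = rotate r (map (c \<circ> left_face) ds)"
      if "r < n + 3" for r
    proof (rule nth_equalityI)
      fix i assume "i < length (map (\<lambda>i. c ((clockwise_next S ^^ i) (?u r))) [0..<n + 3])"
      then have i: "i < n + 3" by simp
      have "(r + i) mod (n + 3) < n + 3" by (rule mod_less_divisor) simp
      then show "map (\<lambda>i. c ((clockwise_next S ^^ i) (?u r))) [0..<n + 3] ! i = rotate r (map (c \<circ> left_face) ds) ! i"
        using i that clockwise_next_walk_iterate[OF walk, of r i] len by (simp add: nth_rotate del: upt_Suc)
    qed (simp add: len)
    ultimately show "map_pmf (\<lambda>u. map (\<lambda>i. c ((clockwise_next (fst s) ^^ i) u)) [0..<n + 3])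
       (pmf_of_set (cluster_dual_vertices (fst s))) =
       map_pmf (\<lambda>r. rotate r (map (c \<circ> left_face) (snd s))) (pmf_of_set {..<n + 3})"
      unfolding sd by (simp add: pmf.map_comp comp_def) (rule map_pmf_cong, simp_all add: support)
  qed
  also have "\<dots> = bind_pmf (boundary_word q n) (\<lambda>xs. map_pmf (\<lambda>r. rotate r xs) (pmf_of_set {..<n + 3}))"
    by (simp add: boundary_word_def bind_assoc_pmf case_prod_beta bind_map_pmf)
  finally show ?thesis .
qed

lemma cyc_proper_3: "cyc_proper [x, y, z] \<longleftrightarrow> distinct [x, y, z]"
  by (auto simp: cyc_proper_def)

text \<open>The three faces at the root are pairwise adjacent, so their colorings are the triples
  of distinct colors.\<close>

lemma boundary_word_0:
  assumes q: "q \<ge> 3"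
  shows "boundary_word q 0 = pmf_of_set {xs \<in> words q 3. distinct xs}" "dual_colorings q {root} \<noteq> {}"
proof -
  define F where "F i = left_face (root, i)" for i :: 3
  let ?ds = "[(root, 0), (root, 1), (root, 2 :: 3)]"
  note walk = boundary_walk_root
  have V: "cluster_dual_vertices {root} = {F 0, F 1, F 2}"
    using boundary_walk_faces[OF walk] by (simp add: F_def)
  have neq: "F i = F j \<longleftrightarrow> i = j" for i j
    by (simp add: F_def left_face_root right_face_root_inj)
  have loop: "(F i, F i) \<notin> dual_edges" for i
    unfolding F_def left_face_root by (rule corner_face_no_loop) (simp add: root_def)
  let ?g = "\<lambda>c :: dvertex \<Rightarrow> nat. [c (F 0), c (F 1), c (F 2)]"
  have g: "map (c \<circ> left_face) ?ds = ?g c" for c by (simp add: F_def)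
  have inj: "inj_on ?g (dual_colorings q {root})"
  proof (rule inj_onI)
    fix c c' assume c: "c \<in> dual_colorings q {root}" "c' \<in> dual_colorings q {root}" "?g c = ?g c'"
    show "c = c'"
    proof (rule extensionalityI)
      show "c \<in> extensional {F 0, F 1, F 2}" "c' \<in> extensional {F 0, F 1, F 2}"
        using c(1,2) by (simp_all add: dual_colorings_def V)
      show "c x = c' x" if "x \<in> {F 0, F 1, F 2}" for x using that c(3) by auto
    qed
  qed
  have img: "?g ` dual_colorings q {root} = {xs \<in> words q 3. distinct xs}"
  proof (intro subset_antisym subsetI)
    fix xs assume "xs \<in> ?g ` dual_colorings q {root}"
    then obtain c where c: "c \<in> dual_colorings q {root}" "xs = ?g c" by blast
    have "set xs \<subseteq> {1..q}" using boundary_walk_proper(2)[OF walk c(1)] unfolding g c(2) .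
    moreover have "distinct xs"
      using cyc_proper_boundary_word[OF walk c(1)] unfolding g c(2) cyc_proper_3 .
    ultimately show "xs \<in> {xs \<in> words q 3. distinct xs}" using c(2) by (simp add: words_def)
  next
    fix xs assume xs: "xs \<in> {xs \<in> words q 3. distinct xs}"
    then obtain x y z where xyz: "xs = [x, y, z]"
      by (auto simp: words_def numeral_3_eq_3 length_Suc_conv)
    define c where "c = (\<lambda>_. undefined)(F 0 := x, F 1 := y, F 2 := z)"
    have val: "c (F 0) = x" "c (F 1) = y" "c (F 2) = z" by (auto simp: c_def neq)
    have "c \<in> extensional {F 0, F 1, F 2}" by (auto simp: c_def extensional_def)
    moreover have "c u \<noteq> c v" if "u \<in> {F 0, F 1, F 2}" "v \<in> {F 0, F 1, F 2}" "(u, v) \<in> dual_edges" for u v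
    proof -
      have "u \<noteq> v" using that loop by auto
      then show ?thesis using that(1,2) xs unfolding xyz by (auto simp: val)
    qed
    moreover have "c u \<in> {1..q}" if "u \<in> {F 0, F 1, F 2}" for u
      using that xs unfolding xyz words_def by (auto simp: val)
    ultimately have "c \<in> dual_colorings q {root}"
      unfolding dual_colorings_def proper_coloring_def V by blast
    moreover have "xs = ?g c" by (simp add: xyz val)
    ultimately show "xs \<in> ?g ` dual_colorings q {root}" by blast
  qed
  have "[1, 2, 3] \<in> {xs \<in> words q 3. distinct xs}" using q by (simp add: words_def)
  then show ne: "dual_colorings q {root} \<noteq> {}" using img by auto
  have "boundary_word q 0 = map_pmf ?g (pmf_of_set (dual_colorings q {root}))"
    unfolding boundary_word_def walk_chain_0 by (simp add: bind_return_pmf F_def)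
  also have "\<dots> = pmf_of_set (?g ` dual_colorings q {root})"
    by (rule map_pmf_of_set_inj[OF inj ne finite_dual_colorings[OF walk]])
  finally show "boundary_word q 0 = pmf_of_set {xs \<in> words q 3. distinct xs}" unfolding img .
qed

lemma dual_colorings_nonempty:
  assumes q: "q \<ge> 3"
  shows "(S, ds) \<in> set_pmf (walk_chain n) \<Longrightarrow> dual_colorings q S \<noteq> {}"
proof (induction n arbitrary: S ds)
  case 0
  then show ?case using boundary_word_0(2)[OF q] by (simp add: walk_chain_0)
next
  case (Suc n)
  then obtain S' ds' where prev: "(S', ds') \<in> set_pmf (walk_chain n)" "(S, ds) \<in> set_pmf (walk_step (S', ds'))"
    by (auto simp: walk_chain_Suc)
  then have walk: "boundary_walk S' ds'" "length ds' = n + 3" using walk_chain_support by auto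
  have "set_pmf (pmf_of_set {..<length ds'}) = {..<length ds'}"
    using walk by (intro set_pmf_of_set) (simp_all add: lessThan_empty_iff)
  then obtain i where i: "i < length ds'" "S = insert (neighbour (fst (ds' ! i)) (snd (ds' ! i))) S'"
    using prev(2) by (auto simp: walk_step_def)
  show ?case unfolding i(2)
    by (rule dual_colorings_step(2)[OF walk(1) i(1) _ q Suc.IH[OF prev(1)]]) simp
qed

definition insert_random_bead :: "nat \<Rightarrow> nat list \<Rightarrow> nat list pmf" where
  "insert_random_bead q xs = bind_pmf (pmf_of_set {..<length xs}) (\<lambda>i.
     map_pmf (\<lambda>col. insert_bead i col xs) (pmf_of_set (free_colors q i xs)))"

text \<open>Given the cluster, the position of the new bead does not depend on the coloring.
  Exchanging the two random choices makes the boundary word a Markov chain of its own.\<close>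

lemma boundary_word_Suc:
  assumes q: "q \<ge> 3"
  shows "boundary_word q (Suc n) = bind_pmf (boundary_word q n) (insert_random_bead q)"
proof -
  let ?col = "\<lambda>(S, ds). map_pmf (\<lambda>c. map (c \<circ> left_face) ds) (pmf_of_set (dual_colorings q S))"
  have "boundary_word q (Suc n) = bind_pmf (walk_chain n) (\<lambda>s. bind_pmf (walk_step s) ?col)"
    by (simp add: boundary_word_def walk_chain_Suc bind_assoc_pmf)
  also have "\<dots> = bind_pmf (walk_chain n) (\<lambda>s. bind_pmf (?col s) (insert_random_bead q))"
  proof (rule bind_pmf_cong)
    fix s assume s: "s \<in> set_pmf (walk_chain n)"
    obtain S ds where sd: "s = (S, ds)" by fastforce
    have walk: "boundary_walk S ds" and len: "length ds = n + 3"
      using walk_chain_support s sd by auto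
    have ne: "dual_colorings q S \<noteq> {}" using dual_colorings_nonempty[OF q] s sd by auto
    have setI: "set_pmf (pmf_of_set {..<length ds}) = {..<length ds}"
      using len by (intro set_pmf_of_set) (simp_all add: lessThan_empty_iff)
    have setD: "set_pmf (pmf_of_set (dual_colorings q S)) = dual_colorings q S"
      by (rule set_pmf_of_set[OF ne finite_dual_colorings[OF walk]])
    let ?S = "\<lambda>i. insert (neighbour (fst (ds ! i)) (snd (ds ! i))) S"
    let ?ds = "\<lambda>i. take i ds @ expand_dart (ds ! i) @ drop (Suc i) ds"
    let ?word = "\<lambda>c. map (c \<circ> left_face) ds"
    have "bind_pmf (walk_step s) ?col = bind_pmf (pmf_of_set {..<length ds}) (\<lambda>i.
        map_pmf (\<lambda>c. map (c \<circ> left_face) (?ds i)) (pmf_of_set (dual_colorings q (?S i))))"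
      by (simp add: sd walk_step_def bind_map_pmf)
    also have "\<dots> = bind_pmf (pmf_of_set {..<length ds}) (\<lambda>i. bind_pmf (pmf_of_set (dual_colorings q S)) (\<lambda>c.
        map_pmf (\<lambda>col. insert_bead i col (?word c)) (pmf_of_set (free_colors q i (?word c)))))"
    proof (rule bind_pmf_cong)
      fix i assume "i \<in> set_pmf (pmf_of_set {..<length ds})"
      then have i: "i < length ds" using setI by simp
      obtain v a where va: "ds ! i = (v, a)" by fastforce
      have "map_pmf (\<lambda>c. map (c \<circ> left_face) (?ds i)) (pmf_of_set (dual_colorings q (?S i))) =
          bind_pmf (pmf_of_set (dual_colorings q S)) (\<lambda>c. map_pmf (\<lambda>col. 
            map (c(new_face (v, a) := col) \<circ> left_face) (take i ds @ expand_dart (v, a) @ drop (Suc i) ds))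
            (pmf_of_set (free_colors q i (?word c))))"
        unfolding va fst_conv snd_conv dual_colorings_step(1)[OF walk i va q ne]
        by (simp only: map_bind_pmf pmf.map_comp comp_def)
      also have "\<dots> = bind_pmf (pmf_of_set (dual_colorings q S)) (\<lambda>c.
          map_pmf (\<lambda>col. insert_bead i col (?word c)) (pmf_of_set (free_colors q i (?word c))))"
      proof (intro bind_pmf_cong map_pmf_cong refl)
        fix c col assume "c \<in> set_pmf (pmf_of_set (dual_colorings q S))"
        then have "c \<in> dual_colorings q S" unfolding setD .
        then show "map (c(new_face (v, a) := col) \<circ> left_face) (take i ds @ expand_dart (v, a) @ drop (Suc i) ds) =
            insert_bead i col (?word c)" by (rule dual_colorings_step(3)[OF walk i va q ne])
      qed
      finally show "map_pmf (\<lambda>c. map (c \<circ> left_face) (?ds i)) (pmf_of_set (dual_colorings q (?S i))) = \<dots>" .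
    qed simp
    also have "\<dots> = bind_pmf (pmf_of_set (dual_colorings q S)) (\<lambda>c. insert_random_bead q (?word c))"
      by (subst bind_commute_pmf) (simp add: insert_random_bead_def)
    also have "\<dots> = bind_pmf (?col s) (insert_random_bead q)"
      by (simp add: sd bind_map_pmf)
    finally show "bind_pmf (walk_step s) ?col = bind_pmf (?col s) (insert_random_bead q)" .
  qed simp
  also have "\<dots> = bind_pmf (boundary_word q n) (insert_random_bead q)"
    by (simp add: boundary_word_def bind_assoc_pmf)
  finally show ?thesis .
qed

lemma boundary_word_support:
  assumes q: "q \<ge> 3" and xs: "xs \<in> set_pmf (boundary_word q n)"
  shows "xs \<in> words q (n + 3)" "cyc_proper xs"
proof -
  obtain S ds where sd: "(S, ds) \<in> set_pmf (walk_chain n)"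
    "xs \<in> set_pmf (map_pmf (\<lambda>c. map (c \<circ> left_face) ds) (pmf_of_set (dual_colorings q S)))"
    using xs by (auto simp: boundary_word_def)
  have walk: "boundary_walk S ds" and len: "length ds = n + 3"
    using walk_chain_support sd(1) by auto
  have "set_pmf (pmf_of_set (dual_colorings q S)) = dual_colorings q S"
    by (rule set_pmf_of_set[OF dual_colorings_nonempty[OF q sd(1)] finite_dual_colorings[OF walk]])
  then obtain c where c: "c \<in> dual_colorings q S" "xs = map (c \<circ> left_face) ds"
    using sd(2) by auto
  show "xs \<in> words q (n + 3)" using boundary_walk_proper(2)[OF walk c(1)] len by (simp add: c(2) words_def)
  show "cyc_proper xs" unfolding c(2) by (rule cyc_proper_boundary_word[OF walk c(1)])
qed

section \<open>The law of the cycle coloring\<close>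

lemma insert_bead_delete:
  assumes "length y = Suc (length xs)" "i < length xs"
  shows "insert_bead i col xs = y \<longleftrightarrow> xs = delete_nth (Suc i) y \<and> y ! Suc i = col"
proof
  assume "insert_bead i col xs = y"
  then have y: "y = take (Suc i) xs @ col # drop (Suc i) xs" by (simp add: insert_bead_def)
  have "length (take (Suc i) xs) = Suc i" using assms(2) by simp
  then show "xs = delete_nth (Suc i) y \<and> y ! Suc i = col"
    by (simp add: y delete_nth_def nth_append del: take_Suc_conv_app_nth)
next
  assume del: "xs = delete_nth (Suc i) y \<and> y ! Suc i = col"
  have len: "length (take (Suc i) y) = Suc i" using assms by simp
  have xs: "xs = take (Suc i) y @ drop (Suc (Suc i)) y" using del by (simp add: delete_nth_def)
  have "take (Suc i) xs = take (Suc i) y" "drop (Suc i) xs = drop (Suc (Suc i)) y"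
    using len unfolding xs by simp_all
  then show "insert_bead i col xs = y"
    using id_take_nth_drop[of "Suc i" y] assms del by (simp add: insert_bead_def)
qed

lemma cyc_proper_insert_bead:
  assumes xs: "cyc_proper xs" "i < length xs"
  shows "cyc_proper (insert_bead i col xs) \<longleftrightarrow> col \<noteq> xs ! i \<and> col \<noteq> xs ! (Suc i mod length xs)"
proof -
  define P Q where "P = take i xs" and "Q = drop (Suc i) xs"
  have dec: "xs = P @ xs ! i # Q" unfolding P_def Q_def by (rule id_take_nth_drop[OF xs(2)])
  have ins: "insert_bead i col xs = P @ xs ! i # col # Q"
    using xs(2) by (simp add: insert_bead_def P_def Q_def take_Suc_conv_app_nth)
  have lenP: "length P = i" using xs(2) by (simp add: P_def)
  show ?thesis
  proof (cases Q)
    case Nil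
    then have len: "length xs = Suc i" using dec lenP by (metis length_append_singleton)
    have "xs ! (Suc i mod length xs) = hd xs"
      using len by (cases xs) auto
    moreover have "last xs = xs ! i" using dec Nil by (metis last_snoc)
    moreover have "insert_bead i col xs = xs @ [col]" using ins Nil dec by (metis append.assoc append_Cons append_Nil)
    moreover have "xs \<noteq> []" using len by auto
    ultimately show ?thesis using xs(1) by (auto simp: cyc_proper_def distinct_adj_append_iff)
  next
    case (Cons b R)
    have "length xs = length P + Suc (Suc (length R))" using dec Cons by (metis length_append length_Cons)
    then have "Suc i < length xs" using lenP by simp
    moreover have "xs ! Suc i = b" 
      using dec Cons lenP by (metis nth_append_length nth_Cons_Suc nth_Cons_0 append.assoc append_Cons append_Nil length_append_singleton)
    ultimately have b: "xs ! (Suc i mod length xs) = b" by simp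
    obtain p where p: "xs ! i = p" by simp
    have "cyc_proper (P @ p # b # R)" using xs(1) dec Cons p by simp
    then show ?thesis unfolding b ins p Cons
      by (cases P) (auto simp: cyc_proper_def distinct_adj_append_iff distinct_adj_Cons hd_append)
  qed
qed

text \<open>Bead \<open>0\<close> is never the inserted one, so the last insertion at position
  \<open>i + 1\<close> is undone by deleting the letter there, for \<open>i < m\<close>; the color
  can be read off the result.\<close>

lemma pmf_insert_random_bead:
  assumes q: "q \<ge> 3" and xs: "xs \<in> words q m" "cyc_proper xs" "m > 0"
  shows "pmf (insert_random_bead q xs) y =
    (\<Sum>i<m. of_bool (y \<in> words q (Suc m) \<and> cyc_proper y \<and> xs = delete_nth (Suc i) y)) / (real m * (real q - 2))"
proof -
  have len: "length xs = m" and sub: "set xs \<subseteq> {1..q}" using xs by (auto simp: words_def)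
  have one: "pmf (map_pmf (\<lambda>col. insert_bead i col xs) (pmf_of_set (free_colors q i xs))) y =
      of_bool (y \<in> words q (Suc m) \<and> cyc_proper y \<and> xs = delete_nth (Suc i) y) / (real q - 2)"
    if i: "i < m" for i
  proof -
    let ?C = "free_colors q i xs"
    have card: "card ?C = q - 2" using card_free_colors[OF xs(2) _ sub, of i] i len by simp
    have C: "finite ?C" "?C \<noteq> {}" using card q card_gt_0_iff[of ?C] by auto
    have inj: "inj_on (\<lambda>col. insert_bead i col xs) ?C"
      by (auto simp: inj_on_def insert_bead_def)
    have "y \<in> (\<lambda>col. insert_bead i col xs) ` ?C \<longleftrightarrow> y \<in> words q (Suc m) \<and> cyc_proper y \<and> xs = delete_nth (Suc i) y"
    proof
      assume "y \<in> (\<lambda>col. insert_bead i col xs) ` ?C"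
      then obtain col where col: "col \<in> ?C" "y = insert_bead i col xs" by blast
      have leny: "length y = Suc (length xs)" using i len by (simp add: col(2) insert_bead_def)
      have "set y \<subseteq> insert col (set xs)" unfolding col(2) insert_bead_def
        by (auto dest: in_set_takeD in_set_dropD)
      then have "y \<in> words q (Suc m)" using col(1) sub leny len by (auto simp: words_def free_colors_def)
      moreover have "cyc_proper y" 
        using cyc_proper_insert_bead[OF xs(2), of i col] col i len by (auto simp: free_colors_def)
      moreover have "xs = delete_nth (Suc i) y"
        using insert_bead_delete[OF leny, of i col] col(2) i len by simp
      ultimately show "y \<in> words q (Suc m) \<and> cyc_proper y \<and> xs = delete_nth (Suc i) y" by blast
    next
      assume y: "y \<in> words q (Suc m) \<and> cyc_proper y \<and> xs = delete_nth (Suc i) y"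
      then have leny: "length y = Suc (length xs)" using len by (simp add: words_def)
      have eq: "y = insert_bead i (y ! Suc i) xs"
        using insert_bead_delete[OF leny, of i "y ! Suc i"] y i len by simp
      have "y ! Suc i \<in> set y" using leny i len by simp
      then have "y ! Suc i \<in> {1..q}" using y by (auto simp: words_def)
      then have "y ! Suc i \<in> ?C"
        using cyc_proper_insert_bead[OF xs(2), of i "y ! Suc i"] eq y i len by (auto simp: free_colors_def)
      then show "y \<in> (\<lambda>col. insert_bead i col xs) ` ?C" using eq by blast
    qed
    then show ?thesis
      using C q by (simp add: map_pmf_of_set_inj[OF inj C(2,1)] card_image[OF inj] card indicator_def of_nat_diff)
  qed
  have "{..<m} \<noteq> {}" using xs(3) by (simp add: lessThan_empty_iff)
  then have "pmf (insert_random_bead q xs) y = 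
      (\<Sum>i<m. of_bool (y \<in> words q (Suc m) \<and> cyc_proper y \<and> xs = delete_nth (Suc i) y) / (real q - 2)) / real m"
    unfolding insert_random_bead_def len by (subst pmf_bind_pmf_of_set) (auto simp: one)
  then show ?thesis by (simp add: sum_divide_distrib[symmetric] mult.commute)
qed

lemma pmf_boundary_word_Suc:
  assumes q: "q \<ge> 3"
  shows "pmf (boundary_word q (Suc n)) y = of_bool (y \<in> words q (n + 4) \<and> cyc_proper y) *
    (\<Sum>i<n + 3. pmf (boundary_word q n) (delete_nth (Suc i) y)) / (real (n + 3) * (real q - 2))"
proof -
  let ?P = "boundary_word q n" and ?m = "n + 3"
  let ?good = "y \<in> words q (n + 4) \<and> cyc_proper y"
  have "pmf (boundary_word q (Suc n)) y = (\<Sum>xs\<in>words q ?m. pmf (insert_random_bead q xs) y * pmf ?P xs)"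
    unfolding boundary_word_Suc[OF q] pmf_bind
    by (rule integral_measure_pmf_real[OF finite_words]) (rule boundary_word_support(1)[OF q])
  also have "\<dots> = (\<Sum>xs\<in>words q ?m. \<Sum>i<?m. 
      of_bool ?good * (if xs = delete_nth (Suc i) y then pmf ?P xs else 0) / (real ?m * (real q - 2)))"
  proof (rule sum.cong)
    fix xs assume xs: "xs \<in> words q ?m"
    show "pmf (insert_random_bead q xs) y * pmf ?P xs = (\<Sum>i<?m. 
      of_bool ?good * (if xs = delete_nth (Suc i) y then pmf ?P xs else 0) / (real ?m * (real q - 2)))"
    proof (cases "xs \<in> set_pmf ?P")
      case True
      have "cyc_proper xs" by (rule boundary_word_support(2)[OF q True])
      then have "pmf (insert_random_bead q xs) y = 
          (\<Sum>i<?m. of_bool (y \<in> words q (Suc ?m) \<and> cyc_proper y \<and> xs = delete_nth (Suc i) y)) / (real ?m * (real q - 2))"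
        by (intro pmf_insert_random_bead[OF q xs]) auto
      then show ?thesis
        by (simp only: sum_divide_distrib sum_distrib_right) (auto intro!: sum.cong simp: eval_nat_numeral)
    next
      case False
      then have "pmf ?P xs = 0" by (simp add: pmf_eq_0_set_pmf)
      then show ?thesis by (simp only: if_cancel mult_zero_right div_0 sum.neutral_const)
    qed
  qed simp
  also have "\<dots> = (\<Sum>i<?m. \<Sum>xs\<in>words q ?m. 
      of_bool ?good * (if xs = delete_nth (Suc i) y then pmf ?P xs else 0) / (real ?m * (real q - 2)))"
    by (rule sum.swap)
  also have "\<dots> = (\<Sum>i<?m. of_bool ?good * pmf ?P (delete_nth (Suc i) y) / (real ?m * (real q - 2)))"
  proof (rule sum.cong)
    fix i assume "i \<in> {..<?m}"
    show "(\<Sum>xs\<in>words q ?m. of_bool ?good * (if xs = delete_nth (Suc i) y then pmf ?P xs else 0) / (real ?m * (real q - 2)))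
        = of_bool ?good * pmf ?P (delete_nth (Suc i) y) / (real ?m * (real q - 2))"
    proof (cases "delete_nth (Suc i) y \<in> words q ?m")
      case True
      have "(\<Sum>xs\<in>words q ?m. if xs = delete_nth (Suc i) y then pmf ?P xs else 0) = pmf ?P (delete_nth (Suc i) y)"
        using True by simp
      then show ?thesis by (simp only: sum_divide_distrib[symmetric] sum_distrib_left[symmetric])
    next
      case False
      then have "delete_nth (Suc i) y \<notin> set_pmf ?P"
        using boundary_word_support(1)[OF q, of "delete_nth (Suc i) y" n] by auto
      then have "pmf ?P (delete_nth (Suc i) y) = 0" by (simp add: pmf_eq_0_set_pmf)
      moreover have "(if xs = delete_nth (Suc i) y then pmf ?P xs else 0) = 0" if "xs \<in> words q ?m" for xs
        using that False by auto
      ultimately show ?thesis by (simp cong: sum.cong)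
    qed
  qed simp
  finally show ?thesis by (simp only: sum_divide_distrib[symmetric] sum_distrib_left[symmetric])
qed

lemma sum_periodic_shift:
  fixes f :: "nat \<Rightarrow> real"
  assumes "\<And>r. f (r + N) = f r"
  shows "(\<Sum>r<N. f (r + k)) = (\<Sum>r<N. f r)"
proof (induction k)
  case (Suc k)
  have "(\<Sum>r<N. f (r + Suc k)) + f k = (\<Sum>r<Suc N. f (r + k))"
    by (subst sum.lessThan_Suc_shift) simp
  also have "\<dots> = (\<Sum>r<N. f (r + k)) + f k" using assms[of k] by (simp add: add.commute)
  finally show ?case using Suc by simp
qed simp

lemma sum_periodic_reflect:
  fixes f :: "nat \<Rightarrow> real"
  assumes "\<And>r. f (r + N) = f r"
  shows "(\<Sum>r<N. f (N - r)) = (\<Sum>r<N. f r)"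
proof -
  have "(\<Sum>r<N. f (N - r)) = (\<Sum>r<N. f (Suc (N - Suc r)))" by (intro sum.cong) (auto simp: Suc_diff_Suc)
  also have "\<dots> = (\<Sum>r<N. f (r + 1))" using sum.nat_diff_reindex[of "\<lambda>r. f (Suc r)" N] by simp
  finally show ?thesis using sum_periodic_shift[of f N 1] assms by simp
qed

definition rotation_sum :: "(nat list \<Rightarrow> real) \<Rightarrow> nat list \<Rightarrow> real" where
  "rotation_sum g x = (\<Sum>r<length x. g (rotate r x))"

lemma rotate_add_length: "rotate (r + length x) x = rotate r x"
  by (metis mod_add_self2 rotate_conv_mod)

lemma rotation_sum_rotate: "rotation_sum g (rotate t x) = rotation_sum g x"
  using sum_periodic_shift[of "\<lambda>r. g (rotate r x)" "length x" t]
  by (simp add: rotation_sum_def rotate_rotate rotate_add_length)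

lemma rotate_delete_nth:
  assumes "k < length y"
  shows "rotate k (delete_nth k y) = delete_nth 0 (rotate k y)"
proof -
  have "rotate k (delete_nth k y) = rotate (length (take k y)) (take k y @ drop (Suc k) y)"
    using assms by (simp add: delete_nth_def)
  also have "\<dots> = drop (Suc k) y @ take k y" by (rule rotate_append)
  finally have 1: "rotate k (delete_nth k y) = drop (Suc k) y @ take k y" .
  have "rotate k y = rotate (length (take k y)) (take k y @ drop k y)" using assms by simp
  also have "\<dots> = drop k y @ take k y" by (rule rotate_append)
  finally show ?thesis using 1 Cons_nth_drop_Suc[OF assms, symmetric] by simp
qed

text \<open>Averaging over rotations removes the special role of the initial bead. Every deletion
  of a letter other than the first from a rotation of \<open>x\<close> is a rotation of the word
  obtained from \<open>x\<close> by deleting that letter; and conversely each rotation of each of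
  these words arises exactly once. The letter is brought to the front before it is deleted, so
  that the rotations before and after the deletion become independent indices.\<close>

lemma rotation_sum_deletions:
  assumes len: "length x = Suc m"
  shows "rotation_sum (\<lambda>y. \<Sum>i<m. g (delete_nth (Suc i) y)) x = (\<Sum>j<Suc m. rotation_sum g (delete_nth j x))"
proof -
  \<comment> \<open>delete the letter at position \<open>t\<close>, then start reading \<open>s\<close> letters further on\<close>
  define h where "h s t = g (rotate s (delete_nth 0 (rotate t x)))" for s t
  have per: "h s (t + Suc m) = h s t" for s t
    using rotate_add_length[of t x] by (simp add: h_def len)
  have del: "g (delete_nth (Suc i) (rotate r x)) = h (m - Suc i) (r + Suc i)" if "i < m" for i r
  proof -
    have "length (delete_nth (Suc i) (rotate r x)) = m"
      using that len by (simp add: length_delete_nth)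
    moreover have "m - Suc i + Suc i = m" using that by simp
    ultimately have "delete_nth (Suc i) (rotate r x) = rotate (m - Suc i) (rotate (Suc i) (delete_nth (Suc i) (rotate r x)))"
      by (metis rotate_rotate rotate_id mod_self)
    also have "rotate (Suc i) (delete_nth (Suc i) (rotate r x)) = delete_nth 0 (rotate (r + Suc i) x)"
      using that len rotate_delete_nth[of "Suc i" "rotate r x"] by (simp only: length_rotate rotate_rotate add.commute)
    finally show ?thesis unfolding h_def by (rule arg_cong)
  qed
  have "rotation_sum (\<lambda>y. \<Sum>i<m. g (delete_nth (Suc i) y)) x = (\<Sum>r<Suc m. \<Sum>i<m. h (m - Suc i) (r + Suc i))"
    unfolding rotation_sum_def len by (intro sum.cong) (simp_all add: del)
  also have "\<dots> = (\<Sum>i<m. \<Sum>r<Suc m. h (m - Suc i) (r + Suc i))" by (rule sum.swap)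
  also have "\<dots> = (\<Sum>i<m. \<Sum>t<Suc m. h (m - Suc i) t)"
    by (intro sum.cong refl sum_periodic_shift) (rule per)
  also have "\<dots> = (\<Sum>t<Suc m. \<Sum>i<m. h (m - Suc i) t)" by (rule sum.swap)
  also have "\<dots> = (\<Sum>t<Suc m. rotation_sum g (delete_nth t x))"
  proof (rule sum.cong)
    fix t assume t: "t \<in> {..<Suc m}"
    have "length (delete_nth 0 (rotate t x)) = m" using len by (simp add: length_delete_nth)
    then have "(\<Sum>i<m. h (m - Suc i) t) = rotation_sum g (delete_nth 0 (rotate t x))"
      unfolding h_def rotation_sum_def using sum.nat_diff_reindex[of "\<lambda>s. g (rotate s (delete_nth 0 (rotate t x)))" m] by simp
    also have "\<dots> = rotation_sum g (delete_nth t x)"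
      using t len by (simp add: rotate_delete_nth[symmetric] rotation_sum_rotate)
    finally show "(\<Sum>i<m. h (m - Suc i) t) = rotation_sum g (delete_nth t x)" .
  qed simp
  finally show ?thesis .
qed

lemma inj_rotate: "inj (rotate r)"
proof (rule injI)
  fix x y :: "'a list" assume eq: "rotate r x = rotate r y"
  then have len: "length x = length y" by (metis length_rotate)
  have "z = rotate (length z - r mod length z) (rotate r z)" for z :: "'a list"
  proof (cases "z = []")
    case False
    then have "(length z - r mod length z) + r mod length z = length z" by simp
    then have "rotate (length z - r mod length z) (rotate (r mod length z) z) = z"
      by (metis rotate_rotate rotate_id mod_self)
    then show ?thesis using rotate_conv_mod[of r z] by simp
  qed simp
  then show "x = y" using eq len by metis
qed

lemma pmf_eden_rotation:
  assumes len: "length x = n + 3"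
  shows "pmf (eden_cycle_coloring q (Suc n)) x = rotation_sum (pmf (boundary_word q n)) x / real (n + 3)"
proof -
  have "eden_cycle_coloring q (Suc n) = bind_pmf (pmf_of_set {..<n + 3}) (\<lambda>r. map_pmf (rotate r) (boundary_word q n))"
    unfolding eden_cycle_coloring_rotation map_pmf_def by (rule bind_commute_pmf)
  moreover have "{..<n + 3} \<noteq> {}" by (simp add: lessThan_empty_iff)
  ultimately have "pmf (eden_cycle_coloring q (Suc n)) x = 
      (\<Sum>r<n + 3. pmf (map_pmf (rotate r) (boundary_word q n)) x) / real (n + 3)"
    by (simp add: pmf_bind_pmf_of_set)
  also have "(\<Sum>r<n + 3. pmf (map_pmf (rotate r) (boundary_word q n)) x) = 
      (\<Sum>r<n + 3. pmf (boundary_word q n) (rotate (n + 3 - r) x))"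
  proof (rule sum.cong)
    fix r assume "r \<in> {..<n + 3}"
    then have "r + (n + 3 - r) = n + 3" by simp
    then have "x = rotate r (rotate (n + 3 - r) x)" by (metis len rotate_rotate rotate_id mod_self)
    then show "pmf (map_pmf (rotate r) (boundary_word q n)) x = pmf (boundary_word q n) (rotate (n + 3 - r) x)"
      using pmf_map_inj'[OF inj_rotate, of r "boundary_word q n" "rotate (n + 3 - r) x"] by simp
  qed simp
  also have "\<dots> = rotation_sum (pmf (boundary_word q n)) x"
    unfolding rotation_sum_def len
    by (rule sum_periodic_reflect) (metis rotate_add_length len)
  finally show ?thesis .
qed

lemma cyc_proper_rotate: "cyc_proper (rotate r z) \<longleftrightarrow> cyc_proper z"
  by (induction r) (simp_all add: cyc_proper_rotate1)

lemma eden_support: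
  assumes q: "q \<ge> 3" and x: "x \<in> set_pmf (eden_cycle_coloring q (Suc n))"
  shows "x \<in> words q (n + 3)" "cyc_proper x"
proof -
  obtain xs r where xs: "xs \<in> set_pmf (boundary_word q n)" "x = rotate r xs"
    using x by (auto simp: eden_cycle_coloring_rotation)
  show "x \<in> words q (n + 3)" "cyc_proper x"
    using boundary_word_support[OF q xs(1)] by (simp_all add: xs(2) words_def cyc_proper_rotate)
qed

text \<open>The recursion for \<open>boundary_word\<close> omits the deletion of the initial bead;
  after averaging over rotations all deletions occur equally often, which gives the recursion of
  \<open>necklace_weight\<close>.\<close>

lemma pmf_eden_Suc:
  assumes q: "q \<ge> 3" and x: "x \<in> words q (n + 4)"
  shows "pmf (eden_cycle_coloring q (Suc (Suc n))) x = of_bool (cyc_proper x) *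
    (\<Sum>j<n + 4. pmf (eden_cycle_coloring q (Suc n)) (delete_nth j x)) / (real (n + 4) * (real q - 2))"
proof -
  let ?P = "pmf (boundary_word q n)" 
  have len: "length x = Suc (n + 3)" using x by (simp add: words_def)
  have "rotation_sum (pmf (boundary_word q (Suc n))) x = 
    of_bool (cyc_proper x) * rotation_sum (\<lambda>y. \<Sum>i<n + 3. ?P (delete_nth (Suc i) y)) x / (real (n + 3) * (real q - 2))"
    unfolding rotation_sum_def sum_distrib_left sum_divide_distrib
  proof (rule sum.cong)
    fix r
    have "rotate r x \<in> words q (n + 4)" using x by (simp add: words_def)
    then show "pmf (boundary_word q (Suc n)) (rotate r x) = (\<Sum>i<n + 3. of_bool (cyc_proper x) * ?P (delete_nth (Suc i) (rotate r x)) / (real (n + 3) * (real q - 2)))"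
      by (simp only: pmf_boundary_word_Suc[OF q] cyc_proper_rotate sum_divide_distrib sum_distrib_left) simp
  qed simp
  also have "rotation_sum (\<lambda>y. \<Sum>i<n + 3. ?P (delete_nth (Suc i) y)) x = (\<Sum>j<Suc (n + 3). rotation_sum ?P (delete_nth j x))"
    by (rule rotation_sum_deletions[OF len])
  also have "\<dots> = (\<Sum>j<Suc (n + 3). real (n + 3) * pmf (eden_cycle_coloring q (Suc n)) (delete_nth j x))"
    using len by (intro sum.cong refl) (simp add: pmf_eden_rotation length_delete_nth)
  finally have "rotation_sum (pmf (boundary_word q (Suc n))) x = of_bool (cyc_proper x) * 
     (\<Sum>j<Suc (n + 3). pmf (eden_cycle_coloring q (Suc n)) (delete_nth j x)) / (real q - 2)"
    by (simp add: sum_distrib_left[symmetric] del: sum.lessThan_Suc)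
  then show ?thesis
    using pmf_eden_rotation[of x "Suc n" q] len by (simp add: eval_nat_numeral field_simps del: sum.lessThan_Suc)
qed

lemma necklace_weight_distinct_triple: "0 \<notin> set x \<Longrightarrow> length x = 3 \<Longrightarrow> necklace_weight x = (if distinct x then 3 else 0)"
  by (auto simp: numeral_3_eq_3 length_Suc_conv necklace_weight_rec deletions_Cons necklace_weight_short cyc_proper_def)

lemma pmf_eden:
  assumes q: "q \<ge> 3"
  shows "\<exists>K. \<forall>x\<in>words q (n + 3). pmf (eden_cycle_coloring q (Suc n)) x = K * necklace_weight x"
proof (induction n)
  case 0
  let ?D = "{xs \<in> words q 3. distinct xs}"
  have "[1, 2, 3] \<in> ?D" using q by (simp add: words_def)
  then have ne: "?D \<noteq> {}" by blast
  have fin: "finite ?D" by (rule finite_subset[OF _ finite_words[of q 3]]) auto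
  have "pmf (eden_cycle_coloring q (Suc 0)) x = 1 / (3 * real (card ?D)) * necklace_weight x" if x: "x \<in> words q 3" for x
  proof -
    have rot: "pmf (boundary_word q 0) (rotate r x) = of_bool (distinct x) / real (card ?D)" for r
    proof -
      have "rotate r x \<in> ?D \<longleftrightarrow> distinct x" using x by (simp add: words_def)
      then show ?thesis by (simp add: boundary_word_0(1)[OF q] pmf_of_set[OF ne fin] indicator_def)
    qed
    have len: "length x = 3" "0 \<notin> set x" using x by (auto simp: words_def)
    then show ?thesis
      using pmf_eden_rotation[of x 0 q] by (simp add: rotation_sum_def rot necklace_weight_distinct_triple)
  qed
  then have "\<forall>x\<in>words q (0 + 3). pmf (eden_cycle_coloring q (Suc 0)) x = 1 / (3 * real (card ?D)) * necklace_weight x"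
    by simp
  then show ?case by (rule exI)
next
  case (Suc n)
  then obtain K where K: "\<And>x. x \<in> words q (n + 3) \<Longrightarrow> pmf (eden_cycle_coloring q (Suc n)) x = K * necklace_weight x" by blast
  have "pmf (eden_cycle_coloring q (Suc (Suc n))) x = K / (real (n + 4) * (real q - 2)) * necklace_weight x"
    if x: "x \<in> words q (n + 4)" for x
  proof -
    have len: "length x = n + 4" using x by (simp add: words_def)
    have nz: "x ! j \<noteq> 0" if "j < n + 4" for j using words_not_0[OF x] that len by (metis nth_mem)
    have "(\<Sum>j<n + 4. pmf (eden_cycle_coloring q (Suc n)) (delete_nth j x)) = K * deletions necklace_weight x"
      unfolding deletions_def len sum_distrib_left
    proof (rule sum.cong)
      fix j assume "j \<in> {..<n + 4}"
      then have j: "j < n + 4" by simp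
      have "delete_nth j x \<in> words q (n + 3)"
        using delete_nth_words[OF x j] by (simp add: add.commute)
      then show "pmf (eden_cycle_coloring q (Suc n)) (delete_nth j x) = K * (if x ! j = 0 then 0 else necklace_weight (delete_nth j x))"
        using K nz[OF j] by simp
    qed simp
    then show ?thesis
      using len by (simp add: pmf_eden_Suc[OF q x] necklace_weight_rec)
  qed
  then have "\<forall>x\<in>words q (n + 4). pmf (eden_cycle_coloring q (Suc (Suc n))) x = 
      K / (real (n + 4) * (real q - 2)) * necklace_weight x" by blast
  moreover have "Suc n + 3 = n + 4" by simp
  ultimately show ?case by (simp only:) (rule exI)
qed

section \<open>Symmetries\<close>

lemma pmf_eden_all:
  assumes q: "q \<ge> 3"
  obtains K where "\<And>x. pmf (eden_cycle_coloring q (Suc n)) x = of_bool (x \<in> words q (n + 3)) * (K * necklace_weight x)"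
proof -
  obtain K where K: "\<forall>x\<in>words q (n + 3). pmf (eden_cycle_coloring q (Suc n)) x = K * necklace_weight x"
    using pmf_eden[OF q] by blast
  have "pmf (eden_cycle_coloring q (Suc n)) x = of_bool (x \<in> words q (n + 3)) * (K * necklace_weight x)" for x
  proof (cases "x \<in> words q (n + 3)")
    case True
    then show ?thesis using K by simp
  next
    case False
    then have "x \<notin> set_pmf (eden_cycle_coloring q (Suc n))" using eden_support(1)[OF q] by blast
    then show ?thesis using False by (simp add: pmf_eq_0_set_pmf)
  qed
  then show ?thesis by (rule that)
qed

lemma map_pmf_invariant:
  assumes "bij f" "\<And>x. pmf p (f x) = pmf p x"
  shows "map_pmf f p = p"
proof (rule pmf_eqI)
  fix y
  obtain x where y: "y = f x" using bij_is_surj[OF assms(1)] by blast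
  show "pmf (map_pmf f p) y = pmf p y"
    unfolding y using pmf_map_inj'[OF bij_is_inj[OF assms(1)], of p x] assms(2) by simp
qed

lemma surj_rotate: "surj (rotate r)"
proof (rule surjI)
  fix z :: "'a list"
  show "rotate r (rotate (length z * r - r) z) = z"
  proof (cases "z = []")
    case False
    then have "r + (length z * r - r) = length z * r" by (cases z) simp_all
    then show ?thesis by (simp add: rotate_rotate rotate_id)
  qed simp
qed

lemma bij_rotate: "bij (rotate r)"
  by (rule bijI[OF inj_rotate surj_rotate])

lemma eden_rotate:
  assumes q: "q \<ge> 3"
  shows "map_pmf (rotate r) (eden_cycle_coloring q (Suc n)) = eden_cycle_coloring q (Suc n)"
proof -
  obtain K where K: "\<And>x. pmf (eden_cycle_coloring q (Suc n)) x = of_bool (x \<in> words q (n + 3)) * (K * necklace_weight x)"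
    by (rule pmf_eden_all[OF q, where n = n]) blast
  show ?thesis
    by (rule map_pmf_invariant[OF bij_rotate]) (simp add: K necklace_weight_rotate words_def)
qed

lemma eden_reflect:
  assumes q: "q \<ge> 3"
  shows "map_pmf rev (eden_cycle_coloring q (Suc n)) = eden_cycle_coloring q (Suc n)"
proof -
  obtain K where K: "\<And>x. pmf (eden_cycle_coloring q (Suc n)) x = of_bool (x \<in> words q (n + 3)) * (K * necklace_weight x)"
    by (rule pmf_eden_all[OF q, where n = n]) blast
  have "bij (rev :: nat list \<Rightarrow> _)" by (rule involuntory_imp_bij) simp
  then show ?thesis
    by (rule map_pmf_invariant) (simp add: K necklace_weight_rev words_def)
qed

lemma eden_permute:
  assumes q: "q \<ge> 3" and \<pi>: "\<pi> permutes {1..q}"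
  shows "map_pmf (map \<pi>) (eden_cycle_coloring q (Suc n)) = eden_cycle_coloring q (Suc n)"
proof -
  obtain K where K: "\<And>x. pmf (eden_cycle_coloring q (Suc n)) x = of_bool (x \<in> words q (n + 3)) * (K * necklace_weight x)"
    by (rule pmf_eden_all[OF q, where n = n]) blast
  have "bij (map \<pi>)"
    by (rule o_bij[of "map (inv \<pi>)"]) (simp_all add: fun_eq_iff comp_def permutes_inverses[OF \<pi>])
  moreover have "pmf (eden_cycle_coloring q (Suc n)) (map \<pi> x) = pmf (eden_cycle_coloring q (Suc n)) x" for x
  proof -
    have "set (map \<pi> x) \<subseteq> {1..q} \<longleftrightarrow> (\<forall>a\<in>set x. \<pi> a \<in> {1..q})"
      unfolding set_map image_subset_iff ..
    also have "\<dots> \<longleftrightarrow> set x \<subseteq> {1..q}" unfolding permutes_in_image[OF \<pi>] by blast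
    finally have "set (map \<pi> x) \<subseteq> {1..q} \<longleftrightarrow> set x \<subseteq> {1..q}" .
    then have 1: "map \<pi> x \<in> words q (n + 3) \<longleftrightarrow> x \<in> words q (n + 3)" by (simp only: words_def mem_Collect_eq length_map)
    have "\<pi> 0 = 0" by (rule permutes_not_in[OF \<pi>]) simp
    then have "\<pi> a = 0 \<longleftrightarrow> a = 0" for a using permutes_inj[OF \<pi>] by (metis injD)
    then have "necklace_weight (map \<pi> x) = necklace_weight x" using permutes_inj_on[OF \<pi>] by (intro necklace_weight_map) auto
    then show ?thesis using 1 by (simp only: K)
  qed
  ultimately show ?thesis by (rule map_pmf_invariant)
qed

section \<open>Properness and the law of an initial segment\<close>

lemma cycle_edge_successor:
  fixes i j m :: nat
  assumes "i \<in> {1..m}" "j \<in> {1..m}" "j mod m = (i + 1) mod m" 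
  shows "j - 1 = i mod m"
proof (cases "j = m")
  case True
  then have "(i + 1) mod m = 0" using assms(3) by simp
  then have "m dvd i + 1" by auto
  then have "m \<le> i + 1" by (rule dvd_imp_le) simp
  then consider "i = m" | "i + 1 = m" using assms(1) by fastforce
  then show ?thesis
  proof cases
    case 1
    then show ?thesis using \<open>m dvd i + 1\<close> dvd_add_right_iff[of m m 1] True by simp
  next
    case 2
    then show ?thesis using True by auto
  qed
next
  case False
  then have j: "j mod m = j" using assms(2) by simp
  show ?thesis
  proof (cases "i + 1 < m")
    case True
    then show ?thesis using assms(3) j by simp
  next
    case F: False
    then consider "i = m" | "i + 1 = m" using assms(1) by fastforce
    then show ?thesis
    proof cases
      case 1
      have "j = 1 mod m" using assms(3) j mod_add_self1[of m 1] unfolding 1 by (simp only:)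
      then have "j \<le> 1" by (metis mod_less_eq_dividend)
      then show ?thesis using 1 by simp
    next
      case 2
      then show ?thesis using assms j by simp
    qed
  qed
qed

lemma proper_coloring_cycle:
  assumes "xs \<in> words q m" "cyc_proper xs"
  shows "proper_coloring {1..m} (cycle_edges m) q (\<lambda>i. C i xs)"
proof -
  have len: "length xs = m" and sub: "set xs \<subseteq> {1..q}" using assms by (auto simp: words_def)
  have succ: "C i xs \<noteq> C j xs" if "i \<in> {1..m}" "j \<in> {1..m}" "j mod m = (i + 1) mod m" for i j
  proof -
    have "i - 1 < m" "Suc (i - 1) = i" using that(1) by auto
    then show ?thesis
      using cyc_proper_neighbours[OF assms(2), of "i - 1"] cycle_edge_successor[OF that] len
      by (simp add: C_def)
  qed
  have "C i xs \<in> {1..q}" if "i \<in> {1..m}" for i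
  proof -
    have "xs ! (i - 1) \<in> set xs" using that len by (intro nth_mem) auto
    then show ?thesis using sub by (auto simp: C_def)
  qed
  then show ?thesis
    unfolding proper_coloring_def cycle_edges_def using succ by fastforce
qed

lemma measure_pmf_on_finite:
  assumes "finite W" "set_pmf p \<subseteq> W"
  shows "measure_pmf.prob p {x. P x} = (\<Sum>x\<in>W. of_bool (P x) * pmf p x)"
proof -
  have "measure_pmf.prob p {x. P x} = (\<integral>x. indicator {x. P x} x \<partial>measure_pmf p)" by simp
  also have "\<dots> = (\<Sum>x\<in>W. indicator {x. P x} x * pmf p x)"
    by (rule integral_measure_pmf_real) (use assms in auto)
  finally show ?thesis by (simp add: indicator_def of_bool_def)
qed

text \<open>The remaining \<open>k\<close> positions form a gap of the cyclic word, so summing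
  over them replaces the cyclic weight by \<open>B_lin\<close>.\<close>

lemma eden_prefix:
  assumes kq: "(k, q) \<in> {(1, 4), (2, 3)}"
  obtains L where "\<And>P. measure_pmf.prob (eden_cycle_coloring q (Suc n)) {x. P (take (n + 3 - k) x)} =
    L * (\<Sum>z\<in>words q (n + 3 - k). of_bool (P z) * real (B_lin z))"
proof -
  have q: "q \<ge> 3" using kq by auto
  let ?N = "n + 3 - k"
  have N: "n + 3 = ?N + k" "?N \<ge> 1" using kq by auto
  obtain K where K: "\<And>x. pmf (eden_cycle_coloring q (Suc n)) x = of_bool (x \<in> words q (n + 3)) * (K * necklace_weight x)"
    by (rule pmf_eden_all[OF q, where n = n]) blast
  obtain c where c: "\<And>n z. n \<ge> 1 \<Longrightarrow> z \<in> words q n \<Longrightarrow> gap k q z = c * real (B_lin z)"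
    by (rule cyclic_gap[OF kq]) blast
  have "measure_pmf.prob (eden_cycle_coloring q (Suc n)) {x. P (take ?N x)} =
      (K * c) * (\<Sum>z\<in>words q ?N. of_bool (P z) * real (B_lin z))" for P
  proof -
    have "measure_pmf.prob (eden_cycle_coloring q (Suc n)) {x. P (take ?N x)} =
        (\<Sum>x\<in>words q (n + 3). of_bool (P (take ?N x)) * pmf (eden_cycle_coloring q (Suc n)) x)"
      by (rule measure_pmf_on_finite) (use eden_support(1)[OF q] in auto)
    also have "\<dots> = (\<Sum>x\<in>words q (?N + k). of_bool (P (take ?N x)) * (K * necklace_weight x))"
      unfolding N(1)[symmetric] by (rule sum.cong) (simp_all add: K)
    also have "\<dots> = (\<Sum>z\<in>words q ?N. \<Sum>w\<in>words q k. of_bool (P (take ?N (z @ w))) * (K * necklace_weight (z @ w)))"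
      by (rule sum_words_append)
    also have "\<dots> = (\<Sum>z\<in>words q ?N. of_bool (P z) * K * gap k q z)"
    proof (rule sum.cong)
      fix z assume "z \<in> words q ?N"
      then have "length z = ?N" by (simp add: words_def)
      then show "(\<Sum>w\<in>words q k. of_bool (P (take ?N (z @ w))) * (K * necklace_weight (z @ w))) = of_bool (P z) * K * gap k q z"
        by (simp add: gap_def sum_distrib_left)
    qed simp
    also have "\<dots> = (\<Sum>z\<in>words q ?N. (K * c) * (of_bool (P z) * real (B_lin z)))"
      by (rule sum.cong) (simp_all add: c[OF N(2)])
    finally show ?thesis by (simp only: sum_distrib_left)
  qed
  then show ?thesis by (rule that)
qed

section \<open>Independence of distant sets\<close>

text \<open>Independence of what lies left and right of \<open>k\<close> consecutive positions
  implies independence of any two distant sets, however they interleave. The elements of one set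
  beyond the maximum \<open>b\<close> of the other one lie beyond \<open>b + k\<close>; they are
  independent of everything up to \<open>b\<close> and can be split off. Here \<open>Q\<close>
  stands for the probability that prescribed values are taken on a set of positions.\<close>

lemma independent_blocks:
  fixes Q :: "nat set \<Rightarrow> real"
  assumes cut: "\<And>b S T. S \<subseteq> {..b} \<Longrightarrow> T \<subseteq> {b + k<..<N} \<Longrightarrow> S \<subseteq> {..<N} \<Longrightarrow> Q (S \<union> T) = Q S * Q T"
    and empty: "Q {} = 1"
    and AB: "A \<subseteq> {..<N}" "B \<subseteq> {..<N}" "\<And>a b. a \<in> A \<Longrightarrow> b \<in> B \<Longrightarrow> a + k < b \<or> b + k < a"
  shows "Q (A \<union> B) = Q A * Q B"
  using AB
proof (induction "card A + card B" arbitrary: A B rule: less_induct)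
  case less
  have fin: "finite A" "finite B" using less.prems by (auto intro: finite_subset)
  have step: "Q (A \<union> B) = Q A * Q B"
    if AB: "A \<subseteq> {..<N}" "B \<subseteq> {..<N}" "\<And>a b. a \<in> A \<Longrightarrow> b \<in> B \<Longrightarrow> a + k < b \<or> b + k < a"
      and ne: "A \<noteq> {}" "B \<noteq> {}" and max: "Max B < Max A" and fin: "finite A" "finite B"
      and IH: "\<And>A1. A1 \<subset> A \<Longrightarrow> Q (A1 \<union> B) = Q A1 * Q B" for A B
  proof -
    let ?b = "Max B"
    define A1 A2 where "A1 = {a \<in> A. a < ?b}" and "A2 = {a \<in> A. ?b < a}"
    have b: "?b \<in> B" using ne fin by simp
    have "a \<noteq> ?b" if "a \<in> A" for a using AB(3)[OF that b] by auto
    then have A: "A = A1 \<union> A2" unfolding A1_def A2_def by (auto simp: neq_iff)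
    have "Max A \<in> A2" using max ne fin by (simp add: A2_def)
    moreover have "Max A \<notin> A1" using max by (simp add: A1_def)
    ultimately have "A1 \<subset> A" using A by blast
    note 1 = IH[OF this]
    have "A2 \<subseteq> {?b + k<..<N}" using AB(1) AB(3)[OF _ b] by (fastforce simp: A2_def)
    note A2 = this
    have A1: "A1 \<subseteq> {..?b}" "A1 \<subseteq> {..<N}" using AB(1) by (auto simp: A1_def)
    have B: "B \<subseteq> {..?b}" using fin(2) by auto
    have "A \<union> B = (A1 \<union> B) \<union> A2" using A by auto
    then have "Q (A \<union> B) = Q (A1 \<union> B) * Q A2" using cut[of "A1 \<union> B" ?b A2] A1 A2 B AB(2) by auto
    also have "\<dots> = Q A1 * Q A2 * Q B" using 1 by simp
    also have "Q A1 * Q A2 = Q A" using cut[OF A1(1) A2 A1(2)] A by simp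
    finally show ?thesis .
  qed
  show ?case
  proof (cases "A = {} \<or> B = {}")
    case True
    then show ?thesis using empty by auto
  next
    case False
    then have m: "Max A \<in> A" "Max B \<in> B" using fin by auto
    have "Max A \<noteq> Max B" using less.prems(3)[OF m] by auto
    then consider "Max B < Max A" | "Max A < Max B" by linarith
    then show ?thesis
    proof cases
      case 1
      show ?thesis
      proof (rule step[OF less.prems _ _ 1 fin])
        show "A \<noteq> {}" "B \<noteq> {}" using False by auto
        show "Q (A1 \<union> B) = Q A1 * Q B" if A1: "A1 \<subset> A" for A1
        proof (rule less.hyps)
          show "card A1 + card B < card A + card B" using psubset_card_mono[OF fin(1) A1] by simp
          show "A1 \<subseteq> {..<N}" "B \<subseteq> {..<N}" using A1 less.prems(1,2) by auto
          show "a + k < b \<or> b + k < a" if "a \<in> A1" "b \<in> B" for a b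
            using less.prems(3)[of a b] that A1 by blast
        qed
      qed
    next
      case 2
      have "Q (B \<union> A) = Q B * Q A"
      proof (rule step[OF less.prems(2,1) _ _ _ 2 fin(2,1)])
        show "B \<noteq> {}" "A \<noteq> {}" using False by auto
        show "a + k < b \<or> b + k < a" if "a \<in> B" "b \<in> A" for a b using less.prems(3)[OF that(2,1)] by blast
        show "Q (B1 \<union> A) = Q B1 * Q A" if B1: "B1 \<subset> B" for B1
        proof -
          have "Q (A \<union> B1) = Q A * Q B1"
          proof (rule less.hyps)
            show "card A + card B1 < card A + card B" using psubset_card_mono[OF fin(2) B1] by simp
            show "A \<subseteq> {..<N}" "B1 \<subseteq> {..<N}" using B1 less.prems(1,2) by auto
            show "a + k < b \<or> b + k < a" if "a \<in> A" "b \<in> B1" for a b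
              using less.prems(3)[of a b] that B1 by blast
          qed
          then show ?thesis by (simp add: Un_commute mult.commute)
        qed
      qed
      then show ?thesis by (simp add: Un_commute mult.commute)
    qed
  qed
qed

lemma mod_add_cancel:
  fixes s x y m :: nat
  assumes "(s + x) mod m = (s + y) mod m"
  shows "x mod m = y mod m"
proof -
  have main: "x mod m = y mod m" if "x \<le> y" "(s + x) mod m = (s + y) mod m" for x y :: nat
    using that mod_eq_dvd_iff_nat[of "s + x" "s + y" m] mod_eq_dvd_iff_nat[of x y m] by simp
  show ?thesis
  proof (cases "x \<le> y")
    case True
    then show ?thesis using assms by (rule main)
  next
    case False
    then have "y \<le> x" by simp
    then show ?thesis using main[OF _ assms[symmetric]] by simp
  qed
qed

definition circular_far :: "nat \<Rightarrow> nat \<Rightarrow> nat set \<Rightarrow> nat set \<Rightarrow> bool" where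
  "circular_far m k A B \<longleftrightarrow>
     (\<forall>a\<in>A. \<forall>b\<in>B. \<forall>d\<le>k. (a + d) mod m \<noteq> b \<and> (b + d) mod m \<noteq> a)"

text \<open>Walk around the cycle from an element of \<open>B\<close> to the first element of
  \<open>A\<close>, and let \<open>b + e\<close> be the last element of \<open>B\<close> on the
  way. Between these two there is no element of either set, and at least \<open>k\<close> places.
  The shift \<open>s\<close> moves the \<open>k\<close> places after \<open>b + e\<close> to the
  end.\<close>

lemma free_window:
  assumes far: "circular_far m k A B" and sub: "A \<subseteq> {..<m}" "B \<subseteq> {..<m}"
    and ne: "A \<noteq> {}" "B \<noteq> {}" and km: "k < m"
  obtains s where "\<And>x. x \<in> A \<union> B \<Longrightarrow> (s + x) mod m < m - k"
proof -
  obtain a b where a: "a \<in> A" and b: "b \<in> B" using ne by blast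
  have am: "a < m" and bm: "b < m" using a b sub by auto
  have "(b + (a + m - b)) mod m = a" using am bm by simp
  then have ex: "\<exists>d. (b + d) mod m \<in> A" using a by metis
  define d where "d = (LEAST d. (b + d) mod m \<in> A)"
  have d: "(b + d) mod m \<in> A" unfolding d_def by (rule LeastI_ex[OF ex])
  have dmin: "(b + t) mod m \<notin> A" if "t < d" for t
    using not_less_Least[of t "\<lambda>d. (b + d) mod m \<in> A"] that by (simp add: d_def)
  have disj: "x \<notin> A" if "x \<in> B" for x
  proof
    assume "x \<in> A"
    then have "(x + 0) mod m \<noteq> x" using far that unfolding circular_far_def by blast
    then show False using that sub by auto
  qed
  define D where "D = {e. e \<le> d \<and> (b + e) mod m \<in> B}"
  have D: "finite D" "0 \<in> D" using b bm by (auto simp: D_def)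
  define e where "e = Max D"
  have "e \<in> D" unfolding e_def using D by (intro Max_in) auto
  then have e: "(b + e) mod m \<in> B" "e \<le> d" unfolding D_def by auto
  have emax: "(b + t) mod m \<notin> B" if "e < t" "t \<le> d" for t
  proof
    assume "(b + t) mod m \<in> B"
    then have "t \<in> D" using that(2) by (simp add: D_def)
    then have "t \<le> e" unfolding e_def by (rule Max_ge[OF D(1)])
    then show False using that(1) by simp
  qed
  have ed: "e + k < d"
  proof (rule ccontr)
    assume "\<not> e + k < d"
    then have "d - e \<le> k" by simp
    then have "((b + e) mod m + (d - e)) mod m \<noteq> (b + d) mod m"
      using far e(1) d unfolding circular_far_def by blast
    moreover have "((b + e) mod m + (d - e)) mod m = (b + d) mod m"
    proof -
      have "b + d = (b + e) + (d - e)" using e(2) by simp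
      then show ?thesis by (simp only: mod_add_left_eq)
    qed
    ultimately show False by blast
  qed
  let ?c = "b + e"
  \<comment> \<open>\<open>s\<close> moves the place \<open>?c\<close> to the last place before the window\<close>
  define s where "s = m - k - 1 + (m - ?c mod m)"
  have "(s + x) mod m < m - k" if x: "x \<in> A \<union> B" for x
  proof (rule ccontr)
    assume "\<not> (s + x) mod m < m - k"
    moreover have "(s + x) mod m < m" using km by simp
    moreover define t where "t = (s + x) mod m - (m - k - 1)"
    ultimately have t: "(s + x) mod m = m - k - 1 + t" "1 \<le> t" "t \<le> k"
      using km by linarith+
    have xm: "x < m" using x sub by auto
    have "?c mod m \<le> m" using km by (simp add: less_imp_le)
    then have sc: "s + ?c = m - k - 1 + m + m * (?c div m)"
      using mod_mult_div_eq[of ?c m] unfolding s_def by linarith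
    have "(m - k - 1 + x) mod m = (m - k - 1 + x + m * (1 + ?c div m)) mod m" by (simp only: mod_mult_self2)
    also have "m - k - 1 + x + m * (1 + ?c div m) = (s + x) + ?c" using sc by (simp add: algebra_simps)
    also have "\<dots> mod m = (m - k - 1 + t + ?c) mod m" by (simp only: t(1)[symmetric] mod_add_left_eq)
    also have "m - k - 1 + t + ?c = m - k - 1 + (b + (e + t))" by simp
    finally have "x mod m = (b + (e + t)) mod m" by (rule mod_add_cancel)
    then have "x = (b + (e + t)) mod m" using xm by simp
    moreover have "e + t < d" "e < e + t" using ed t by simp_all
    ultimately show False using x dmin[of "e + t"] emax[of "e + t"] by auto
  qed
  then show ?thesis by (rule that)
qed

lemma circular_far_shift:
  assumes far: "circular_far m k A B" and ab: "a \<in> A" "b \<in> B" "A \<subseteq> {..<m}" "B \<subseteq> {..<m}"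
  shows "(s + a) mod m + k < (s + b) mod m \<or> (s + b) mod m + k < (s + a) mod m"
proof -
  have close: False if "x < m" "y < m" and le: "(s + x) mod m \<le> (s + y) mod m" "(s + y) mod m \<le> (s + x) mod m + k"
    and apart: "\<forall>d\<le>k. (x + d) mod m \<noteq> y" for x y
  proof -
    define d where "d = (s + y) mod m - (s + x) mod m"
    have d: "(s + y) mod m = (s + x) mod m + d" "d \<le> k"
      using le unfolding d_def by linarith+
    have "(s + y) mod m = ((s + x) mod m + d) mod m" using d(1) by (metis mod_mod_trivial)
    also have "\<dots> = (s + (x + d)) mod m" by (simp add: mod_add_left_eq add.assoc)
    finally have "y mod m = (x + d) mod m" by (rule mod_add_cancel)
    then have "(x + d) mod m = y" using \<open>y < m\<close> by simp
    then show False using apart d(2) by blast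
  qed
  have "a < m" "b < m" using ab by auto
  moreover have "\<forall>d\<le>k. (a + d) mod m \<noteq> b" "\<forall>d\<le>k. (b + d) mod m \<noteq> a"
    using far ab(1,2) unfolding circular_far_def by blast+
  ultimately have "\<not> ((s + a) mod m \<le> (s + b) mod m \<and> (s + b) mod m \<le> (s + a) mod m + k)"
    "\<not> ((s + b) mod m \<le> (s + a) mod m \<and> (s + a) mod m \<le> (s + b) mod m + k)"
    using close[of a b] close[of b a] by blast+
  then show ?thesis by linarith
qed

definition agrees :: "nat set \<Rightarrow> (nat \<Rightarrow> nat) \<Rightarrow> nat list \<Rightarrow> bool" where
  "agrees S u x \<longleftrightarrow> (\<forall>i\<in>S. x ! i = u i)"

text \<open>Split the words at the \<open>k\<close> places after \<open>b\<close>. Summing over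
  these places gives, by \<open>linear_gap\<close>, a constant times the product of the weights of
  the two sides; the constant is the same for all prescribed values, and it is fixed by the case
  in which nothing is prescribed.\<close>

lemma prefix_independence:
  assumes kq: "(k, q) \<in> {(1, 4), (2, 3)}"
    and AB: "A \<subseteq> {..<n + 3 - k}" "B \<subseteq> {..<n + 3 - k}" "\<And>a b. a \<in> A \<Longrightarrow> b \<in> B \<Longrightarrow> a + k < b \<or> b + k < a"
  shows "measure_pmf.prob (eden_cycle_coloring q (Suc n)) {x. agrees (A \<union> B) u x} =
    measure_pmf.prob (eden_cycle_coloring q (Suc n)) {x. agrees A u x} *
    measure_pmf.prob (eden_cycle_coloring q (Suc n)) {x. agrees B u x}"
proof -
  let ?p = "eden_cycle_coloring q (Suc n)" and ?N = "n + 3 - k"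
  obtain L where L: "\<And>P. measure_pmf.prob ?p {x. P (take ?N x)} = L * (\<Sum>z\<in>words q ?N. of_bool (P z) * real (B_lin z))"
    by (rule eden_prefix[OF kq, where n = n]) blast
  define Q where "Q S = measure_pmf.prob ?p {x. agrees S u x}" for S
  have Q: "Q S = L * (\<Sum>z\<in>words q ?N. of_bool (agrees S u z) * real (B_lin z))" if "S \<subseteq> {..<?N}" for S
  proof -
    have "i < ?N" if "i \<in> S" for i using that \<open>S \<subseteq> {..<?N}\<close> by auto
    then have "agrees S u x \<longleftrightarrow> agrees S u (take ?N x)" for x
      by (simp add: agrees_def)
    then show ?thesis unfolding Q_def L[of "agrees S u", symmetric] by simp
  qed
  have Q0: "Q {} = 1" by (simp add: Q_def agrees_def)
  have cut: "Q (S \<union> T) = Q S * Q T" if S: "S \<subseteq> {..b}" "S \<subseteq> {..<?N}" and T: "T \<subseteq> {b + k<..<?N}" for b S T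
  proof (cases "b + k + 1 < ?N")
    case False
    then have "T = {}" using T by fastforce
    then show ?thesis using Q0 by simp
  next
    case True
    define n2 where "n2 = ?N - (Suc b + k)"
    have N: "?N = Suc b + (k + n2)" using True by (simp add: n2_def)
    obtain c where c: "\<And>x y. x \<in> words q (Suc b) \<Longrightarrow> y \<in> words q n2 \<Longrightarrow>
        (\<Sum>w\<in>words q k. real (B_lin (x @ w @ y))) = c * real (B_lin x) * real (B_lin y)"
      by (rule linear_gap[OF kq, where m = "Suc b" and n = n2]) blast
    define X where "X S = (\<Sum>x\<in>words q (Suc b). of_bool (agrees S u x) * real (B_lin x))" for S
    define Y where "Y T = (\<Sum>y\<in>words q n2. of_bool (agrees ((\<lambda>i. i - (Suc b + k)) ` T) (\<lambda>i. u (i + (Suc b + k))) y) * real (B_lin y))" for T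
    \<comment> \<open>\<open>X\<close> and \<open>Y\<close> sum the weights of the left and the right part; the latter counts its positions from the end of the gap\<close>
    have split: "Q (S \<union> T) = L * c * X S * Y T" if S: "S \<subseteq> {..b}" and T: "T \<subseteq> {b + k<..<?N}" for S T
    proof -
      have ST: "S \<union> T \<subseteq> {..<?N}" using S T True by (auto simp: subset_iff)
      let ?T = "(\<lambda>i. i - (Suc b + k)) ` T" and ?u = "\<lambda>i. u (i + (Suc b + k))"
      have agree: "agrees (S \<union> T) u (x @ w @ y) \<longleftrightarrow> agrees S u x \<and> agrees ?T ?u y"
        if "x \<in> words q (Suc b)" "w \<in> words q k" for x w y
      proof -
        have len: "length x = Suc b" "length w = k" using that by (auto simp: words_def)
        have "(x @ w @ y) ! i = x ! i" if "i \<in> S" for i using that S len by (auto simp: nth_append)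
        moreover have "(x @ w @ y) ! i = y ! (i - (Suc b + k))" "i - (Suc b + k) + (Suc b + k) = i" if "i \<in> T" for i
          using that T len by (auto simp: nth_append subset_iff)
        ultimately show ?thesis by (auto simp: agrees_def)
      qed
      have "Q (S \<union> T) = L * (\<Sum>z\<in>words q (Suc b + (k + n2)). of_bool (agrees (S \<union> T) u z) * real (B_lin z))"
        using Q[OF ST] unfolding N .
      also have "(\<Sum>z\<in>words q (Suc b + (k + n2)). of_bool (agrees (S \<union> T) u z) * real (B_lin z)) =
          (\<Sum>x\<in>words q (Suc b). \<Sum>w\<in>words q k. \<Sum>y\<in>words q n2. 
             of_bool (agrees (S \<union> T) u (x @ w @ y)) * real (B_lin (x @ w @ y)))"
        by (simp only: sum_words_append)
      also have "\<dots> = (\<Sum>x\<in>words q (Suc b). \<Sum>w\<in>words q k. \<Sum>y\<in>words q n2. 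
             of_bool (agrees S u x) * of_bool (agrees ?T ?u y) * real (B_lin (x @ w @ y)))"
        by (intro sum.cong refl) (simp only: agree of_bool_conj)
      also have "\<dots> = (\<Sum>x\<in>words q (Suc b). \<Sum>y\<in>words q n2. \<Sum>w\<in>words q k. 
             of_bool (agrees S u x) * of_bool (agrees ?T ?u y) * real (B_lin (x @ w @ y)))"
        by (rule sum.cong[OF refl], rule sum.swap)
      also have "\<dots> = (\<Sum>x\<in>words q (Suc b). \<Sum>y\<in>words q n2. 
             c * ((of_bool (agrees S u x) * real (B_lin x)) * (of_bool (agrees ?T ?u y) * real (B_lin y))))"
      proof (intro sum.cong refl)
        fix x y assume "x \<in> words q (Suc b)" "y \<in> words q n2"
        note c = c[OF this]
        have "(\<Sum>w\<in>words q k. of_bool (agrees S u x) * of_bool (agrees ?T ?u y) * real (B_lin (x @ w @ y))) =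
            of_bool (agrees S u x) * of_bool (agrees ?T ?u y) * (\<Sum>w\<in>words q k. real (B_lin (x @ w @ y)))"
          by (rule sum_distrib_left[symmetric])
        then show "(\<Sum>w\<in>words q k. of_bool (agrees S u x) * of_bool (agrees ?T ?u y) * real (B_lin (x @ w @ y))) =
            c * ((of_bool (agrees S u x) * real (B_lin x)) * (of_bool (agrees ?T ?u y) * real (B_lin y)))"
          unfolding c by (simp only: mult_ac)
      qed
      also have "\<dots> = c * (X S * Y T)"
        by (simp only: X_def Y_def sum_distrib_left[symmetric] sum_distrib_right[symmetric])
      finally show ?thesis by (simp only: mult_ac)
    qed
    have "Q S = L * c * X S * Y {}" "Q T = L * c * X {} * Y T" "1 = L * c * X {} * Y {}" "Q (S \<union> T) = L * c * X S * Y T"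
      using split[OF S(1), of "{}"] split[OF _ T, of "{}"] split[of "{}" "{}"] split[OF S(1) T] Q0 by simp_all
    then show ?thesis by algebra
  qed
  have "Q (A \<union> B) = Q A * Q B"
  proof (rule independent_blocks[where N = ?N and k = k])
    show "Q (S \<union> T) = Q S * Q T" if "S \<subseteq> {..b}" "T \<subseteq> {b + k<..<?N}" "S \<subseteq> {..<?N}" for b S T
      using that(1,3,2) by (rule cut)
  qed (use Q0 AB in blast)+
  then show ?thesis by (simp only: Q_def)
qed

text \<open>By rotation invariance of the law, the free window may be placed at the end of the
  word, where it disappears when passing to the initial segment.\<close>

lemma cycle_independence:
  assumes kq: "(k, q) \<in> {(1, 4), (2, 3)}"
    and far: "circular_far (n + 3) k A B" and sub: "A \<subseteq> {..<n + 3}" "B \<subseteq> {..<n + 3}"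
  shows "measure_pmf.prob (eden_cycle_coloring q (Suc n)) {x. agrees (A \<union> B) u x} =
    measure_pmf.prob (eden_cycle_coloring q (Suc n)) {x. agrees A u x} *
    measure_pmf.prob (eden_cycle_coloring q (Suc n)) {x. agrees B u x}"
proof (cases "A = {} \<or> B = {}")
  case True
  have "measure_pmf.prob p {x. agrees {} u x} = 1" for p by (simp add: agrees_def)
  then show ?thesis using True by auto
next
  case False
  let ?p = "eden_cycle_coloring q (Suc n)" and ?m = "n + 3"
  have q: "q \<ge> 3" and km: "k < ?m" using kq by auto
  obtain s where s: "\<And>x. x \<in> A \<union> B \<Longrightarrow> (s + x) mod ?m < ?m - k"
    by (rule free_window[OF far sub _ _ km]) (use False in blast)+
  let ?\<sigma> = "\<lambda>i. (s + i) mod ?m"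
  have inj: "inj_on ?\<sigma> {..<?m}"
  proof (rule inj_onI)
    fix x y assume xy: "x \<in> {..<?m}" "y \<in> {..<?m}" "?\<sigma> x = ?\<sigma> y"
    have "x mod ?m = y mod ?m" by (rule mod_add_cancel[OF xy(3)])
    then show "x = y" using xy(1,2) by simp
  qed
  \<comment> \<open>the prescribed values, carried along with the rotation\<close>
  define u' where "u' = u \<circ> inv_into {..<?m} ?\<sigma>"
  have u': "u' (?\<sigma> i) = u i" if "i < ?m" for i
    using inv_into_f_f[OF inj, of i] that by (simp add: u'_def)
  have rot: "measure_pmf.prob ?p {x. agrees S u x} = measure_pmf.prob ?p {x. agrees (?\<sigma> ` S) u' x}"
    if S: "S \<subseteq> {..<?m}" for S
  proof -
    have "measure_pmf.prob ?p {x. agrees S u x} = measure_pmf.prob (map_pmf (rotate s) ?p) {x. agrees S u x}"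
      by (simp only: eden_rotate[OF q])
    also have "\<dots> = measure_pmf.prob ?p {x. agrees S u (rotate s x)}"
      by (simp add: vimage_def)
    also have "\<dots> = measure_pmf.prob ?p {x. agrees (?\<sigma> ` S) u' x}"
    proof (rule measure_pmf.finite_measure_eq_AE)
      show "AE x in ?p. x \<in> {x. agrees S u (rotate s x)} \<longleftrightarrow> x \<in> {x. agrees (?\<sigma> ` S) u' x}"
        unfolding AE_measure_pmf_iff
      proof
        fix x assume "x \<in> set_pmf ?p"
        then have len: "length x = ?m" using eden_support(1)[OF q] by (simp add: words_def)
        have "rotate s x ! i = x ! ?\<sigma> i" "u' (?\<sigma> i) = u i" if "i \<in> S" for i
        proof -
          have "i < ?m" using that S by auto
          then show "rotate s x ! i = x ! ?\<sigma> i" "u' (?\<sigma> i) = u i"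
            using len u' by (simp_all add: nth_rotate)
        qed
        then show "x \<in> {x. agrees S u (rotate s x)} \<longleftrightarrow> x \<in> {x. agrees (?\<sigma> ` S) u' x}"
          by (simp add: agrees_def)
      qed
    qed simp_all
    finally show ?thesis .
  qed
  have "measure_pmf.prob ?p {x. agrees (?\<sigma> ` A \<union> ?\<sigma> ` B) u' x} =
      measure_pmf.prob ?p {x. agrees (?\<sigma> ` A) u' x} * measure_pmf.prob ?p {x. agrees (?\<sigma> ` B) u' x}"
  proof (rule prefix_independence[OF kq])
    show "?\<sigma> ` A \<subseteq> {..<?m - k}" "?\<sigma> ` B \<subseteq> {..<?m - k}" using s by blast+
    show "a' + k < b' \<or> b' + k < a'" if ab: "a' \<in> ?\<sigma> ` A" "b' \<in> ?\<sigma> ` B" for a' b'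
    proof -
      obtain a b where "a \<in> A" "b \<in> B" "a' = ?\<sigma> a" "b' = ?\<sigma> b" using ab by blast
      then show ?thesis using circular_far_shift[OF far _ _ sub, of a b s] by simp
    qed
  qed
  moreover have "A \<union> B \<subseteq> {..<?m}" using sub by blast
  ultimately show ?thesis
    using rot[OF sub(1)] rot[OF sub(2)] rot[of "A \<union> B"] by (simp only: image_Un)
qed

lemma cycle_edges_power:
  assumes i: "i \<in> {1..m}" and m: "m > 0"
  shows "(i, (i - 1 + d) mod m + 1) \<in> cycle_edges m ^^ d \<and> ((i - 1 + d) mod m + 1, i) \<in> cycle_edges m ^^ d"
proof (induction d)
  case 0
  have "i - 1 < m" using i by auto
  then show ?case using i by simp
next
  case (Suc d)
  let ?v = "(i - 1 + d) mod m + 1" and ?w = "(i - 1 + Suc d) mod m + 1"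
  have "?v \<in> {1..m}" "?w \<in> {1..m}" using m mod_less_divisor[of m] by (simp_all add: Suc_leI)
  moreover have "?w mod m = (?v + 1) mod m"
    by (simp add: mod_Suc_eq mod_simps)
  ultimately have "(?v, ?w) \<in> cycle_edges m" "(?w, ?v) \<in> cycle_edges m"
    by (auto simp: cycle_edges_def)
  then show ?case using Suc relpow_Suc_I[of i ?v] relpow_Suc_I2[of ?w ?v] by blast
qed

text \<open>Walking \<open>d\<close> steps along the cycle bounds the graph distance by
  \<open>d\<close>.\<close>

lemma circular_far_of_graph_dist:
  assumes A: "A \<subseteq> {1..m}" and B: "B \<subseteq> {1..m}"
    and far: "\<forall>a\<in>A. \<forall>b\<in>B. graph_dist (cycle_edges m) a b > enat k"
  shows "circular_far m k ((\<lambda>v. v - 1) ` A) ((\<lambda>v. v - 1) ` B)"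
  unfolding circular_far_def
proof (intro ballI allI impI)
  fix a' b' d assume "a' \<in> (\<lambda>v. v - 1) ` A" "b' \<in> (\<lambda>v. v - 1) ` B" and d: "d \<le> k"
  then obtain a b where ab: "a \<in> A" "b \<in> B" "a' = a - 1" "b' = b - 1" by blast
  have ab1: "a \<in> {1..m}" "b \<in> {1..m}" using ab A B by auto
  then have m: "m > 0" by auto
  have no: "(a, b) \<notin> cycle_edges m ^^ d"
  proof
    assume "(a, b) \<in> cycle_edges m ^^ d"
    then have "graph_dist (cycle_edges m) a b \<le> enat d"
      unfolding graph_dist_def by (intro INF_lower) simp
    also have "\<dots> \<le> enat k" using d by simp
    finally show False using far ab by (meson leD)
  qed
  have "(a' + d) mod m \<noteq> b'"
  proof
    assume "(a' + d) mod m = b'"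
    then have "(a - 1 + d) mod m + 1 = b" using ab ab1 by simp
    then show False using cycle_edges_power[OF ab1(1) m, of d] no by simp
  qed
  moreover have "(b' + d) mod m \<noteq> a'"
  proof
    assume "(b' + d) mod m = a'"
    then have "(b - 1 + d) mod m + 1 = a" using ab ab1 by simp
    then show False using cycle_edges_power[OF ab1(2) m, of d] no by simp
  qed
  ultimately show "(a' + d) mod m \<noteq> b' \<and> (b' + d) mod m \<noteq> a'" by blast
qed

lemma emeasure_pair_pmf_Times:
  "emeasure (measure_pmf (pair_pmf p r)) (S \<times> T) = emeasure (measure_pmf p) S * emeasure (measure_pmf r) T"
proof -
  have "emeasure (measure_pmf (pair_pmf p r)) (S \<times> T) = (\<integral>\<^sup>+x. indicator (S \<times> T) x \<partial>pair_pmf p r)" by simp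
  also have "\<dots> = (\<integral>\<^sup>+a. \<integral>\<^sup>+b. indicator S a * indicator T b \<partial>r \<partial>p)"
    unfolding nn_integral_pair_pmf' by (simp add: indicator_times)
  also have "\<dots> = emeasure (measure_pmf p) S * emeasure (measure_pmf r) T"
    by (simp add: nn_integral_cmult nn_integral_multc)
  finally show ?thesis .
qed

text \<open>On a discrete space independence is the factorization of the joint law; the
  sigma-algebras of the targets need not be discrete.\<close>

lemma pmf_indep_varI:
  assumes joint: "map_pmf (\<lambda>\<omega>. (f \<omega>, g \<omega>)) p = pair_pmf (map_pmf f p) (map_pmf g p)"
    and range: "range f \<subseteq> space M" "range g \<subseteq> space N"
  shows "prob_space.indep_var (measure_pmf p) M f N g"
proof -
  note P = measure_pmf.prob_space_axioms[of p]
  have meas: "f \<in> measurable (measure_pmf p) M" "g \<in> measurable (measure_pmf p) N"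
    using range by auto
  have "measure_pmf.prob p (f -` S \<inter> g -` T) = measure_pmf.prob p (f -` S) * measure_pmf.prob p (g -` T)" for S T
  proof -
    have "emeasure (measure_pmf p) (f -` S \<inter> g -` T) = emeasure (measure_pmf (map_pmf (\<lambda>\<omega>. (f \<omega>, g \<omega>)) p)) (S \<times> T)"
      by (simp add: vimage_def Int_def)
    also have "\<dots> = emeasure (measure_pmf p) (f -` S) * emeasure (measure_pmf p) (g -` T)"
      unfolding joint emeasure_pair_pmf_Times by simp
    finally show ?thesis by (simp add: measure_def enn2real_mult)
  qed
  then have "prob_space.indep_set (measure_pmf p) {f -` S \<inter> space (measure_pmf p) |S. S \<in> sets M}
      {g -` T \<inter> space (measure_pmf p) |T. T \<in> sets N}"
    by (intro prob_space.indep_setI[OF P]) auto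
  moreover have "(\<lambda>i. {case_bool f g i -` S \<inter> space (measure_pmf p) |S. S \<in> sets (case_bool M N i)}) =
      case_bool {f -` S \<inter> space (measure_pmf p) |S. S \<in> sets M}
        {g -` T \<inter> space (measure_pmf p) |T. T \<in> sets N}"
    by (rule ext) (simp split: bool.split)
  moreover have "\<forall>i\<in>UNIV. case_bool f g i \<in> measurable (measure_pmf p) (case_bool M N i)"
    using meas by (simp add: UNIV_bool)
  ultimately show ?thesis
    unfolding prob_space.indep_var_def[OF P] prob_space.indep_vars_def2[OF P] prob_space.indep_set_def[OF P] by simp
qed

text \<open>The two sets are disjoint because a vertex has distance \<open>0\<close> from itself.
  So values prescribed on each of them combine into a single assignment, to which
  \<open>cycle_independence\<close> applies.\<close>

lemma eden_k_dependent:
  assumes kq: "(k, q) \<in> {(1, 4), (2, 3)}"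
  shows "k_dependent (measure_pmf (eden_cycle_coloring q (Suc n))) {1..n + 3} (cycle_edges (n + 3)) k C"
  unfolding k_dependent_def
proof (intro allI impI)
  fix A B assume A: "A \<subseteq> {1..n + 3}" and B: "B \<subseteq> {1..n + 3}"
    and far: "\<forall>a\<in>A. \<forall>b\<in>B. graph_dist (cycle_edges (n + 3)) a b > enat k"
  let ?p = "eden_cycle_coloring q (Suc n)"
  let ?f = "\<lambda>\<omega>. \<lambda>v\<in>A. C v \<omega>" and ?g = "\<lambda>\<omega>. \<lambda>v\<in>B. C v \<omega>"
  let ?A = "(\<lambda>v. v - 1) ` A" and ?B = "(\<lambda>v. v - 1) ` B"
  have circ: "circular_far (n + 3) k ?A ?B"
    by (rule circular_far_of_graph_dist[OF A B far])
  have sub: "?A \<subseteq> {..<n + 3}" "?B \<subseteq> {..<n + 3}" using A B by fastforce+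
  have disj: "v \<notin> B" if "v \<in> A" for v
  proof
    assume "v \<in> B"
    then have "graph_dist (cycle_edges (n + 3)) v v > enat k" using far that by blast
    moreover have "graph_dist (cycle_edges (n + 3)) v v \<le> enat 0"
      unfolding graph_dist_def by (intro INF_lower) simp
    ultimately show False by (simp add: zero_enat_def[symmetric])
  qed
  have "map_pmf (\<lambda>\<omega>. (?f \<omega>, ?g \<omega>)) ?p = pair_pmf (map_pmf ?f ?p) (map_pmf ?g ?p)"
  proof (rule pmf_eqI)
    fix y :: "(nat \<Rightarrow> nat) \<times> (nat \<Rightarrow> nat)"
    obtain \<alpha> \<beta> where y: "y = (\<alpha>, \<beta>)" by fastforce
    have f_eq: "?f \<omega> = \<alpha> \<longleftrightarrow> (\<forall>v\<in>A. C v \<omega> = \<alpha> v)" if "\<alpha> \<in> extensional A" for \<omega>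
      using that by (auto simp: fun_eq_iff extensional_def restrict_def)
    have g_eq: "?g \<omega> = \<beta> \<longleftrightarrow> (\<forall>v\<in>B. C v \<omega> = \<beta> v)" if "\<beta> \<in> extensional B" for \<omega>
      using that by (auto simp: fun_eq_iff extensional_def restrict_def)
    have lhs: "pmf (map_pmf (\<lambda>\<omega>. (?f \<omega>, ?g \<omega>)) ?p) y = measure_pmf.prob ?p {\<omega>. ?f \<omega> = \<alpha> \<and> ?g \<omega> = \<beta>}"
      by (simp add: pmf_map y vimage_def)
    have rhs: "pmf (pair_pmf (map_pmf ?f ?p) (map_pmf ?g ?p)) y =
        measure_pmf.prob ?p {\<omega>. ?f \<omega> = \<alpha>} * measure_pmf.prob ?p {\<omega>. ?g \<omega> = \<beta>}"
      by (simp add: pmf_pair pmf_map y vimage_def)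
    show "pmf (map_pmf (\<lambda>\<omega>. (?f \<omega>, ?g \<omega>)) ?p) y = pmf (pair_pmf (map_pmf ?f ?p) (map_pmf ?g ?p)) y"
    proof (cases "\<alpha> \<in> extensional A \<and> \<beta> \<in> extensional B")
      case False
      then have "{\<omega>. ?f \<omega> = \<alpha>} = {} \<or> {\<omega>. ?g \<omega> = \<beta>} = {}" by auto
      moreover from this have "{\<omega>. ?f \<omega> = \<alpha> \<and> ?g \<omega> = \<beta>} = {}" by blast
      ultimately show ?thesis unfolding lhs rhs by auto
    next
      case True
      \<comment> \<open>positions of a list start at \<open>0\<close>, vertices of the cycle at \<open>1\<close>\<close>
      define u where "u i = (if Suc i \<in> A then \<alpha> (Suc i) else \<beta> (Suc i))" for i
      have A_agrees: "(\<forall>v\<in>A. C v \<omega> = \<alpha> v) \<longleftrightarrow> agrees ?A u \<omega>" for \<omega>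
      proof -
        have "C v \<omega> = \<alpha> v \<longleftrightarrow> \<omega> ! (v - 1) = u (v - 1)" if "v \<in> A" for v
        proof -
          have "Suc (v - 1) = v" using that A by fastforce
          then show ?thesis using that by (simp add: u_def C_def)
        qed
        then show ?thesis by (simp add: agrees_def)
      qed
      have B_agrees: "(\<forall>v\<in>B. C v \<omega> = \<beta> v) \<longleftrightarrow> agrees ?B u \<omega>" for \<omega>
      proof -
        have "C v \<omega> = \<beta> v \<longleftrightarrow> \<omega> ! (v - 1) = u (v - 1)" if "v \<in> B" for v
        proof -
          have "Suc (v - 1) = v" using that B by fastforce
          moreover have "v \<notin> A" using disj that by blast
          ultimately show ?thesis by (simp add: u_def C_def)
        qed
        then show ?thesis by (simp add: agrees_def)
      qed
      have eqs: "{\<omega>. ?f \<omega> = \<alpha>} = {\<omega>. agrees ?A u \<omega>}" "{\<omega>. ?g \<omega> = \<beta>} = {\<omega>. agrees ?B u \<omega>}"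
        using True f_eq g_eq A_agrees B_agrees by auto
      have "{\<omega>. ?f \<omega> = \<alpha> \<and> ?g \<omega> = \<beta>} = {\<omega>. ?f \<omega> = \<alpha>} \<inter> {\<omega>. ?g \<omega> = \<beta>}" by blast
      also have "\<dots> = {\<omega>. agrees (?A \<union> ?B) u \<omega>}" unfolding eqs by (auto simp: agrees_def)
      finally show ?thesis
        unfolding lhs rhs eqs using cycle_independence[OF kq circ sub] by simp
    qed
  qed
  then show "prob_space.indep_var (measure_pmf ?p) (Pi\<^sub>M A (\<lambda>_. count_space UNIV)) ?f
      (Pi\<^sub>M B (\<lambda>_. count_space UNIV)) ?g"
    by (rule pmf_indep_varI) (auto simp: space_PiM)
qed

section \<open>Comparison with the Holroyd--Liggett coloring\<close>

lemma measurable_initial_word: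
  assumes X: "\<And>i. X i \<in> measurable M (count_space UNIV)"
  shows "initial_word X N \<in> measurable M (count_space UNIV)"
proof (induction N)
  case 0
  then show ?case by (simp add: initial_word_def[abs_def])
next
  case (Suc N)
  note [measurable] = Suc X
  have "(\<lambda>\<omega>. (initial_word X N \<omega>, X (int (Suc N)) \<omega>)) \<in> measurable M (count_space UNIV)"
    by measurable
  then have "(\<lambda>\<omega>. (\<lambda>(xs, x). xs @ [x]) (initial_word X N \<omega>, X (int (Suc N)) \<omega>)) \<in> measurable M (count_space UNIV)"
    by (rule measurable_compose) simp
  moreover have "initial_word X (Suc N) = (\<lambda>\<omega>. (\<lambda>(xs, x). xs @ [x]) (initial_word X N \<omega>, X (int (Suc N)) \<omega>))"
    by (simp add: initial_word_def fun_eq_iff)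
  ultimately show ?case by simp
qed

text \<open>Both laws are proportional to \<open>B_lin\<close> on the words of length \<open>n + 3
  - k\<close>. The law on the cycle has total mass one, which identifies its constant as the
  normalization \<open>Z_lin\<close> and shows that this normalization is not zero; hence the
  words carry the whole mass of the other law as well.\<close>

lemma eden_holroyd_liggett:
  fixes M :: "'o measure"
  assumes kq: "(k, q) \<in> {(1, 4), (2, 3)}" and HL: "holroyd_liggett_coloring q M X"
  shows "distr (measure_pmf (eden_cycle_coloring q (Suc n))) (count_space UNIV) (take (n + 3 - k)) =
    distr M (count_space UNIV) (initial_word X (n + 3 - k))"
proof -
  let ?p = "eden_cycle_coloring q (Suc n)" and ?N = "n + 3 - k"
  let ?W = "words q ?N"
  have q: "q \<ge> 3" using kq by auto
  obtain L where L: "\<And>P. measure_pmf.prob ?p {x. P (take ?N x)} = L * (\<Sum>z\<in>?W. of_bool (P z) * real (B_lin z))"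
    by (rule eden_prefix[OF kq, where n = n]) blast
  have one: "L * real (Z_lin ?N q) = 1"
    using L[of "\<lambda>_. True"] by (simp add: Z_lin_def)
  have "real (Z_lin ?N q) \<noteq> 0" using one by (metis mult_zero_right zero_neq_one)
  then have L_eq: "L = 1 / real (Z_lin ?N q)" by (rule nonzero_eq_divide_eq[THEN iffD2, OF _ one])
  let ?D1 = "distr (measure_pmf ?p) (count_space UNIV) (take ?N)"
  let ?D2 = "distr M (count_space UNIV) (initial_word X ?N)"
  interpret M: prob_space M using HL by (simp add: holroyd_liggett_coloring_def)
  have meas: "initial_word X ?N \<in> measurable M (count_space UNIV)"
    using HL by (intro measurable_initial_word) (simp add: holroyd_liggett_coloring_def)
  interpret D1: prob_space ?D1 by (rule measure_pmf.prob_space_distr) simp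
  interpret D2: prob_space ?D2 by (rule M.prob_space_distr[OF meas])
  have words: "measure ?D1 {z} = measure ?D2 {z}" if z: "z \<in> ?W" for z
  proof -
    have "measure ?D1 {z} = measure_pmf.prob ?p {x. take ?N x = z}"
      by (simp add: measure_distr vimage_def)
    also have "\<dots> = L * real (B_lin z)"
      unfolding L[of "\<lambda>y. y = z"] using z by (simp add: of_bool_def if_distrib[of "\<lambda>c. c * _"] cong: if_cong)
    also have "\<dots> = real (B_lin z) / real (Z_lin ?N q)" unfolding L_eq by simp
    also have "\<dots> = measure M {\<omega> \<in> space M. initial_word X ?N \<omega> = z}"
      using HL z by (simp add: holroyd_liggett_coloring_def)
    also have "\<dots> = measure ?D2 {z}"
      by (simp add: measure_distr[OF meas] vimage_def Int_def conj_commute)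
    finally show ?thesis .
  qed
  have total1: "measure ?D1 ?W = 1"
  proof -
    have "measure ?D1 ?W = measure_pmf.prob ?p {x. take ?N x \<in> ?W}"
      by (simp add: measure_distr vimage_def)
    also have "\<dots> = L * real (Z_lin ?N q)"
      unfolding L[of "\<lambda>y. y \<in> ?W"] Z_lin_def by simp
    finally show ?thesis using one by simp
  qed
  have "measure ?D2 ?W = measure ?D1 ?W"
    using words D1.finite_measure_eq_sum_singleton[of ?W] D2.finite_measure_eq_sum_singleton[of ?W] by simp
  then have total2: "measure ?D2 ?W = 1" using total1 by simp
  have outside: "measure D {z} = 0" if "prob_space D" "sets D = UNIV" "measure D ?W = 1" "z \<notin> ?W" for D z
  proof -
    interpret D: prob_space D by fact
    have "measure D ({z} \<union> ?W) = measure D {z} + measure D ?W"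
      using that(2,4) by (intro D.finite_measure_Union) auto
    then show ?thesis using D.prob_le_1[of "{z} \<union> ?W"] that(3) measure_nonneg[of D "{z}"] by simp
  qed
  have "measure ?D1 {z} = measure ?D2 {z}" for z
  proof (cases "z \<in> ?W")
    case False
    have "measure ?D1 {z} = 0" using total1 False by (intro outside D1.prob_space_axioms) auto
    moreover have "measure ?D2 {z} = 0" using total2 False by (intro outside D2.prob_space_axioms) auto
    ultimately show ?thesis by simp
  qed (rule words)
  then show ?thesis
    by (intro measure_eqI_countable[where A = UNIV])
       (auto simp: D1.emeasure_eq_measure D2.emeasure_eq_measure)
qed

theorem theorem1:
  fixes n k q :: nat
  assumes "n \<ge> 1"
    and "(k, q) \<in> {(1, 4), (2, 3)}"
  shows
    "(AE xs in measure_pmf (eden_cycle_coloring q n).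
        proper_coloring {1..n + 2} (cycle_edges (n + 2)) q (\<lambda>i. C i xs)) \<and>
     k_dependent (measure_pmf (eden_cycle_coloring q n)) {1..n + 2} (cycle_edges (n + 2)) k C \<and>
     (\<forall>r. map_pmf (rotate r) (eden_cycle_coloring q n) = eden_cycle_coloring q n) \<and>
     (\<forall>r. map_pmf (\<lambda>xs. rotate r (rev xs)) (eden_cycle_coloring q n) = eden_cycle_coloring q n) \<and>
     (\<forall>\<pi>. \<pi> permutes {1..q} \<longrightarrow>
        map_pmf (map \<pi>) (eden_cycle_coloring q n) = eden_cycle_coloring q n) \<and>
     (\<forall>(M :: 'o measure) X. holroyd_liggett_coloring q M X \<longrightarrow>
        distr (measure_pmf (eden_cycle_coloring q n)) (count_space UNIV) (take (n + 2 - k)) =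
        distr M (count_space UNIV) (initial_word X (n + 2 - k)))"
proof -
  obtain n' where n: "n = Suc n'" using assms(1) by (cases n) auto
  have m: "n + 2 = n' + 3" using n by simp
  have q: "q \<ge> 3" using assms(2) by auto
  have "AE xs in measure_pmf (eden_cycle_coloring q n).
      proper_coloring {1..n' + 3} (cycle_edges (n' + 3)) q (\<lambda>i. C i xs)"
    unfolding AE_measure_pmf_iff n using eden_support[OF q] proper_coloring_cycle by blast
  moreover have "map_pmf (\<lambda>xs. rotate r (rev xs)) (eden_cycle_coloring q n) = eden_cycle_coloring q n" for r
  proof -
    have "map_pmf (\<lambda>xs. rotate r (rev xs)) (eden_cycle_coloring q n) =
        map_pmf (rotate r) (map_pmf rev (eden_cycle_coloring q n))"
      by (simp add: pmf.map_comp comp_def)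
    then show ?thesis by (simp only: n eden_reflect[OF q] eden_rotate[OF q])
  qed
  ultimately show ?thesis
    using eden_k_dependent[OF assms(2), of n'] eden_rotate[OF q, of _ n'] eden_permute[OF q, of _ n']
      eden_holroyd_liggett[OF assms(2), where n = n']
    unfolding m by (simp only: n simp_thms) blast
qed

end
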